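(* Let $\nu,\mu\in\mathbb{C}$ and $x\in\mathbb{C}\setminus((-\infty,-1]\cup[1,\infty))$, with parameters such that the integral below converges. Then $$[\mathsf{Q}_\nu^{-\mu}(x)]^2+\frac{\pi^2}{4}[\mathsf{P}_\nu^{-\mu}(x)]^2=\frac{\sqrt{\pi}\,e^{i\pi\mu}}{2^\mu\Gamma(\mu+\frac12)(1-x^2)^{\mu}}\int_1^\infty Q_\nu^{-\mu}(w)\,\frac{(w-1)^{\frac{\mu-1}{2}}}{(w+1)^{\frac{\mu}{2}}}\,(1-2x^2+w)^{\mu-\frac12}\,dw .$$
   Context: Let $\mathbf{F}(a,b;c;z)=\sum_{n\ge0}\frac{(a)_n(b)_n}{\Gamma(c+n)}\frac{z^n}{n!}$ (continued analytically to $\mathbb{C}\setminus[1,\infty)$) be the regularized Gauss hypergeometric function. Associated Legendre function of the second kind on $\mathbb{C}\setminus(-\infty,1]$: $Q_\nu^\mu(z)=\frac{\sqrt\pi\,e^{i\pi\mu}\Gamma(\nu+\mu+1)(z^2-1)^{\mu/2}}{2^{\nu+1}z^{\nu+\mu+1}}\mathbf{F}\big(\frac{\nu+\mu+1}{2},\frac{\nu+\mu+2}{2};\nu+\frac32;\frac1{z^2}\big)$ for $|z|>1$, continued analytically. Ferrers functions, for $x\in(-1,1)$: $\mathsf{P}_\nu^{\mu}(x)=\left(\frac{1+x}{1-x}\right)^{\frac12\mu}\mathbf{F}\big(-\nu,\nu+1;1-\mu;\frac{1-x}{2}\big)$ and $\mathsf{Q}_\nu^\mu(x)=\frac12e^{-i\pi\mu}\big(e^{-\frac12i\pi\mu}Q_\nu^\mu(x+i0)+e^{\frac12i\pi\mu}Q_\nu^\mu(x-i0)\big)$;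 both are extended analytically to $\mathbb{C}\setminus((-\infty,-1]\cup[1,\infty))$. Convention: the basic range is $x\in(-1,1)$ real (powers of positive numbers positive for real exponents); for complex $x$ both sides are understood by analytic continuation. Parameters are assumed such that all functions are defined. *)

theory Defs
  imports "HOL-Complex_Analysis.Complex_Analysis"
begin

text \<open>
  In all uses below, \<open>B\<close> is open and connected and \<open>A \<subseteq> B\<close> has a limit point in \<open>B\<close>, so by the
  identity theorem at most one choice is possible on \<open>B\<close>. Values outside \<open>B\<close> are unspecified.
\<close>
definition analytic_continuation ::
    "complex set \<Rightarrow> complex set \<Rightarrow> (complex \<Rightarrow> complex) \<Rightarrow> complex \<Rightarrow> complex" where
  "analytic_continuation A B f = (SOME g. g holomorphic_on B \<and> (\<forall>z\<in>A. g z = f z))"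

definition hyp2F1_reg :: "complex \<Rightarrow> complex \<Rightarrow> complex \<Rightarrow> complex \<Rightarrow> complex" where
  "hyp2F1_reg a b c =
     analytic_continuation (ball 0 1) (- complex_of_real ` {1..})
       (\<lambda>z. \<Sum>n. pochhammer a n * pochhammer b n * rGamma (c + of_nat n) * z ^ n / fact n)"

text \<open>
  The branch of \<open>(z\<^sup>2 - 1)\<^bsup>\<mu>/2\<^esup>\<close> is \<open>(z - 1)\<^bsup>\<mu>/2\<^esup> (z + 1)\<^bsup>\<mu>/2\<^esup>\<close> with principal powers: it is analytic off
  \<open>(-\<infinity>, 1]\<close> and positive for real \<open>\<mu>\<close> and \<open>z > 1\<close>, whereas the principal power of \<open>z\<^sup>2 - 1\<close>
  jumps across the imaginary axis. Meaningful only when \<open>\<nu> + \<mu> + 1\<close> is not a pole of the Gamma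
  function.
\<close>
definition legendreQ :: "complex \<Rightarrow> complex \<Rightarrow> complex \<Rightarrow> complex" where
  "legendreQ \<nu> \<mu> =
     analytic_continuation {z. norm z > 1 \<and> z \<notin> \<real>\<^sub>\<le>\<^sub>0} (- complex_of_real ` {..1})
       (\<lambda>z. of_real (sqrt pi) * exp (\<i> * of_real pi * \<mu>) * Gamma (\<nu> + \<mu> + 1) *
            ((z - 1) powr (\<mu> / 2) * (z + 1) powr (\<mu> / 2)) /
            (2 powr (\<nu> + 1) * z powr (\<nu> + \<mu> + 1)) *
            hyp2F1_reg ((\<nu> + \<mu> + 1) / 2) ((\<nu> + \<mu> + 2) / 2) (\<nu> + 3 / 2) (1 / z\<^sup>2))"

definition ferrers_domain :: "complex set" where
  "ferrers_domain = - (complex_of_real ` ({..-1} \<union> {1..}))"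

text \<open>
  On \<^const>\<open>ferrers_domain\<close> the quotient \<open>(1 + x) / (1 - x)\<close> avoids \<open>(-\<infinity>, 0]\<close> and \<open>(1 - x) / 2\<close> avoids
  \<open>[1, \<infinity>)\<close>, so this formula is already the analytic extension from \<open>(-1, 1)\<close>.
\<close>
definition ferrersP :: "complex \<Rightarrow> complex \<Rightarrow> complex \<Rightarrow> complex" where
  "ferrersP \<nu> \<mu> x =
     ((1 + x) / (1 - x)) powr (\<mu> / 2) * hyp2F1_reg (- \<nu>) (\<nu> + 1) (1 - \<mu>) ((1 - x) / 2)"

definition ferrersQ :: "complex \<Rightarrow> complex \<Rightarrow> complex \<Rightarrow> complex" where
  "ferrersQ \<nu> \<mu> =
     analytic_continuation (complex_of_real ` {-1<..<1}) ferrers_domain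
       (\<lambda>x. 1 / 2 * exp (- \<i> * of_real pi * \<mu>) *
            (exp (- \<i> * of_real pi * \<mu> / 2) *
               Lim (at_right (0::real)) (\<lambda>\<epsilon>. legendreQ \<nu> \<mu> (x + \<i> * of_real \<epsilon>)) +
             exp (\<i> * of_real pi * \<mu> / 2) *
               Lim (at_right (0::real)) (\<lambda>\<epsilon>. legendreQ \<nu> \<mu> (x - \<i> * of_real \<epsilon>))))"

text \<open>
  For \<open>x\<close> in \<^const>\<open>ferrers_domain\<close> and \<open>w \<ge> 1\<close> the number \<open>1 - 2x\<^sup>2 + w\<close> avoids \<open>(-\<infinity>, 0]\<close>, so the
  principal power is the analytic continuation from real \<open>x\<close>.
\<close>
definition legendre_integrand :: "complex \<Rightarrow> complex \<Rightarrow> complex \<Rightarrow> real \<Rightarrow> complex" where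
  "legendre_integrand \<nu> \<mu> x w =
     legendreQ \<nu> (- \<mu>) (of_real w) *
     (of_real (w - 1) powr ((\<mu> - 1) / 2) / of_real (w + 1) powr (\<mu> / 2)) *
     (1 - 2 * x\<^sup>2 + of_real w) powr (\<mu> - 1 / 2)"

end

(*
  Put lam = nu + mu + 1, m = mu + 1/2, x = cos theta, and Phi = F(lam, m; lam - m + 1; -).  By
  Euler's and a quadratic transformation of F, the boundary values of Q_nu^{-mu} at x + i0 and x - i0
  are elementary multiples of the branches B_{+-} = e^{-+ i lam theta} Phi(e^{-+ 2 i theta}).
  So the Ferrers function Q is a combination of B_+ and B_-.  The difference combination is a
  multiple of the Ferrers function P: integrating (1 - C^2)^{m-1} (cos theta + i sin theta C)^{-lam}
  along the edge of the half plane in which it is analytic gives zero, and the three parts of the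
  line (cut at -1 and 1) give B_+, B_- and a function which a second quadratic transformation
  identifies with P.  Hence the left-hand side is a constant times (1 - x^2)^mu B_+ B_-.

  The product Phi(x) Phi(y) is a beta-type integral with kernel
  P^{-lam} F(lam/2, (lam+1)/2; lam-m+1; 4 x y (1-t)^2 / P^2), P = 1 + x y - (x + y) t:
  as a function of y both sides solve the hypergeometric equation.  For y the conjugate of x and |x|
  tending to 1, the substitution w = 1 + 2 (1 - x^2) t / (1 - t) turns this into the claim for real x
  in (0, 1), and the identity theorem gives complex x.

  The integral converges only if Re mu > -1/2 and Re (nu - mu) > -1, by the asymptotics of the
  integrand at 1 and at infinity; if nu + 3/2 is a pole of Gamma, nu is first replaced by -1 - nu.
*)
theory Submission
  imports Defs "HOL-Real_Asymp.Real_Asymp"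
begin

text \<open>In terms of lam and m the range of convergence is Re m > 0 and Re (lam - 2 m + 1) > 0,
  exactly where the beta-type integrals over (0, 1) converge, so the argument runs at fixed \<nu>
  and \<mu>. The transformations share one pattern: a candidate solves a hypergeometric equation and
  is regular at 0, where such a solution is determined by its value if c is not a pole of Gamma;
  what remains is polynomial algebra. Three obstacles shape the rest. The functions are picked by a
  choice operator, so a holomorphic extension has to be exhibited before anything is known about
  them. For |x| = 1 and y the conjugate of x, the hypergeometric factor of the product kernel
  reaches its singular point 1 at t = 0; the formula is therefore proved inside the disc and carried
  to the circle by dominated convergence. Finally, convergence means gauge integrability, which
  permits cancellation; to deduce the range of parameters, oscillation has to be excluded by lower
  bounds on integrals. That step needs a nonzero leading coefficient at infinity, which is what
  fails when 1 / Gamma (\<nu> + 3/2) = 0.\<close>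

section \<open>Integrals depending on a parameter\<close>

text \<open>Differentiation under the integral sign with a merely local dominating function.
  Cauchy's inequality on small discs turns the bound g on f into the bound g / R on the derivative,
  hence on the difference quotients, and dominated convergence applies.\<close>

lemma holomorphic_integral:
  fixes f :: "complex \<Rightarrow> real \<Rightarrow> complex"
  assumes A: "A \<in> sets lebesgue" and S: "open S"
    and cont: "\<And>z. z \<in> S \<Longrightarrow> continuous_on A (f z)"
    and hol: "\<And>t. t \<in> A \<Longrightarrow> (\<lambda>z. f z t) holomorphic_on S"
    and dom: "\<And>z. z \<in> S \<Longrightarrow> \<exists>r>0. \<exists>g. ball z r \<subseteq> S \<and> g integrable_on A \<and>
                 (\<forall>w\<in>ball z r. \<forall>t\<in>A. norm (f w t) \<le> g t)"
    and z: "z \<in> S"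
  shows "f z absolutely_integrable_on A"
    and "(\<lambda>t. deriv (\<lambda>w. f w t) z) absolutely_integrable_on A"
    and "((\<lambda>z. integral A (f z)) has_field_derivative integral A (\<lambda>t. deriv (\<lambda>w. f w t) z)) (at z)"
proof -
  have abs: "f w absolutely_integrable_on A" if w: "w \<in> S" for w
  proof -
    obtain r g where rg: "r > 0" "g integrable_on A" "\<forall>v\<in>ball w r. \<forall>t\<in>A. norm (f v t) \<le> g t"
      using dom[OF w] by blast
    show ?thesis
    proof (rule measurable_bounded_by_integrable_imp_absolutely_integrable[OF _ A rg(2)])
      show "f w \<in> borel_measurable (lebesgue_on A)"
        using cont[OF w] A by (rule continuous_imp_measurable_on_sets_lebesgue)
    qed (use rg in auto)
  qed
  show "f z absolutely_integrable_on A" using abs z .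
  obtain r g where r: "r > 0" and rS: "ball z r \<subseteq> S" and g: "g integrable_on A"
    and bd: "\<And>v t. v \<in> ball z r \<Longrightarrow> t \<in> A \<Longrightarrow> norm (f v t) \<le> g t"
    using dom[OF z] by blast
  \<comment> \<open>With a quarter of the radius, a closed disc of radius \<open>R\<close> around
    any point of \<open>ball z R\<close> still lies in \<open>ball z r\<close>, where g
    dominates.\<close>
  define R where "R = r / 4"
  have R: "R > 0" using r by (simp add: R_def)
  have der: "((\<lambda>w. f w t) has_field_derivative deriv (\<lambda>w. f w t) v) (at v)" if "t \<in> A" "v \<in> S" for t v
    using hol[OF that(1)] S that(2) holomorphic_derivI by blast
  have dbd: "norm (deriv (\<lambda>w. f w t) v) \<le> g t / R" if t: "t \<in> A" and v: "v \<in> ball z R" for t v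
  proof -
    have sub: "cball v R \<subseteq> ball z r"
    proof
      fix y assume "y \<in> cball v R"
      then show "y \<in> ball z r" using v dist_triangle[of z y v] r by (auto simp: R_def)
    qed
    have h: "(\<lambda>w. f w t) holomorphic_on cball v R"
      using hol[OF t] sub rS holomorphic_on_subset by (meson subset_trans)
    have "norm ((deriv ^^ 1) (\<lambda>w. f w t) v) \<le> fact 1 * g t / R ^ 1"
    proof (rule Cauchy_inequality)
      show "(\<lambda>w. f w t) holomorphic_on ball v R" using h holomorphic_on_subset ball_subset_cball by blast
      show "continuous_on (cball v R) (\<lambda>w. f w t)" using h holomorphic_on_imp_continuous_on by blast
      show "norm (f x t) \<le> g t" if "norm (v - x) = R" for x
        using sub that t by (intro bd) (auto simp: dist_norm)
    qed (use R in auto)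
    then show ?thesis by simp
  qed
  have lip: "norm (f w t - f z t) \<le> g t / R * norm (w - z)" if t: "t \<in> A" and w: "w \<in> ball z R" for t w
  proof (rule field_differentiable_bound[of "ball z R" "\<lambda>w. f w t" "\<lambda>v. deriv (\<lambda>w. f w t) v"])
    show "((\<lambda>w. f w t) has_field_derivative deriv (\<lambda>w. f w t) v) (at v within ball z R)"
      if "v \<in> ball z R" for v
    proof -
      have "v \<in> S" using that rS R r by (auto simp: R_def subset_iff)
      then show ?thesis using der[OF t] has_field_derivative_at_within by blast
    qed
  qed (use dbd t w R in auto)
  \<comment> \<open>Dominated convergence is a statement about sequences, so the limit of the
    difference quotients is taken along an arbitrary null sequence of nonzero increments.\<close>
  have main: "(\<lambda>t. deriv (\<lambda>w. f w t) z) integrable_on A \<and>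
     (\<lambda>n. (integral A (f (z + h n)) - integral A (f z)) / h n) \<longlonglongrightarrow> integral A (\<lambda>t. deriv (\<lambda>w. f w t) z)"
    if h0: "\<And>n. h n \<noteq> 0" and h: "h \<longlonglongrightarrow> 0" and hR: "\<And>n. norm (h n) < R" for h :: "nat \<Rightarrow> complex"
  proof -
    have inS: "z + h n \<in> S" for n
      using rS hR[of n] r by (auto simp: R_def subset_iff dist_norm)
    have intg: "(\<lambda>t. (f (z + h n) t - f z t) / h n) integrable_on A" for n
      using abs[OF inS[of n]] abs[OF z]
      by (intro integrable_on_divide integrable_diff) (auto simp: absolutely_integrable_on_def)
    have dc: "(\<lambda>t. deriv (\<lambda>w. f w t) z) integrable_on A \<and>
       (\<lambda>n. integral A (\<lambda>t. (f (z + h n) t - f z t) / h n)) \<longlonglongrightarrow> integral A (\<lambda>t. deriv (\<lambda>w. f w t) z)"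
    proof (intro conjI)
      have b: "norm ((f (z + h n) t - f z t) / h n) \<le> g t / R" if "t \<in> A" for t n
        using lip[OF that, of "z + h n"] hR[of n] h0[of n]
        by (simp add: norm_divide dist_norm pos_divide_le_eq)
      have lim: "(\<lambda>n. (f (z + h n) t - f z t) / h n) \<longlonglongrightarrow> deriv (\<lambda>w. f w t) z" if t: "t \<in> A" for t
      proof -
        have "((\<lambda>k. (f (z + k) t - f z t) / k) \<longlongrightarrow> deriv (\<lambda>w. f w t) z) (at 0)"
          using der[OF t z] by (simp add: DERIV_def)
        moreover have "filterlim h (at 0) sequentially"
          using h h0 by (simp add: filterlim_at)
        ultimately show ?thesis using filterlim_compose by blast
      qed
      have gi: "(\<lambda>t. g t / R) integrable_on A" using g integrable_on_divide by blast
      show "(\<lambda>t. deriv (\<lambda>w. f w t) z) integrable_on A"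
        by (rule dominated_convergence(1)[OF intg gi b lim])
      show "(\<lambda>n. integral A (\<lambda>t. (f (z + h n) t - f z t) / h n)) \<longlonglongrightarrow> integral A (\<lambda>t. deriv (\<lambda>w. f w t) z)"
        by (rule dominated_convergence(2)[OF intg gi b lim])
    qed
    have eq: "integral A (\<lambda>t. (f (z + h n) t - f z t) / h n)
        = (integral A (f (z + h n)) - integral A (f z)) / h n" for n
      using abs[OF inS[of n]] abs[OF z]
      by (simp add: integral_diff absolutely_integrable_on_def)
    show ?thesis using dc by (simp only: eq)
  qed
  \<comment> \<open>One concrete sequence of increments suffices for the integrability of the
    derivative.\<close>
  have int: "(\<lambda>t. deriv (\<lambda>w. f w t) z) integrable_on A"
  proof -
    have "(\<lambda>n. of_real (R / real (n + 2)) :: complex) \<longlonglongrightarrow> of_real 0"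
      by (intro tendsto_of_real) (real_asymp)
    moreover have "norm (of_real (R / real (n + 2)) :: complex) < R" for n
      using R by (simp only: norm_of_real) (simp add: pos_divide_less_eq)
    moreover have "(of_real (R / real (n + 2)) :: complex) \<noteq> 0" for n
      using R by (simp only: of_real_eq_0_iff) simp
    ultimately show ?thesis using main[of "\<lambda>n. of_real (R / real (n + 2))"] by simp
  qed
  have gi: "(\<lambda>t. g t / R) integrable_on A" using g integrable_on_divide by blast
  show "(\<lambda>t. deriv (\<lambda>w. f w t) z) absolutely_integrable_on A"
    by (rule absolutely_integrable_integrable_bound[OF _ int gi]) (use dbd R in auto)
  show "((\<lambda>z. integral A (f z)) has_field_derivative integral A (\<lambda>t. deriv (\<lambda>w. f w t) z)) (at z)"
    unfolding DERIV_def
  proof (subst tendsto_at_iff_sequentially, intro allI impI)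
    fix X :: "nat \<Rightarrow> complex"
    assume X0: "\<forall>i. X i \<in> UNIV - {0}" and X: "X \<longlonglongrightarrow> 0"
    obtain N where N: "\<And>n. n \<ge> N \<Longrightarrow> norm (X n) < R"
      using X R by (metis LIMSEQ_D diff_zero)
    have "(\<lambda>n. (integral A (f (z + X (n + N))) - integral A (f z)) / X (n + N)) \<longlonglongrightarrow> integral A (\<lambda>t. deriv (\<lambda>w. f w t) z)"
      using main[of "\<lambda>n. X (n + N)"] X0 N LIMSEQ_ignore_initial_segment[OF X] by auto
    then show "((\<lambda>h. (integral A (f (z + h)) - integral A (f z)) / h) \<circ> X) \<longlonglongrightarrow> integral A (\<lambda>t. deriv (\<lambda>w. f w t) z)"
      unfolding o_def using LIMSEQ_offset[of "\<lambda>n. (integral A (f (z + X n)) - integral A (f z)) / X n"] by blast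
  qed
qed

text \<open>\<open>w\<close> carries the endpoint singularities and \<open>h\<close> is continuous
  up to the endpoints. On a compact disc times [0, 1] the factor \<open>h\<close> is bounded by some
  B, so |w| B dominates. Euler's integral, the product formula and the Legendre integral are all
  brought to this form.\<close>

lemma holomorphic_weighted_integral:
  fixes w :: "real \<Rightarrow> complex" and h :: "complex \<Rightarrow> real \<Rightarrow> complex"
  assumes S: "open S" and w: "w absolutely_integrable_on {0<..<1}" "continuous_on {0<..<1} w"
    and h: "continuous_on (S \<times> {0..1}) (\<lambda>(z, t). h z t)"
    and hol: "\<And>t. t \<in> {0<..<1} \<Longrightarrow> (\<lambda>z. h z t) holomorphic_on S"
    and z: "z \<in> S"
  shows "(\<lambda>t. w t * h z t) absolutely_integrable_on {0<..<1}"
    and "(\<lambda>t. w t * deriv (\<lambda>z. h z t) z) absolutely_integrable_on {0<..<1}"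
    and "((\<lambda>z. integral {0<..<1} (\<lambda>t. w t * h z t)) has_field_derivative
            integral {0<..<1} (\<lambda>t. w t * deriv (\<lambda>z. h z t) z)) (at z)"
proof -
  have cont: "continuous_on {0<..<1} (\<lambda>t. w t * h z t)" if z: "z \<in> S" for z
  proof -
    have "continuous_on {0<..<1} (\<lambda>t. (\<lambda>(z, t). h z t) (z, t))"
      by (rule continuous_on_compose2[OF h]) (use z in \<open>auto intro!: continuous_intros\<close>)
    then show ?thesis using w(2) by (auto intro!: continuous_intros)
  qed
  have hol': "(\<lambda>z. w t * h z t) holomorphic_on S" if "t \<in> {0<..<1}" for t
    using hol[OF that] by (intro holomorphic_intros)
  have dom: "\<exists>r>0. \<exists>g. ball z r \<subseteq> S \<and> g integrable_on {0<..<1} \<and>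
                 (\<forall>y\<in>ball z r. \<forall>t\<in>{0<..<1}. norm (w t * h y t) \<le> g t)" if z: "z \<in> S" for z
  proof -
    obtain r where r: "r > 0" "cball z r \<subseteq> S" using S z open_contains_cball by blast
    have "compact ((\<lambda>(z, t). h z t) ` (cball z r \<times> {0..1}))"
      by (intro compact_continuous_image compact_Times continuous_on_subset[OF h]) (use r in auto)
    then obtain B where B: "\<And>x. x \<in> (\<lambda>(z, t). h z t) ` (cball z r \<times> {0..1}) \<Longrightarrow> norm x \<le> B"
      using compact_imp_bounded bounded_iff by metis
    have "(\<lambda>t. norm (w t) * B) integrable_on {0<..<1}"
      using w(1) by (intro integrable_on_mult_left) (simp add: absolutely_integrable_on_def)
    moreover have "norm (w t * h y t) \<le> norm (w t) * B" if "y \<in> ball z r" "t \<in> {0<..<1}" for y t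
      unfolding norm_mult by (intro mult_left_mono B) (use that in force)+
    ultimately show ?thesis using r ball_subset_cball by (meson order_trans)
  qed
  note main = holomorphic_integral[OF _ S cont hol' dom z, simplified]
  have d: "deriv (\<lambda>z. w t * h z t) z = w t * deriv (\<lambda>z. h z t) z" if "t \<in> {0<..<1}" for t
    using hol[OF that] S z by (intro deriv_cmult) (auto simp: holomorphic_on_imp_differentiable_at)
  show "(\<lambda>t. w t * h z t) absolutely_integrable_on {0<..<1}" by (rule main(1))
  have "(\<lambda>t. deriv (\<lambda>z. w t * h z t) z) absolutely_integrable_on {0<..<1}" by (rule main(2))
  then show "(\<lambda>t. w t * deriv (\<lambda>z. h z t) z) absolutely_integrable_on {0<..<1}"
    by (rule set_integrable_cong[THEN iffD1, rotated -1]) (use d in auto)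
  have "((\<lambda>z. integral {0<..<1} (\<lambda>t. w t * h z t)) has_field_derivative
            integral {0<..<1} (\<lambda>t. deriv (\<lambda>z. w t * h z t) z)) (at z)" by (rule main(3))
  also have "integral {0<..<1} (\<lambda>t. deriv (\<lambda>z. w t * h z t) z) = integral {0<..<1} (\<lambda>t. w t * deriv (\<lambda>z. h z t) z)"
    by (intro integral_cong d)
  finally show "((\<lambda>z. integral {0<..<1} (\<lambda>t. w t * h z t)) has_field_derivative
            integral {0<..<1} (\<lambda>t. w t * deriv (\<lambda>z. h z t) z)) (at z)" .
qed

section \<open>Principal powers and the identity theorem\<close>

lemma continuous_on_powr_slit:
  fixes f :: "'a::topological_space \<Rightarrow> complex"
  assumes "continuous_on S f" "\<And>x. x \<in> S \<Longrightarrow> f x \<notin> \<real>\<^sub>\<le>\<^sub>0"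
  shows "continuous_on S (\<lambda>x. f x powr a)"
proof -
  have "f x \<noteq> 0 \<and> (Re (f x) \<ge> 0 \<or> Im (f x) \<noteq> 0)" if "x \<in> S" for x
    using assms(2)[OF that] by (auto simp: complex_nonpos_Reals_iff)
  then show ?thesis using assms(1) by (intro continuous_on_powr_complex) auto
qed

lemma of_real_islimpt:
  assumes "a < t" "t < b"
  shows "complex_of_real t islimpt complex_of_real ` {a<..<b}"
proof -
  have "t islimpt {a<..<b}" using assms by (simp add: open_imp_islimpt)
  then show ?thesis
    by (rule islimpt_isCont_image) (auto simp: eventually_at_filter)
qed

text \<open>The main use is for identities between principal powers: on a suitable real interval
  every base is positive, and the claim becomes one about real logarithms.\<close>

lemma holomorphic_eq_if_eq_on_real_interval:
  assumes "f holomorphic_on S" "g holomorphic_on S" "open S" "connected S"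
    and ab: "a < b" "complex_of_real ` {a<..<b} \<subseteq> S"
    and eq: "\<And>t. a < t \<Longrightarrow> t < b \<Longrightarrow> f (of_real t) = g (of_real t)" and z: "z \<in> S"
  shows "f z = g z"
proof -
  have "f z - g z = 0"
  proof (rule Conformal_Mappings.analytic_continuation[of "\<lambda>z. f z - g z" S "complex_of_real ` {a<..<b}" "of_real ((a + b) / 2)"])
    show "complex_of_real ((a + b) / 2) \<in> S" using ab by (intro subsetD[OF ab(2)] imageI) auto
    show "complex_of_real ((a + b) / 2) islimpt complex_of_real ` {a<..<b}"
      using ab by (intro of_real_islimpt) auto
  qed (use assms in \<open>auto intro!: holomorphic_intros\<close>)
  then show ?thesis by simp
qed

section \<open>Euler's beta integral for complex parameters\<close>

definition beta_weight :: "complex \<Rightarrow> complex \<Rightarrow> real \<Rightarrow> complex" where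
  "beta_weight a b t = of_real t powr (a - 1) * of_real (1 - t) powr (b - 1)"

lemma norm_beta_weight:
  "0 < t \<Longrightarrow> t < 1 \<Longrightarrow> norm (beta_weight a b t) = t powr (Re a - 1) * (1 - t) powr (Re b - 1)"
  by (simp add: beta_weight_def norm_mult norm_powr_real_powr del: of_real_diff)

lemma continuous_on_beta_weight: "continuous_on {0<..<1} (beta_weight a b)"
  unfolding beta_weight_def
  by (intro continuous_intros) (auto simp: complex_nonpos_Reals_iff simp del: of_real_diff)

lemma beta_weight_absolutely_integrable:
  assumes "Re a > 0" "Re b > 0"
  shows "beta_weight a b absolutely_integrable_on {0<..<1}"
proof (rule measurable_bounded_by_integrable_imp_absolutely_integrable)
  show "beta_weight a b \<in> borel_measurable (lebesgue_on {0<..<1})"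
    by (intro continuous_imp_measurable_on_sets_lebesgue continuous_on_beta_weight) auto
  show "(\<lambda>t. t powr (Re a - 1) * (1 - t) powr (Re b - 1)) integrable_on {0<..<1}"
    using has_integral_Beta_real[OF assms] by (auto simp: has_integral_Icc_iff_Ioo)
qed (auto simp: norm_beta_weight)

text \<open>On the disc of radius Re b / 2 about b the real part stays at least Re b / 2, and since
  1 - t < 1 the smaller exponent gives the larger power: one integrable bound serves the whole
  disc.\<close>

lemma holomorphic_beta_integral:
  assumes a: "Re a > 0"
  shows "(\<lambda>b. integral {0<..<1} (beta_weight a b)) holomorphic_on {b. Re b > 0}"
  unfolding holomorphic_on_def field_differentiable_def
proof
  have op: "open {b. Re b > 0}" by (rule open_halfspace_Re_gt)
  fix b assume b: "b \<in> {b. Re b > 0}"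
  show "\<exists>f'. ((\<lambda>b. integral {0<..<1} (beta_weight a b)) has_field_derivative f') (at b within {b. Re b > 0})"
  proof (intro exI, rule has_field_derivative_at_within, rule holomorphic_integral(3)[OF _ op _ _ _ b])
    fix t :: real assume "t \<in> {0<..<1}"
    then show "(\<lambda>b. beta_weight a b t) holomorphic_on {b. Re b > 0}"
      unfolding beta_weight_def by (intro holomorphic_intros) (auto simp del: of_real_diff)
  next
    fix b assume "b \<in> {b. Re b > 0}"
    then have b: "Re b > 0" by simp
    let ?g = "\<lambda>t. t powr (Re a - 1) * (1 - t) powr (Re b / 2 - 1)"
    have sub: "Re b / 2 \<le> Re w" if "w \<in> ball b (Re b / 2)" for w
      using that abs_Re_le_cmod[of "b - w"] by (auto simp: dist_norm)
    have "?g integrable_on {0<..<1}"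
      using has_integral_Beta_real[of "Re a" "Re b / 2"] a b by (auto simp: has_integral_Icc_iff_Ioo)
    moreover have "norm (beta_weight a w t) \<le> ?g t" if "w \<in> ball b (Re b / 2)" "t \<in> {0<..<1}" for w t
      using that sub[OF that(1)] by (auto simp: norm_beta_weight intro!: mult_left_mono powr_mono')
    ultimately show "\<exists>r>0. \<exists>g. ball b r \<subseteq> {b. Re b > 0} \<and> g integrable_on {0<..<1} \<and>
        (\<forall>w\<in>ball b r. \<forall>t\<in>{0<..<1}. norm (beta_weight a w t) \<le> g t)"
      using b sub by (intro exI[of _ "Re b / 2"] conjI exI[of _ ?g]) force+
  qed (auto intro: continuous_on_beta_weight)
qed

lemma beta_integral_swap:
  assumes "Re a > 0" "Re b > 0"
  shows "integral {0<..<1} (beta_weight a b) = integral {0<..<1} (beta_weight b a)"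
proof -
  have im: "(\<lambda>t. 1 - t) ` {0<..<1} = {0<..<1::real}"
    by (auto simp: image_iff intro!: bexI[of _ "1 - _"])
  have "beta_weight b a absolutely_integrable_on (\<lambda>t. 1 - t) ` {0<..<1} \<and>
        integral ((\<lambda>t. 1 - t) ` {0<..<1}) (beta_weight b a) = integral {0<..<1} (beta_weight b a)"
    using assms by (simp add: im beta_weight_absolutely_integrable)
  then have "integral {0<..<1} (\<lambda>t. \<bar>-1\<bar> *\<^sub>R beta_weight b a (1 - t)) = integral {0<..<1} (beta_weight b a)"
    by (subst (asm) has_absolute_integral_change_of_variables_real[symmetric])
       (auto intro!: derivative_eq_intros simp: inj_on_def)
  then show ?thesis by (simp add: beta_weight_def[abs_def] mult.commute)
qed

text \<open>Known for real positive parameters. The identity theorem extends it first in b with a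
  real and then, after swapping the two parameters, in the other one.\<close>

lemma beta_integral:
  assumes a: "Re a > 0" and b: "Re b > 0"
  shows "integral {0<..<1} (beta_weight a b) = Beta a b"
proof -
  have cn: "connected {b. Re b > 0}" by (intro convex_connected convex_halfspace_Re_gt)
  have hB: "(\<lambda>b. Beta a b) holomorphic_on {b. Re b > 0}" if "Re a > 0" for a
    unfolding Beta_altdef using that
    by (intro holomorphic_intros) (auto elim!: nonpos_Ints_cases)
  have real: "integral {0<..<1} (beta_weight (of_real a) (of_real b)) = Beta (of_real a) (of_real b)"
    if "a > 0" "b > 0" for a b :: real
  proof -
    have "((\<lambda>t. complex_of_real (t powr (a - 1) * (1 - t) powr (b - 1))) has_integral of_real (Beta a b)) {0<..<1}"
      using has_integral_Beta_real[OF that]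
      by (intro has_integral_of_real) (auto simp: has_integral_Icc_iff_Ioo)
    then have "(beta_weight (of_real a) (of_real b) has_integral of_real (Beta a b)) {0<..<1}"
      by (rule has_integral_eq[rotated]) (auto simp: beta_weight_def powr_of_real[symmetric])
    then show ?thesis by (simp add: integral_unique Beta_complex_of_real)
  qed
  have one: "integral {0<..<1} (beta_weight (of_real a) b) = Beta (of_real a) b"
    if "a > 0" "Re b > 0" for a b
    by (rule holomorphic_eq_if_eq_on_real_interval[OF holomorphic_beta_integral hB open_halfspace_Re_gt cn, of _ _ 0 1])
       (use that real in auto)
  show ?thesis
    by (subst beta_integral_swap[OF a b], subst Beta_commute,
        rule holomorphic_eq_if_eq_on_real_interval[OF holomorphic_beta_integral hB open_halfspace_Re_gt cn, of _ _ 0 1])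
       (use a b one in \<open>auto simp: beta_integral_swap[of b] Beta_commute[of b]\<close>)
qed

section \<open>The regularized hypergeometric function\<close>

definition cut_plane :: "complex set" where "cut_plane = - complex_of_real ` {1..}"

lemma cut_plane_iff: "z \<in> cut_plane \<longleftrightarrow> Im z \<noteq> 0 \<or> Re z < 1"
  by (auto simp: cut_plane_def image_iff complex_eq_iff)

lemma open_cut_plane: "open cut_plane"
proof -
  have eq: "cut_plane = {z. Im z < 0} \<union> {z. Im z > 0} \<union> {z. Re z < 1}"
    by (auto simp: cut_plane_iff)
  show ?thesis unfolding eq
    by (intro open_Un open_halfspace_Im_lt open_halfspace_Im_gt open_halfspace_Re_lt)
qed

lemma ball_subset_cut_plane: "ball 0 1 \<subseteq> cut_plane"
proof
  fix z :: complex assume "z \<in> ball 0 1"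
  then show "z \<in> cut_plane" using complex_Re_le_cmod[of z] by (auto simp: cut_plane_iff)
qed

lemma one_minus_mult_notin_nonpos:
  assumes "z \<in> cut_plane" "0 \<le> t" "t \<le> 1"
  shows "1 - z * of_real t \<notin> \<real>\<^sub>\<le>\<^sub>0"
proof
  assume "1 - z * of_real t \<in> \<real>\<^sub>\<le>\<^sub>0"
  then have *: "Im z * t = 0" "1 \<le> Re z * t" by (auto simp: complex_nonpos_Reals_iff)
  then have "t > 0" using assms by (cases "t = 0") auto
  then have "Re z \<ge> 1" using * assms
    by (smt (verit) mult_left_le mult_less_cancel_left_disj mult_nonneg_nonpos2)
  with * assms \<open>t > 0\<close> show False by (auto simp: cut_plane_iff)
qed

lemma starlike_cut_plane: "starlike cut_plane"
  unfolding starlike_def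
proof (intro bexI[of _ 0] ballI subsetI)
  fix x y assume x: "x \<in> cut_plane" and "y \<in> closed_segment 0 x"
  then obtain u where u: "0 \<le> u" "u \<le> 1" "y = of_real u * x"
    by (auto simp: closed_segment_def scaleR_conv_of_real)
  have "1 - x * of_real u \<notin> \<real>\<^sub>\<le>\<^sub>0" using one_minus_mult_notin_nonpos[OF x u(1,2)] .
  then show "y \<in> cut_plane" using u(3) by (auto simp: cut_plane_iff complex_nonpos_Reals_iff mult.commute)
qed (simp add: cut_plane_iff)

lemma connected_cut_plane: "connected cut_plane"
  by (rule starlike_imp_connected[OF starlike_cut_plane])

section \<open>The coefficients of the regularized series\<close>

definition hyp_fps :: "complex \<Rightarrow> complex \<Rightarrow> complex \<Rightarrow> complex fps" where
  "hyp_fps a b c = Abs_fps (\<lambda>n. pochhammer a n * pochhammer b n * rGamma (c + of_nat n) / fact n)"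

lemma hyp_fps_nth [simp]:
  "fps_nth (hyp_fps a b c) n = pochhammer a n * pochhammer b n * rGamma (c + of_nat n) / fact n"
  by (simp add: hyp_fps_def)

text \<open>The ratio of consecutive coefficients with denominators cleared. In this form it holds
  for every c, since the reciprocal Gamma function satisfies its recurrence at the poles of Gamma as
  well.\<close>

lemma hyp_fps_Suc:
  "fps_nth (hyp_fps a b c) (Suc n) * ((c + of_nat n) * of_nat (Suc n)) =
     fps_nth (hyp_fps a b c) n * ((a + of_nat n) * (b + of_nat n))"
proof -
  have "rGamma (c + of_nat n) = (c + of_nat n) * rGamma (c + of_nat n + 1)"
    by (simp add: rGamma_plus1)
  then show ?thesis by (simp add: pochhammer_Suc field_simps del: of_nat_Suc) (simp add: add_ac)
qed

text \<open>The hypergeometric operator acts on coefficients by a two-term recurrence. Stated for an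
  arbitrary series, it serves both to verify the equation and to prove uniqueness.\<close>

lemma fps_hyp_ode_nth:
  fixes F :: "complex fps"
  shows "fps_nth (fps_X * (1 - fps_X) * fps_deriv (fps_deriv F) +
     (fps_const c - fps_const (a + b + 1) * fps_X) * fps_deriv F - fps_const (a * b) * F) n =
     fps_nth F (Suc n) * ((c + of_nat n) * of_nat (Suc n)) - fps_nth F n * ((a + of_nat n) * (b + of_nat n))"
proof -
  have 1: "fps_X * (1 - fps_X) * fps_deriv (fps_deriv F) +
     (fps_const c - fps_const (a + b + 1) * fps_X) * fps_deriv F - fps_const (a * b) * F
    = fps_X * fps_deriv (fps_deriv F) - fps_X * (fps_X * fps_deriv (fps_deriv F))
    + fps_const c * fps_deriv F - fps_X * (fps_const (a + b + 1) * fps_deriv F)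
     - fps_const (a * b) * F"
    by (simp only: ring_distribs mult.assoc mult_1_left mult_1_right mult.left_commute diff_diff_eq2 diff_diff_eq add_diff_eq diff_add_eq)
  have 2: "fps_nth (fps_X * fps_deriv (fps_deriv F)) n = of_nat n * of_nat (Suc n) * fps_nth F (Suc n)"
    by (cases n) simp_all
  have 3: "fps_nth (fps_X * (fps_X * fps_deriv (fps_deriv F))) n = of_nat n * (of_nat n - 1) * fps_nth F n"
  proof (cases n)
    case (Suc k)
    then show ?thesis by (cases k) simp_all
  qed simp
  have 4: "fps_nth (fps_X * (fps_const k * fps_deriv F)) n = k * of_nat n * fps_nth F n" for k
    by (cases n) simp_all
  show ?thesis
    unfolding 1 fps_add_nth fps_sub_nth fps_mult_left_const_nth 2 3 4 fps_deriv_nth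
    by (simp add: algebra_simps)
qed

lemma hyp_fps_ode:
  "fps_X * (1 - fps_X) * fps_deriv (fps_deriv (hyp_fps a b c)) +
   (fps_const c - fps_const (a + b + 1) * fps_X) * fps_deriv (hyp_fps a b c) - fps_const (a * b) * hyp_fps a b c = 0"
  by (rule fps_ext) (simp only: fps_hyp_ode_nth hyp_fps_Suc fps_zero_nth diff_self)

text \<open>The recurrence can be solved upwards because (c + n) (n + 1) never vanishes. The factor
  \<open>Gamma c\<close> undoes the constant term \<open>rGamma c\<close> of
  \<open>hyp_fps\<close>.\<close>

lemma fps_ode_unique:
  fixes F :: "complex fps"
  assumes ode: "fps_X * (1 - fps_X) * fps_deriv (fps_deriv F) +
     (fps_const c - fps_const (a + b + 1) * fps_X) * fps_deriv F - fps_const (a * b) * F = 0"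
    and c: "c \<notin> \<int>\<^sub>\<le>\<^sub>0"
  shows "F = fps_const (fps_nth F 0 * Gamma c) * hyp_fps a b c"
proof -
  have rec: "fps_nth F (Suc n) * ((c + of_nat n) * of_nat (Suc n)) = fps_nth F n * ((a + of_nat n) * (b + of_nat n))" for n
    using fps_hyp_ode_nth[of F c a b n] unfolding ode by simp
  have cn: "c + of_nat n \<noteq> 0" for n
    using c plus_of_nat_eq_0_imp by blast
  have "fps_nth F n = fps_nth F 0 * Gamma c * fps_nth (hyp_fps a b c) n" for n
  proof (induction n)
    case 0
    then show ?case using c by (simp add: rGamma_inverse_Gamma Gamma_eq_zero_iff)
  next
    case (Suc n)
    have "fps_nth F (Suc n) * ((c + of_nat n) * of_nat (Suc n))
        = fps_nth F 0 * Gamma c * (fps_nth (hyp_fps a b c) n * ((a + of_nat n) * (b + of_nat n)))"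
      by (subst rec, subst Suc.IH) (simp only: mult_ac)
    also have "\<dots> = (fps_nth F 0 * Gamma c * fps_nth (hyp_fps a b c) (Suc n)) * ((c + of_nat n) * of_nat (Suc n))"
      unfolding hyp_fps_Suc[symmetric] by (simp only: mult_ac)
    finally have "fps_nth F (Suc n) * ((c + of_nat n) * of_nat (Suc n)) = \<dots>" .
    moreover have "(c + of_nat n) * of_nat (Suc n) \<noteq> 0" using cn[of n] by (simp del: of_nat_Suc)
    ultimately show ?case by (metis mult_right_cancel)
  qed
  then show ?thesis by (intro fps_ext, subst fps_mult_left_const_nth)
qed

section \<open>Continuation of the series to the plane cut along [1, infinity)\<close>

lemma holomorphic_eq_if_same_fps:
  assumes "f holomorphic_on S" "g holomorphic_on S" "open S" "connected S" "0 \<in> S"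
    and "f has_fps_expansion F" "g has_fps_expansion F" "z \<in> S"
  shows "f z = g z"
proof -
  have "(\<lambda>z. f z - g z) has_fps_expansion F - F"
    using assms by (intro fps_expansion_intros)
  then have "(\<lambda>z. f z - g z) has_fps_expansion 0" by simp
  from has_fps_expansion_0_analytic_continuation[OF this, of S z] show ?thesis
    using assms by (auto intro!: holomorphic_intros)
qed

text \<open>The existence statement that makes the choice in \<open>hyp2F1_reg\<close>
  meaningful.\<close>

definition hyp_extends :: "complex \<Rightarrow> complex \<Rightarrow> complex \<Rightarrow> bool" where
  "hyp_extends a b c \<longleftrightarrow> (\<exists>g. g holomorphic_on cut_plane \<and> g has_fps_expansion hyp_fps a b c)"

text \<open>Contiguous relation (z d/dz + c) F(a, b; c + 1) = F(a, b; c): the operator z d/dz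
  multiplies the n-th coefficient by n, and (c + n) / Gamma (c + n + 1) = 1 / Gamma (c + n).\<close>

lemma hyp_extends_lower_c:
  assumes "hyp_extends a b (c + 1)"
  shows "hyp_extends a b c"
proof -
  obtain g where g: "g holomorphic_on cut_plane" "g has_fps_expansion hyp_fps a b (c + 1)"
    using assms by (auto simp: hyp_extends_def)
  have "(\<lambda>z. z * deriv g z + c * g z) has_fps_expansion
      fps_X * fps_deriv (hyp_fps a b (c + 1)) + fps_const c * hyp_fps a b (c + 1)"
    by (intro fps_expansion_intros g)
  also have "fps_X * fps_deriv (hyp_fps a b (c + 1)) + fps_const c * hyp_fps a b (c + 1) = hyp_fps a b c"
  proof (rule fps_ext)
    fix n
    have "rGamma (c + of_nat n) = (c + of_nat n) * rGamma (c + 1 + of_nat n)"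
      using rGamma_plus1[of "c + of_nat n"] by (simp add: add_ac)
    moreover have "fps_nth (fps_X * fps_deriv (hyp_fps a b (c + 1)) + fps_const c * hyp_fps a b (c + 1)) n
        = (c + of_nat n) * fps_nth (hyp_fps a b (c + 1)) n"
      by (cases n) (simp_all add: algebra_simps del: hyp_fps_nth)
    ultimately show "fps_nth (fps_X * fps_deriv (hyp_fps a b (c + 1)) + fps_const c * hyp_fps a b (c + 1)) n = fps_nth (hyp_fps a b c) n"
      by (simp only: hyp_fps_nth times_divide_eq_right mult_ac)
  qed
  finally show ?thesis unfolding hyp_extends_def
    using g open_cut_plane by (intro exI[of _ "\<lambda>z. z * deriv g z + c * g z"] conjI holomorphic_intros holomorphic_deriv)
qed

text \<open>Contiguous relation: (c - b - 1) F(a, b; c) equals z (1 - z) F'(a, b + 1; c) + (c - b -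
  1 - a z) F(a, b + 1; c). The right-hand side extends wherever F(a, b + 1; c) does; at c = b + 1
  one would divide by zero.\<close>

lemma hyp_extends_lower_b:
  assumes "hyp_extends a (b + 1) c" and cb: "c \<noteq> b + 1"
  shows "hyp_extends a b c"
proof -
  obtain g where g: "g holomorphic_on cut_plane" "g has_fps_expansion hyp_fps a (b + 1) c"
    using assms by (auto simp: hyp_extends_def)
  let ?F = "hyp_fps a (b + 1) c"
  let ?G = "fps_const (1 / (c - b - 1)) * (fps_X * (1 - fps_X) * fps_deriv ?F + (fps_const (c - b - 1) - fps_const a * fps_X) * ?F)"
  have "(\<lambda>z. 1 / (c - b - 1) * (z * (1 - z) * deriv g z + ((c - b - 1) - a * z) * g z)) has_fps_expansion ?G"
    by (intro fps_expansion_intros g)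
  also have "?G = hyp_fps a b c"
  proof (rule fps_ext)
    fix n
    have e: "fps_X * (1 - fps_X) * fps_deriv ?F + (fps_const (c - b - 1) - fps_const a * fps_X) * ?F
       = fps_X * fps_deriv ?F - fps_X * (fps_X * fps_deriv ?F) + fps_const (c - b - 1) * ?F - fps_X * (fps_const a * ?F)"
      by (simp add: algebra_simps)
    have "fps_nth (fps_X * (1 - fps_X) * fps_deriv ?F + (fps_const (c - b - 1) - fps_const a * fps_X) * ?F) n
       = (c - b - 1) * fps_nth (hyp_fps a b c) n"
    proof (cases n)
      case 0
      then show ?thesis by simp
    next
      case (Suc k)
      let ?f = "fps_nth ?F"
      define p where "p = pochhammer (b + 1) k"
      have pb: "pochhammer b (Suc k) = b * p" by (simp add: p_def pochhammer_rec)
      have pb1: "pochhammer (b + 1) (Suc k) = p * (b + 1 + of_nat k)" by (simp add: p_def pochhammer_Suc)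
      have rG: "rGamma (c + of_nat k) = (c + of_nat k) * rGamma (c + of_nat (Suc k))"
        using rGamma_plus1[of "c + of_nat k"] by (simp add: add_ac)
      have fk: "(fact (Suc k) :: complex) = of_nat (Suc k) * fact k" by simp
      have "fps_nth (fps_X * (1 - fps_X) * fps_deriv ?F + (fps_const (c - b - 1) - fps_const a * fps_X) * ?F) n
          = of_nat (Suc k) * ?f (Suc k) - of_nat k * ?f k + (c - b - 1) * ?f (Suc k) - a * ?f k"
        unfolding e Suc by (cases k) (simp_all del: hyp_fps_nth)
      also have "\<dots> = (c - b - 1) * fps_nth (hyp_fps a b c) (Suc k)"
        unfolding hyp_fps_nth pb pb1 rG fk p_def[symmetric] pochhammer_Suc[of a]
        by (simp add: divide_simps del: of_nat_Suc) (simp add: algebra_simps)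
      finally show ?thesis by (simp add: Suc)
    qed
    moreover have "c - b - 1 \<noteq> 0" using cb by (metis add_diff_cancel_right' diff_add_cancel diff_zero add.commute diff_add_eq_diff_diff_swap eq_iff_diff_eq_0)
    ultimately show "fps_nth ?G n = fps_nth (hyp_fps a b c) n"
      by (simp only: fps_mult_left_const_nth times_divide_eq_left mult_1 nonzero_mult_div_cancel_left not_False_eq_True)
  qed
  finally show ?thesis unfolding hyp_extends_def
    using g open_cut_plane by (intro exI[of _ "\<lambda>z. 1 / (c - b - 1) * (z * (1 - z) * deriv g z + ((c - b - 1) - a * z) * g z)"] conjI holomorphic_intros holomorphic_deriv) auto
qed

lemma Re_pos_notin_nonpos_Ints: "Re z > 0 \<Longrightarrow> z \<notin> \<int>\<^sub>\<le>\<^sub>0"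
  by (auto elim!: nonpos_Ints_cases)

lemma beta_weight_mult_power:
  assumes "0 < t"
  shows "beta_weight a b t * of_real t ^ n = beta_weight (a + of_nat n) b t"
proof -
  have "complex_of_real t powr (a + of_nat n - 1) = of_real t powr (a - 1) * of_real t powr (of_nat n)"
    by (subst powr_add[symmetric]) (simp add: algebra_simps)
  then show ?thesis using assms by (simp add: beta_weight_def powr_nat')
qed

text \<open>Expand (1 - z t)^(-a) by the binomial series and integrate term by term; each term is a
  beta integral with first parameter b + n.\<close>

lemma euler_integral_sums:
  assumes b: "Re b > 0" and cb: "Re (c - b) > 0" and z: "norm z < 1"
  shows "(\<lambda>n. Gamma b * Gamma (c - b) * (fps_nth (hyp_fps a b c) n * z ^ n)) sums
     integral {0<..<1} (\<lambda>t. beta_weight b (c - b) t * (1 - z * of_real t) powr (- a))"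
proof -
  define k where "k n = pochhammer a n / fact n" for n :: nat
  have kb: "(- a) gchoose n = (-1) ^ n * k n" for n by (simp add: gbinomial_pochhammer k_def)
  have ser: "(\<lambda>n. k n * w ^ n) sums (1 - w) powr (- a)" if "norm w < 1" for w
  proof -
    have "(- 1) ^ n * k n * (- w) ^ n = k n * w ^ n" for n by (cases "even n") simp_all
    note eq = this
    show ?thesis using gen_binomial_complex[of "- w" "- a"] that unfolding kb eq by simp
  qed
  \<comment> \<open>The sum of absolute values at t = 1 bounds all partial sums uniformly in t, so
    the absolute value of the weight times \<open>B\<close> is the dominating function.\<close>
  define B where "B = (\<Sum>n. norm (k n * z ^ n))"
  have sm: "summable (\<lambda>n. norm (k n * z ^ n))"
  proof (rule powser_insidea)
    show "summable (\<lambda>n. k n * of_real ((1 + norm z) / 2) ^ n)"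
      using ser[of "of_real ((1 + norm z) / 2)"] z by (auto simp: sums_iff norm_of_real simp del: of_real_divide of_real_add)
    show "norm z < norm (complex_of_real ((1 + norm z) / 2))" using z by (simp add: norm_of_real del: of_real_divide of_real_add)
  qed
  let ?w = "beta_weight b (c - b)"
  define f where "f N t = (\<Sum>n<N. k n * z ^ n * beta_weight (b + of_nat n) (c - b) t)" for N t
  have f_eq: "f N t = ?w t * (\<Sum>n<N. k n * (z * of_real t) ^ n)" if "t \<in> {0<..<1}" for N t
    unfolding f_def sum_distrib_left using that
    by (intro sum.cong refl) (simp add: beta_weight_mult_power[symmetric] power_mult_distrib mult_ac)
  have bi: "beta_weight (b + of_nat n) (c - b) absolutely_integrable_on {0<..<1}" for n
    using b cb by (intro beta_weight_absolutely_integrable) auto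
  have fint: "f N integrable_on {0<..<1}" for N
    unfolding f_def
    by (rule integrable_sum) (auto intro!: integrable_on_mult_right bi[unfolded absolutely_integrable_on_def, THEN conjunct1])
  have gint: "(\<lambda>t. norm (?w t) * B) integrable_on {0<..<1}"
    using bi[of 0] by (intro integrable_on_mult_left) (simp add: absolutely_integrable_on_def)
  have bound: "norm (f N t) \<le> norm (?w t) * B" if t: "t \<in> {0<..<1}" for N t
  proof -
    have "norm (\<Sum>n<N. k n * (z * of_real t) ^ n) \<le> (\<Sum>n<N. norm (k n * z ^ n))"
    proof (rule sum_norm_le)
      fix n assume "n \<in> {..<N}"
      have "t ^ n \<le> 1" using t by (intro power_le_one) auto
      then show "norm (k n * (z * of_real t) ^ n) \<le> norm (k n * z ^ n)"
        using t by (auto simp: norm_mult norm_power power_mult_distrib intro!: mult_left_mono mult_left_le)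
    qed
    also have "\<dots> \<le> B" unfolding B_def by (intro sum_le_suminf sm) auto
    finally show ?thesis unfolding f_eq[OF t] norm_mult by (intro mult_left_mono) auto
  qed
  have lim: "(\<lambda>N. f N t) \<longlonglongrightarrow> ?w t * (1 - z * of_real t) powr (- a)" if t: "t \<in> {0<..<1}" for t
  proof -
    have "norm (z * of_real t) \<le> norm z * 1" using t unfolding norm_mult by (intro mult_left_mono) auto
    then have "norm (z * of_real t) < 1" using z by simp
    from ser[OF this] show ?thesis unfolding f_eq[OF t] sums_def by (intro tendsto_mult tendsto_const)
  qed
  have "(\<lambda>N. integral {0<..<1} (f N)) \<longlonglongrightarrow> integral {0<..<1} (\<lambda>t. ?w t * (1 - z * of_real t) powr (- a))"
    by (rule dominated_convergence(2)[OF fint gint bound lim])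
  moreover have "integral {0<..<1} (f N) = (\<Sum>n<N. Gamma b * Gamma (c - b) * (fps_nth (hyp_fps a b c) n * z ^ n))" for N
  proof -
    have "integral {0<..<1} (f N) = (\<Sum>n<N. k n * z ^ n * integral {0<..<1} (beta_weight (b + of_nat n) (c - b)))"
      unfolding f_def using bi
      by (subst integral_sum) (auto intro!: integrable_on_mult_right simp: absolutely_integrable_on_def)
    also have "\<dots> = (\<Sum>n<N. Gamma b * Gamma (c - b) * (fps_nth (hyp_fps a b c) n * z ^ n))"
    proof (intro sum.cong refl)
      fix n
      have "integral {0<..<1} (beta_weight (b + of_nat n) (c - b)) = Beta (b + of_nat n) (c - b)"
        using b cb by (intro beta_integral) auto
      also have "\<dots> = Gamma b * Gamma (c - b) * (pochhammer b n * rGamma (c + of_nat n))"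
        using pochhammer_Gamma[OF Re_pos_notin_nonpos_Ints[OF b], of n] Re_pos_notin_nonpos_Ints[OF b]
        by (simp add: Beta_altdef add_ac Gamma_eq_zero_iff)
      finally show "k n * z ^ n * integral {0<..<1} (beta_weight (b + of_nat n) (c - b)) =
          Gamma b * Gamma (c - b) * (fps_nth (hyp_fps a b c) n * z ^ n)"
        by (simp add: k_def)
    qed
    finally show ?thesis .
  qed
  ultimately show ?thesis unfolding sums_def by simp
qed

lemma euler_integrand_continuous:
  "continuous_on (cut_plane \<times> {0..1}) (\<lambda>(z, t). (1 - z * complex_of_real t) powr (- a))"
  unfolding case_prod_unfold
  by (intro continuous_on_powr_slit continuous_intros one_minus_mult_notin_nonpos) auto

lemma euler_integral_holomorphic:
  assumes "Re b > 0" "Re (c - b) > 0"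
  shows "(\<lambda>z. integral {0<..<1} (\<lambda>t. beta_weight b (c - b) t * (1 - z * of_real t) powr (- a))) holomorphic_on cut_plane"
proof -
  have "(\<lambda>z. (1 - z * complex_of_real t) powr (- a)) holomorphic_on cut_plane" if "t \<in> {0<..<1}" for t
    using that by (intro holomorphic_intros one_minus_mult_notin_nonpos) auto
  from holomorphic_weighted_integral(3)[OF open_cut_plane beta_weight_absolutely_integrable[OF assms]
      continuous_on_beta_weight euler_integrand_continuous this]
  show ?thesis unfolding holomorphic_on_def field_differentiable_def
    by (auto intro: has_field_derivative_at_within)
qed

text \<open>Euler's integral is itself the extension: up to Gamma factors it is holomorphic on the
  cut plane with the right Taylor series at 0.\<close>

lemma hyp_extends_base:
  assumes b: "Re b > 0" and cb: "Re (c - b) > 0"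
  shows "hyp_extends a b c"
proof -
  define E where "E z = integral {0<..<1} (\<lambda>t. beta_weight b (c - b) t * (1 - z * of_real t) powr (- a)) / (Gamma b * Gamma (c - b))" for z
  have nz: "Gamma b \<noteq> 0" "Gamma (c - b) \<noteq> 0"
    using Re_pos_notin_nonpos_Ints[OF b] Re_pos_notin_nonpos_Ints[OF cb] by (auto simp: Gamma_eq_zero_iff)
  have "E holomorphic_on cut_plane"
    unfolding E_def using nz by (intro holomorphic_intros euler_integral_holomorphic[OF b cb]) auto
  moreover have "E has_fps_expansion hyp_fps a b c"
  proof (rule has_fps_expansionI)
    have "(\<lambda>n. fps_nth (hyp_fps a b c) n * z ^ n) sums E z" if "norm z < 1" for z
      using sums_divide[OF euler_integral_sums[OF b cb that], of a "Gamma b * Gamma (c - b)"] nz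
      by (simp add: E_def del: hyp_fps_nth)
    moreover have "eventually (\<lambda>z::complex. z \<in> ball 0 1) (nhds 0)"
      by (intro eventually_nhds_in_open) auto
    ultimately show "\<forall>\<^sub>F u in nhds 0. (\<lambda>n. fps_nth (hyp_fps a b c) n * u ^ n) sums E u"
      by (auto elim!: eventually_mono simp del: hyp_fps_nth)
  qed
  ultimately show ?thesis unfolding hyp_extends_def by blast
qed

text \<open>Euler's integral covers 0 < Re b < Re c. With Re c large, lowering b reaches every b;
  then c is lowered back to its given value.\<close>

lemma hyp_extends: "hyp_extends a b c"
proof -
  \<comment> \<open>The margin N + 1 between Re b and Re c keeps c away from b + 1 at each of the N
    steps that lower b.\<close>
  have 1: "\<forall>b c. Re b > - real N \<and> Re c > Re b + real N + 1 \<longrightarrow> hyp_extends a b c" for N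
  proof (induction N)
    case 0
    then show ?case by (auto intro!: hyp_extends_base)
  next
    case (Suc N)
    show ?case
    proof (intro allI impI)
      fix b c :: complex assume *: "Re b > - real (Suc N) \<and> Re c > Re b + real (Suc N) + 1"
      show "hyp_extends a b c"
        by (rule hyp_extends_lower_b) (use * Suc.IH in auto)
    qed
  qed
  obtain N :: nat where N: "real N > - Re b" using reals_Archimedean2 by blast
  obtain k :: nat where k: "real k > Re b + real N + 1 - Re c" using reals_Archimedean2 by blast
  have "hyp_extends a b (c + of_nat k)" using N k 1[of N] by auto
  then show ?thesis
  proof (induction k)
    case (Suc k)
    then show ?case using hyp_extends_lower_c[of a b "c + of_nat k"] by (simp add: add_ac)
  qed simp
qed

text \<open>The chosen continuation agrees on the unit disc with the extension found above, hence
  has the same power series. From here on only these two properties of \<open>hyp2F1_reg\<close> are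
  used.\<close>

lemma hyp2F1_reg_holomorphic_and_fps:
  "hyp2F1_reg a b c holomorphic_on cut_plane \<and> hyp2F1_reg a b c has_fps_expansion hyp_fps a b c"
proof -
  let ?s = "\<lambda>z. \<Sum>n. pochhammer a n * pochhammer b n * rGamma (c + of_nat n) * z ^ n / fact n"
  obtain g where g: "g holomorphic_on cut_plane" "g has_fps_expansion hyp_fps a b c"
    using hyp_extends[of a b c] unfolding hyp_extends_def by blast
  have gs: "g z = ?s z" if "z \<in> ball 0 1" for z
  proof -
    have "g holomorphic_on eball 0 1"
      by (rule holomorphic_on_subset[OF g(1)]) (use ball_subset_cut_plane in \<open>auto simp: eball_def dist_norm\<close>)
    then have "(\<lambda>n. fps_nth (hyp_fps a b c) n * z ^ n) sums g z"
      using that by (intro has_fps_expansion_imp_sums_complex[OF g(2)]) auto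
    then show ?thesis by (simp add: sums_iff)
  qed
  have "\<exists>h. h holomorphic_on cut_plane \<and> (\<forall>z\<in>ball 0 1. h z = ?s z)" using g gs by blast
  from someI_ex[OF this]
  have h: "hyp2F1_reg a b c holomorphic_on cut_plane" "\<forall>z\<in>ball 0 1. hyp2F1_reg a b c z = ?s z"
    unfolding hyp2F1_reg_def analytic_continuation_def cut_plane_def by auto
  have "eventually (\<lambda>z::complex. z \<in> ball 0 1) (nhds 0)" by (intro eventually_nhds_in_open) auto
  then have "eventually (\<lambda>z. hyp2F1_reg a b c z = g z) (nhds 0)"
    by eventually_elim (use h gs in auto)
  then have "hyp2F1_reg a b c has_fps_expansion hyp_fps a b c"
    using g(2) has_fps_expansion_cong by blast
  with h show ?thesis by blast
qed

lemmas hyp2F1_reg_holomorphic = hyp2F1_reg_holomorphic_and_fps[THEN conjunct1]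
lemmas hyp2F1_reg_has_fps_expansion = hyp2F1_reg_holomorphic_and_fps[THEN conjunct2]

lemma hyp2F1_reg_sums:
  assumes "norm z < 1"
  shows "(\<lambda>n. fps_nth (hyp_fps a b c) n * z ^ n) sums hyp2F1_reg a b c z"
proof (rule has_fps_expansion_imp_sums_complex[OF hyp2F1_reg_has_fps_expansion])
  show "hyp2F1_reg a b c holomorphic_on eball 0 1"
    by (rule holomorphic_on_subset[OF hyp2F1_reg_holomorphic])
       (use ball_subset_cut_plane in \<open>auto simp: eball_def dist_norm\<close>)
qed (use assms in auto)

lemma hyp2F1_reg_0: "hyp2F1_reg a b c 0 = rGamma c"
  using sums_unique2[OF hyp2F1_reg_sums[of 0 a b c] powser_sums_zero] by simp

lemma hyp2F1_reg_eqI: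
  assumes "f holomorphic_on S" "open S" "connected S" "0 \<in> S" "S \<subseteq> cut_plane"
    and "f has_fps_expansion fps_const k * hyp_fps a b c" "z \<in> S"
  shows "f z = k * hyp2F1_reg a b c z"
proof (rule holomorphic_eq_if_same_fps[OF assms(1) _ assms(2-4) assms(6) _ assms(7)])
  show "(\<lambda>z. k * hyp2F1_reg a b c z) holomorphic_on S"
    using assms by (intro holomorphic_intros holomorphic_on_subset[OF hyp2F1_reg_holomorphic])
qed (intro fps_expansion_intros hyp2F1_reg_has_fps_expansion)

lemma hyp2F1_reg_commute:
  assumes "z \<in> cut_plane"
  shows "hyp2F1_reg a b c z = hyp2F1_reg b a c z"
proof -
  have "hyp_fps a b c = hyp_fps b a c" by (rule fps_ext) simp
  then have "hyp2F1_reg a b c has_fps_expansion fps_const 1 * hyp_fps b a c"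
    using hyp2F1_reg_has_fps_expansion[of a b c] by simp
  from hyp2F1_reg_eqI[OF hyp2F1_reg_holomorphic open_cut_plane connected_cut_plane _ _ this assms]
  show ?thesis by (simp add: cut_plane_iff)
qed

text \<open>Both sides are holomorphic on the cut plane and have the same Taylor series at
  0.\<close>

lemma euler_integral:
  assumes b: "Re b > 0" and cb: "Re (c - b) > 0" and z: "z \<in> cut_plane"
  shows "integral {0<..<1} (\<lambda>t. beta_weight b (c - b) t * (1 - z * of_real t) powr (- a)) =
         Gamma b * Gamma (c - b) * hyp2F1_reg a b c z"
proof (rule hyp2F1_reg_eqI[OF euler_integral_holomorphic[OF b cb] open_cut_plane connected_cut_plane])
  show "(\<lambda>z. integral {0<..<1} (\<lambda>t. beta_weight b (c - b) t * (1 - z * of_real t) powr (- a)))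
    has_fps_expansion fps_const (Gamma b * Gamma (c - b)) * hyp_fps a b c"
  proof (rule has_fps_expansionI)
    have "eventually (\<lambda>z::complex. z \<in> ball 0 1) (nhds 0)"
      by (intro eventually_nhds_in_open) auto
    then show "\<forall>\<^sub>F u in nhds 0. (\<lambda>n. fps_nth (fps_const (Gamma b * Gamma (c - b)) * hyp_fps a b c) n * u ^ n) sums
       integral {0<..<1} (\<lambda>t. beta_weight b (c - b) t * (1 - u * of_real t) powr (- a))"
      by eventually_elim (use euler_integral_sums[OF b cb] in \<open>simp only: fps_mult_left_const_nth mult.assoc mem_ball_0\<close>)
  qed
qed (use z in \<open>auto simp: cut_plane_iff\<close>)

section \<open>The hypergeometric equation and its regular solution\<close>

definition hyp_ode :: "complex \<Rightarrow> complex \<Rightarrow> complex \<Rightarrow> (complex \<Rightarrow> complex) \<Rightarrow> complex \<Rightarrow> bool" where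
  "hyp_ode a b c f z \<longleftrightarrow>
     z * (1 - z) * deriv (deriv f) z + (c - (a + b + 1) * z) * deriv f z - a * b * f z = 0"

lemma hyp2F1_reg_ode:
  assumes "z \<in> cut_plane"
  shows "hyp_ode a b c (hyp2F1_reg a b c) z"
proof -
  let ?F = "hyp2F1_reg a b c"
  have "(\<lambda>z. z * (1 - z) * deriv (deriv ?F) z + (c - (a + b + 1) * z) * deriv ?F z - a * b * ?F z)
    has_fps_expansion fps_X * (1 - fps_X) * fps_deriv (fps_deriv (hyp_fps a b c)) +
   (fps_const c - fps_const (a + b + 1) * fps_X) * fps_deriv (hyp_fps a b c) - fps_const (a * b) * hyp_fps a b c"
    by (intro fps_expansion_intros hyp2F1_reg_has_fps_expansion)
  then have "(\<lambda>z. z * (1 - z) * deriv (deriv ?F) z + (c - (a + b + 1) * z) * deriv ?F z - a * b * ?F z)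
    has_fps_expansion 0" unfolding hyp_fps_ode .
  moreover have "(\<lambda>z. z * (1 - z) * deriv (deriv ?F) z + (c - (a + b + 1) * z) * deriv ?F z - a * b * ?F z)
    holomorphic_on cut_plane"
    using open_cut_plane by (intro holomorphic_intros holomorphic_deriv hyp2F1_reg_holomorphic)
  ultimately show ?thesis unfolding hyp_ode_def
    by (rule has_fps_expansion_0_analytic_continuation[OF _ _ open_cut_plane connected_cut_plane _ assms])
       (simp add: cut_plane_iff)
qed

text \<open>The exponents at 0 are 0 and 1 - c, so for such c a solution regular at 0 is fixed by
  its value there. The equation is only required near 0; the power series then identifies f on all
  of S.\<close>

lemma hyp_ode_unique:
  assumes f: "f holomorphic_on S" and S: "open S" "connected S" "0 \<in> S" "S \<subseteq> cut_plane"
    and c: "c \<notin> \<int>\<^sub>\<le>\<^sub>0" and ode: "eventually (hyp_ode a b c f) (nhds 0)" and z: "z \<in> S"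
  shows "f z = f 0 * Gamma c * hyp2F1_reg a b c z"
proof (rule hyp2F1_reg_eqI[OF f S _ z])
  have "f analytic_on {0}" using f S analytic_at by blast
  then obtain F where F: "f has_fps_expansion F" using analytic_at_imp_has_fps_expansion_0 by blast
  have "(\<lambda>z. z * (1 - z) * deriv (deriv f) z + (c - (a + b + 1) * z) * deriv f z - a * b * f z)
    has_fps_expansion fps_X * (1 - fps_X) * fps_deriv (fps_deriv F) +
   (fps_const c - fps_const (a + b + 1) * fps_X) * fps_deriv F - fps_const (a * b) * F"
    by (intro fps_expansion_intros F)
  moreover have "(\<lambda>z. z * (1 - z) * deriv (deriv f) z + (c - (a + b + 1) * z) * deriv f z - a * b * f z) has_fps_expansion 0"
    using ode unfolding hyp_ode_def has_fps_expansion_0_iff .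
  ultimately have "fps_X * (1 - fps_X) * fps_deriv (fps_deriv F) +
   (fps_const c - fps_const (a + b + 1) * fps_X) * fps_deriv F - fps_const (a * b) * F = 0"
    using fps_expansion_unique_complex by blast
  from fps_ode_unique[OF this c] have "F = fps_const (f 0 * Gamma c) * hyp_fps a b c"
    using has_fps_expansion_imp_0_eq_fps_nth_0[OF F] by simp
  then show "f has_fps_expansion fps_const (f 0 * Gamma c) * hyp_fps a b c" using F by simp
qed

section \<open>Transformations of the hypergeometric function\<close>

text \<open>Let N = P^(-lam) K(s) be the kernel of the product formula; v is 1 / P, and
  \<open>st\<close>, \<open>sy\<close>, \<open>syy\<close> are partial derivatives of s. Apply 1 - y
  times the hypergeometric operator in y to N and add \<delta> times the t-expression of
  \<open>kernel_identity\<close>. The three claims say that the coefficients of K'', K' and K in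
  this sum are \<kappa> times those of the hypergeometric equation with parameters lam/2, (lam +
  1)/2, c at s.\<close>

lemma product_kernel_algebra:
  fixes x y t lam m P :: complex
  assumes P: "P = 1 + x * y - (x + y) * t" "P \<noteq> 0" and c: "c = lam - m + 1"
    and \<tau>: "\<tau> = 1 - t" and v: "v = 1 / P" and \<delta>: "\<delta> = (1 - x) * (1 - y)"
    and s: "s = 4 * x * y * \<tau>\<^sup>2 * v\<^sup>2" and st: "st = - 8 * x * y * \<tau> * v ^ 3 * \<delta>"
    and sy: "sy = 4 * x * \<tau>\<^sup>2 * v\<^sup>2 - 8 * x * y * \<tau>\<^sup>2 * (x - t) * v ^ 3"
    and syy: "syy = - 16 * x * \<tau>\<^sup>2 * (x - t) * v ^ 3 + 24 * x * y * \<tau>\<^sup>2 * (x - t)\<^sup>2 * v ^ 4"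
    and \<kappa>: "\<kappa> = 4 * x * \<tau>\<^sup>2 * v\<^sup>2 * (1 - y)\<^sup>2"
  shows "(1 - y)\<^sup>2 * y * sy\<^sup>2 + 2 * \<delta> * t * \<tau> * v * s * st = \<kappa> * (s * (1 - s))"
    and "2 * ((1 - y) * (y * (1 - y) * (syy - 2 * lam * (x - t) * v * sy) + (c - (lam + m + 1) * y) * sy)
          + \<delta> * ((m - c * t) * (2 * s * v) + t * \<tau> * ((x + y) * v\<^sup>2 * (2 * s) * (lam + 1) + (lam + 2) * v * st)))
       = \<kappa> * (2 * c - (2 * lam + 3) * s)"
    and "4 * ((1 - y) * (y * (1 - y) * lam * (lam + 1) * (x - t)\<^sup>2 * v\<^sup>2 + (c - (lam + m + 1) * y) * (- (lam * (x - t) * v)) - lam * m)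
          + \<delta> * ((m - c * t) * lam * v + t * \<tau> * (x + y) * lam * (lam + 1) * v\<^sup>2)) = - (\<kappa> * lam * (lam + 1))"
proof -
  have vP: "v * P = 1" using P v by simp
  show "(1 - y)\<^sup>2 * y * sy\<^sup>2 + 2 * \<delta> * t * \<tau> * v * s * st = \<kappa> * (s * (1 - s))"
  proof -
    have e: "(1 - y)\<^sup>2 * y * sy\<^sup>2 + 2 * \<delta> * t * \<tau> * v * s * st
        = 16 * x\<^sup>2 * y * \<tau> ^ 4 * v ^ 6 * (1 - y)\<^sup>2 * ((P - 2 * y * (x - t))\<^sup>2 - 4 * (1 - x)\<^sup>2 * y * t)"
      unfolding s st sy \<delta> v using P(2) by (simp add: field_simps power2_eq_square power3_eq_cube eval_nat_numeral)
    have e2: "\<kappa> * (s * (1 - s)) = 16 * x\<^sup>2 * y * \<tau> ^ 4 * v ^ 6 * (1 - y)\<^sup>2 * (P\<^sup>2 - 4 * x * y * \<tau>\<^sup>2)"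
      unfolding s \<kappa> v using P(2) by (simp add: field_simps power2_eq_square power3_eq_cube eval_nat_numeral)
    \<comment> \<open>The first claim reduces to this identity once the common factor 16 x^2 y
      \<tau>^4 v^6 (1 - y)^2 is split off.\<close>
    have "(P - 2 * y * (x - t))\<^sup>2 - 4 * (1 - x)\<^sup>2 * y * t = P\<^sup>2 - 4 * x * y * \<tau>\<^sup>2"
      unfolding P \<tau> by algebra
    then show ?thesis unfolding e e2 by simp
  qed
  show "2 * ((1 - y) * (y * (1 - y) * (syy - 2 * lam * (x - t) * v * sy) + (c - (lam + m + 1) * y) * sy)
          + \<delta> * ((m - c * t) * (2 * s * v) + t * \<tau> * ((x + y) * v\<^sup>2 * (2 * s) * (lam + 1) + (lam + 2) * v * st)))
       = \<kappa> * (2 * c - (2 * lam + 3) * s)"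
  proof -
    \<comment> \<open>Multiplying by a power of P leaves a polynomial identity modulo v P =
      1.\<close>
    have "P ^ 4 * (2 * ((1 - y) * (y * (1 - y) * (syy - 2 * lam * (x - t) * v * sy) + (c - (lam + m + 1) * y) * sy)
          + \<delta> * ((m - c * t) * (2 * s * v) + t * \<tau> * ((x + y) * v\<^sup>2 * (2 * s) * (lam + 1) + (lam + 2) * v * st))))
       = P ^ 4 * (\<kappa> * (2 * c - (2 * lam + 3) * s))"
      using vP unfolding s st sy syy \<delta> \<kappa> P \<tau> c by algebra
    moreover have "P ^ 4 \<noteq> 0" using P(2) by simp
    ultimately show ?thesis by (metis mult_left_cancel)
  qed
  show "4 * ((1 - y) * (y * (1 - y) * lam * (lam + 1) * (x - t)\<^sup>2 * v\<^sup>2 + (c - (lam + m + 1) * y) * (- (lam * (x - t) * v)) - lam * m)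
          + \<delta> * ((m - c * t) * lam * v + t * \<tau> * (x + y) * lam * (lam + 1) * v\<^sup>2)) = - (\<kappa> * lam * (lam + 1))"
  proof -
    have "P\<^sup>2 * (4 * ((1 - y) * (y * (1 - y) * lam * (lam + 1) * (x - t)\<^sup>2 * v\<^sup>2 + (c - (lam + m + 1) * y) * (- (lam * (x - t) * v)) - lam * m)
          + \<delta> * ((m - c * t) * lam * v + t * \<tau> * (x + y) * lam * (lam + 1) * v\<^sup>2))) = P\<^sup>2 * (- (\<kappa> * lam * (lam + 1)))"
      using vP unfolding \<delta> \<kappa> P \<tau> c by algebra
    moreover have "P\<^sup>2 \<noteq> 0" using P(2) by simp
    ultimately show ?thesis by (metis mult_left_cancel)
  qed
qed

text \<open>The chain rule reduces each transformation to a polynomial identity between the values and the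
  derivatives of the two sides; \<open>E\<close> stands for the power factor.\<close>

lemma euler_transformation_algebra:
  fixes z :: complex
  assumes "v * (1 - z) = 1" "p = c - a - b"
    "z * (1 - z) * G2 + (c - ((c - a) + (c - b) + 1) * z) * G1 - (c - a) * (c - b) * G0 = 0"
  shows "z * (1 - z) * (E * (G2 - 2 * p * v * G1 + p * (p - 1) * v\<^sup>2 * G0)) + (c - (a + b + 1) * z) * (E * (G1 - p * v * G0)) - a * b * (E * G0) = 0"
  using assms by algebra

lemma quadratic_transformation_algebra:
  fixes X :: complex
  assumes "v * (1 + X) = 1" "s = 4 * X * v\<^sup>2" "s1 = 4 * (1 - X) * v ^ 3" "s2 = - 4 * v ^ 3 - 12 * (1 - X) * v ^ 4" "c = lam - m + 1"
    "4 * s * (1 - s) * K2 + (4 * c - (4 * lam + 6) * s) * K1 - lam * (lam + 1) * K = 0"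
  shows "X * (1 - X) * (E * (lam * (lam + 1) * v\<^sup>2 * K - 2 * lam * v * s1 * K1 + s2 * K1 + s1\<^sup>2 * K2))
     + (c - (lam + m + 1) * X) * (E * (s1 * K1 - lam * v * K)) - lam * m * (E * K) = 0"
  using assms by algebra

lemma quadratic_transformation_cosh_algebra:
  fixes y :: complex
  assumes "i * h = 1" "h\<^sup>2 = 1 - y" "4 * u = 2 - i - h" "8 * u1 = - (i ^ 3 - i)" "16 * u2 = - (3 * i ^ 5 - i ^ 3)"
    "2 * u * (1 - u) * H2 + (2 * m + 1 - (4 * m + 2) * u) * H1 - 2 * lam * (2 * m - lam) * H = 0"
  shows "4 * (y * (1 - y) * (E * (lam * (lam + 2) * i ^ 4 * H + 4 * lam * i\<^sup>2 * u1 * H1 + 4 * u2 * H1 + 4 * u1\<^sup>2 * H2))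
     + (2 * m - (lam + m + 1) * y) * (E * (2 * lam * i\<^sup>2 * H + 4 * u1 * H1)) - 4 * lam * m * (E * H)) = 0"
  using assms by algebra

lemma hyp_odeI:
  assumes S: "open S" "z \<in> S" and f: "\<And>w. w \<in> S \<Longrightarrow> (f has_field_derivative f1 w) (at w)"
    and f1: "(f1 has_field_derivative f2) (at z)"
    and eq: "z * (1 - z) * f2 + (c - (a + b + 1) * z) * f1 z - a * b * f z = 0"
  shows "hyp_ode a b c f z"
proof -
  have d: "deriv f w = f1 w" if "w \<in> S" for w using f[OF that] by (rule DERIV_imp_deriv)
  have "(deriv f has_field_derivative f2) (at z)"
    by (rule has_field_derivative_transform_within_open[OF f1 S]) (simp add: d)
  then have "deriv (deriv f) z = f2" by (rule DERIV_imp_deriv)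
  with eq d[OF S(2)] show ?thesis by (simp add: hyp_ode_def)
qed

lemma hyp2F1_reg_deriv:
  assumes "z \<in> cut_plane"
  shows "(hyp2F1_reg a b c has_field_derivative deriv (hyp2F1_reg a b c) z) (at z)"
    and "(deriv (hyp2F1_reg a b c) has_field_derivative deriv (deriv (hyp2F1_reg a b c)) z) (at z)"
  using holomorphic_derivI[OF hyp2F1_reg_holomorphic open_cut_plane assms]
    holomorphic_derivI[OF holomorphic_deriv[OF hyp2F1_reg_holomorphic open_cut_plane] open_cut_plane assms]
  by auto

lemma zero_in_cut_plane: "0 \<in> cut_plane"
  by (simp add: cut_plane_iff)

lemma one_minus_notin_nonpos: "z \<in> cut_plane \<Longrightarrow> 1 - z \<notin> \<real>\<^sub>\<le>\<^sub>0"
  using one_minus_mult_notin_nonpos[of z 1] by simp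

text \<open>The right-hand side satisfies the same equation as the left and is regular at 0 with
  value \<open>rGamma c\<close>.\<close>

lemma euler_transformation:
  assumes c: "c \<notin> \<int>\<^sub>\<le>\<^sub>0" and z: "z \<in> cut_plane"
  shows "hyp2F1_reg a b c z = (1 - z) powr (c - a - b) * hyp2F1_reg (c - a) (c - b) c z"
proof -
  define p where "p = c - a - b"
  define G where "G = hyp2F1_reg (c - a) (c - b) c"
  define f where "f w = (1 - w) powr p * G w" for w
  define f1 where "f1 w = (1 - w) powr p * (deriv G w - p * (1 / (1 - w)) * G w)" for w
  have nz: "1 - w \<noteq> 0" if "w \<in> cut_plane" for w using one_minus_notin_nonpos[OF that] by auto
  have dE: "((\<lambda>w. (1 - w) powr p) has_field_derivative - p * ((1 - w) powr p * (1 / (1 - w)))) (at w)" if "w \<in> cut_plane" for w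
    using one_minus_notin_nonpos[OF that] nz[OF that]
    by (auto intro!: derivative_eq_intros simp: powr_diff)
  have dG: "(G has_field_derivative deriv G w) (at w)" "(deriv G has_field_derivative deriv (deriv G) w) (at w)" if "w \<in> cut_plane" for w
    unfolding G_def using hyp2F1_reg_deriv[OF that] by auto
  have df: "(f has_field_derivative f1 w) (at w)" if "w \<in> cut_plane" for w
    unfolding f_def f1_def
    by (rule dE[OF that] dG[OF that] derivative_eq_intros refl)+ (simp add: algebra_simps)
  have ode: "hyp_ode a b c f w" if w: "w \<in> cut_plane" for w
  proof (rule hyp_odeI[OF open_cut_plane w df])
    let ?v = "1 / (1 - w)"
    have dv: "((\<lambda>w. 1 / (1 - w)) has_field_derivative ?v\<^sup>2) (at w)"
      using nz[OF w] by (auto intro!: derivative_eq_intros simp: divide_simps power2_eq_square)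
    show "(f1 has_field_derivative (1 - w) powr p * (deriv (deriv G) w - 2 * p * ?v * deriv G w + p * (p - 1) * ?v\<^sup>2 * G w)) (at w)"
      unfolding f1_def
      by (rule dE[OF w] dG[OF w] dv derivative_eq_intros refl)+ (simp_all add: algebra_simps power2_eq_square add_divide_distrib diff_divide_distrib)
    have "hyp_ode (c - a) (c - b) c G w" unfolding G_def by (rule hyp2F1_reg_ode[OF w])
    then show "w * (1 - w) * ((1 - w) powr p * (deriv (deriv G) w - 2 * p * ?v * deriv G w + p * (p - 1) * ?v\<^sup>2 * G w))
      + (c - (a + b + 1) * w) * f1 w - a * b * f w = 0"
      unfolding f1_def f_def using nz[OF w] by (intro euler_transformation_algebra) (auto simp: p_def hyp_ode_def)
  qed
  have "f z = f 0 * Gamma c * hyp2F1_reg a b c z"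
  proof (rule hyp_ode_unique[OF _ open_cut_plane connected_cut_plane _ _ c _ z])
    show "f holomorphic_on cut_plane"
      unfolding holomorphic_on_def field_differentiable_def using df has_field_derivative_at_within by blast
    show "\<forall>\<^sub>F w in nhds 0. hyp_ode a b c f w"
      using eventually_nhds_in_open[OF open_cut_plane zero_in_cut_plane] by (rule eventually_mono) (auto simp: ode cut_plane_iff)
  qed (auto simp: cut_plane_iff)
  moreover have "f 0 * Gamma c = 1"
    using c by (simp add: f_def G_def hyp2F1_reg_0 rGamma_inverse_Gamma Gamma_eq_zero_iff)
  ultimately show ?thesis by (simp add: f_def G_def p_def)
qed

text \<open>Put q = (1 - X) / (1 + X). This Cayley transform sends the unit disc to the right half
  plane, and 4 X / (1 + X)^2 = 1 - q^2 is real and at least 1 only for imaginary q.\<close>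

lemma koebe_map_in_cut_plane:
  assumes "norm X < 1"
  shows "1 + X \<notin> \<real>\<^sub>\<le>\<^sub>0" "4 * X / (1 + X)\<^sup>2 \<in> cut_plane"
proof -
  have "Re (1 + X) > 0" using assms abs_Re_le_cmod[of X] by simp
  then show nz: "1 + X \<notin> \<real>\<^sub>\<le>\<^sub>0" by (auto simp: complex_nonpos_Reals_iff)
  then have nz': "1 + X \<noteq> 0" by auto
  define q where "q = (1 - X) / (1 + X)"
  have "Re q = (1 - (norm X)\<^sup>2) / (norm (1 + X))\<^sup>2"
    unfolding q_def Re_divide cmod_power2 by (simp add: algebra_simps power2_eq_square)
  moreover have "(norm X)\<^sup>2 < 1" using assms by (simp add: abs_square_less_1)
  ultimately have q: "Re q > 0" using nz' by simp
  have "4 * X / (1 + X)\<^sup>2 = 1 - q\<^sup>2" using nz' unfolding q_def by (simp add: power_divide divide_simps) algebra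
  moreover have "1 - q\<^sup>2 \<in> cut_plane" using q by (auto simp: cut_plane_iff power2_eq_square)
  ultimately show "4 * X / (1 + X)\<^sup>2 \<in> cut_plane" by simp
qed

text \<open>Multiplied by 4 so that no fractions enter the polynomial identities.\<close>

lemma half_params_ode:
  assumes "w \<in> cut_plane" and "K = hyp2F1_reg (lam / 2) ((lam + 1) / 2) c"
  shows "4 * w * (1 - w) * deriv (deriv K) w + (4 * c - (4 * lam + 6) * w) * deriv K w - lam * (lam + 1) * K w = 0"
proof -
  have "hyp_ode (lam / 2) ((lam + 1) / 2) c K w" unfolding assms(2) by (rule hyp2F1_reg_ode[OF assms(1)])
  then have "4 * (w * (1 - w) * deriv (deriv K) w + (c - (lam / 2 + (lam + 1) / 2 + 1) * w) * deriv K w - lam / 2 * ((lam + 1) / 2) * K w) = 0"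
    unfolding hyp_ode_def by (simp only: mult_zero_right)
  moreover have "4 * (w * (1 - w) * deriv (deriv K) w + (c - (lam / 2 + (lam + 1) / 2 + 1) * w) * deriv K w - lam / 2 * ((lam + 1) / 2) * K w)
     = 4 * w * (1 - w) * deriv (deriv K) w + (4 * c - (4 * lam + 6) * w) * deriv K w - lam * (lam + 1) * K w"
    by (simp add: field_simps)
  ultimately show ?thesis by simp
qed

text \<open>The relation c = lam - m + 1 is what allows a quadratic substitution: \<open>f\<close>,
  the left-hand side times (1 + X)^(-lam), then solves the equation with parameters lam, m, c. The
  identity is confined to the disc, since X \<mapsto> 4 X / (1 + X)^2 sends the unit circle to the
  cut.\<close>

lemma quadratic_transformation:
  assumes c: "c = lam - m + 1" "c \<notin> \<int>\<^sub>\<le>\<^sub>0" and X: "norm X < 1"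
  shows "hyp2F1_reg (lam / 2) ((lam + 1) / 2) c (4 * X / (1 + X)\<^sup>2) = (1 + X) powr lam * hyp2F1_reg lam m c X"
proof -
  let ?B = "ball 0 1 :: complex set"
  define K where "K = hyp2F1_reg (lam / 2) ((lam + 1) / 2) c"
  define s where "s w = 4 * w * (1 / (1 + w))\<^sup>2" for w :: complex
  define s1 where "s1 w = 4 * (1 - w) * (1 / (1 + w)) ^ 3" for w :: complex
  define f where "f w = (1 + w) powr (- lam) * K (s w)" for w
  define f1 where "f1 w = (1 + w) powr (- lam) * (s1 w * deriv K (s w) - lam * (1 / (1 + w)) * K (s w))" for w
  have nz: "1 + w \<notin> \<real>\<^sub>\<le>\<^sub>0" "1 + w \<noteq> 0" and sc: "s w \<in> cut_plane" if "w \<in> ?B" for w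
    using koebe_map_in_cut_plane[of w] that by (auto simp: s_def power_divide)
  have dE: "((\<lambda>w. (1 + w) powr (- lam)) has_field_derivative - lam * ((1 + w) powr (- lam) * (1 / (1 + w)))) (at w)" if "w \<in> ?B" for w
    using nz[OF that] by (auto intro!: derivative_eq_intros simp: powr_diff)
  have ds: "(s has_field_derivative s1 w) (at w)" if "w \<in> ?B" for w
    unfolding s_def s1_def using nz[OF that]
    by (auto intro!: derivative_eq_intros simp: divide_simps) (simp add: field_simps power2_eq_square power3_eq_cube eval_nat_numeral)
  have ds1: "(s1 has_field_derivative (- 4 * (1 / (1 + w)) ^ 3 - 12 * (1 - w) * (1 / (1 + w)) ^ 4)) (at w)" if "w \<in> ?B" for w
    unfolding s1_def using nz[OF that]
    by (auto intro!: derivative_eq_intros simp: divide_simps) (simp add: field_simps power2_eq_square power3_eq_cube eval_nat_numeral)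
  have dK: "((\<lambda>w. K (s w)) has_field_derivative deriv K (s w) * s1 w) (at w)"
    "((\<lambda>w. deriv K (s w)) has_field_derivative deriv (deriv K) (s w) * s1 w) (at w)" if "w \<in> ?B" for w
    unfolding K_def using hyp2F1_reg_deriv[OF sc[OF that]] ds[OF that] by (auto intro: DERIV_chain2)
  have df: "(f has_field_derivative f1 w) (at w)" if "w \<in> ?B" for w
    unfolding f_def f1_def
    by (rule dE[OF that] dK[OF that] derivative_eq_intros refl)+ (simp add: algebra_simps)
  have ode: "hyp_ode lam m c f w" if w: "w \<in> ?B" for w
  proof (rule hyp_odeI[OF open_ball w df])
    let ?v = "1 / (1 + w)"
    let ?s2 = "- 4 * ?v ^ 3 - 12 * (1 - w) * ?v ^ 4"
    let ?f2 = "(1 + w) powr (- lam) * (lam * (lam + 1) * ?v\<^sup>2 * K (s w) - 2 * lam * ?v * s1 w * deriv K (s w) + ?s2 * deriv K (s w) + (s1 w)\<^sup>2 * deriv (deriv K) (s w))"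
    have dv: "((\<lambda>w. 1 / (1 + w)) has_field_derivative - (?v\<^sup>2)) (at w)"
      using nz[OF w] by (auto intro!: derivative_eq_intros simp: divide_simps power2_eq_square)
    show "(f1 has_field_derivative ?f2) (at w)"
      unfolding f1_def
      by (rule dE[OF w] dK[OF w] ds1[OF w] dv derivative_eq_intros refl)+ (simp add: algebra_simps power2_eq_square add_divide_distrib)
    show "w * (1 - w) * ?f2 + (c - (lam + m + 1) * w) * f1 w - lam * m * f w = 0"
      unfolding f1_def f_def
      by (rule quadratic_transformation_algebra[OF _ _ _ refl c(1) half_params_ode[OF sc[OF w] K_def]])
         (use nz[OF w] in \<open>auto simp: s_def s1_def\<close>)
  qed
  have "f X = f 0 * Gamma c * hyp2F1_reg lam m c X"
  proof (rule hyp_ode_unique[OF _ open_ball _ _ ball_subset_cut_plane c(2)])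
    show "f holomorphic_on ?B"
      unfolding holomorphic_on_def field_differentiable_def using df has_field_derivative_at_within by blast
    show "\<forall>\<^sub>F w in nhds 0. hyp_ode lam m c f w"
      by (rule eventually_mono[OF eventually_nhds_in_open[of ?B 0]]) (auto simp: ode)
  qed (use X in auto)
  moreover have "f 0 * Gamma c = 1"
    using c by (simp add: f_def K_def s_def hyp2F1_reg_0 rGamma_inverse_Gamma Gamma_eq_zero_iff)
  ultimately have "(1 + X) powr (- lam) * K (s X) = hyp2F1_reg lam m c X" by (simp add: f_def)
  moreover have "(1 + X) powr lam * (1 + X) powr (- lam) = 1" using nz[of X] X by (simp add: powr_minus)
  ultimately have "(1 + X) powr lam * hyp2F1_reg lam m c X = K (s X)" by (metis mult.assoc mult_1)
  then show ?thesis by (simp add: K_def s_def power_divide)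
qed

text \<open>For y = 1 - e^(-2 i \<theta>) with 0 < \<theta> < \<pi>/2 the root is e^(-i \<theta>)
  and the left argument is (1 - cos \<theta>) / 2, the argument in the Ferrers function P. The
  special lower parameter 2 m is what admits this substitution.\<close>

lemma quadratic_transformation_cosh:
  assumes m: "2 * m \<notin> \<int>\<^sub>\<le>\<^sub>0" and y: "y \<in> cut_plane"
  shows "(1 - y) powr (- lam / 2) * hyp2F1_reg lam (2 * m - lam) (m + 1 / 2) ((2 - 1 / csqrt (1 - y) - csqrt (1 - y)) / 4) =
         rGamma (m + 1 / 2) * Gamma (2 * m) * hyp2F1_reg lam m (2 * m) y"
proof -
  define H where "H = hyp2F1_reg lam (2 * m - lam) (m + 1 / 2)"
  define h where "h w = csqrt (1 - w)" for w
  define u where "u w = (2 - 1 / h w - h w) / 4" for w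
  define u1 where "u1 w = - ((1 / h w) ^ 3 - 1 / h w) / 8" for w
  define f where "f w = (1 - w) powr (- lam / 2) * H (u w)" for w
  define f1 where "f1 w = (1 - w) powr (- lam / 2) * (lam / 2 * (1 / h w)\<^sup>2 * H (u w) + u1 w * deriv H (u w))" for w
  note nn = one_minus_notin_nonpos
  have h2: "(h w)\<^sup>2 = 1 - w" for w by (simp add: h_def)
  \<comment> \<open>1 - w avoids 0 and the negative axis, so its principal root lies strictly in the
    right half plane.\<close>
  have hp: "Re (h w) > 0" if "w \<in> cut_plane" for w
    unfolding h_def using csqrt_principal[of "1 - w"] nn[OF that]
    by (smt (verit) complex_eq_iff h2 h_def complex_nonpos_Reals_iff Re_power2 power2_eq_square mult_zero_left zero_complex.sel Im_power2 mult_eq_0_iff not_sum_power2_lt_zero)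
  have hnz: "h w \<noteq> 0" if "w \<in> cut_plane" for w using hp[OF that] by auto
  \<comment> \<open>Both h and 1 / h have positive real part, which forces Re u < 1/2.\<close>
  have uc: "u w \<in> cut_plane" if "w \<in> cut_plane" for w
  proof (rule ccontr)
    assume "u w \<notin> cut_plane"
    then have "Re (u w) \<ge> 1" by (auto simp: cut_plane_iff)
    moreover have "Re (1 / h w) > 0" using hp[OF that] by (simp add: Re_divide sum_power2_gt_zero_iff)
    ultimately show False using hp[OF that] by (simp add: u_def)
  qed
  have dh: "(h has_field_derivative - (1 / h w) / 2) (at w)" if "w \<in> cut_plane" for w
    unfolding h_def using nn[OF that] by (auto intro!: derivative_eq_intros simp: divide_simps)
  have di: "((\<lambda>w. 1 / h w) has_field_derivative (1 / h w) ^ 3 / 2) (at w)" if "w \<in> cut_plane" for w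
    using hnz[OF that] by (auto intro!: derivative_eq_intros dh[OF that] simp: divide_simps eval_nat_numeral)
  have dE: "((\<lambda>w. (1 - w) powr (- lam / 2)) has_field_derivative (lam / 2) * ((1 - w) powr (- lam / 2) * (1 / h w)\<^sup>2)) (at w)" if "w \<in> cut_plane" for w
    using nn[OF that] by (auto intro!: derivative_eq_intros simp: powr_diff power_divide h2)
  have du: "(u has_field_derivative u1 w) (at w)" if "w \<in> cut_plane" for w
    unfolding u_def u1_def by (rule di[OF that] dh[OF that] derivative_eq_intros refl)+ (simp_all add: diff_divide_distrib)
  have du1: "(u1 has_field_derivative - (3 * (1 / h w) ^ 5 - (1 / h w) ^ 3) / 16) (at w)" if "w \<in> cut_plane" for w
    unfolding u1_def by (rule di[OF that] dh[OF that] derivative_eq_intros refl)+ (use hnz[OF that] in \<open>simp_all add: field_simps eval_nat_numeral\<close>)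
  have dH: "((\<lambda>w. H (u w)) has_field_derivative deriv H (u w) * u1 w) (at w)"
    "((\<lambda>w. deriv H (u w)) has_field_derivative deriv (deriv H) (u w) * u1 w) (at w)" if "w \<in> cut_plane" for w
    unfolding H_def using hyp2F1_reg_deriv[OF uc[OF that]] du[OF that] by (auto intro: DERIV_chain2)
  have df: "(f has_field_derivative f1 w) (at w)" if "w \<in> cut_plane" for w
    unfolding f_def f1_def
    by (rule dE[OF that] dH[OF that] derivative_eq_intros refl)+ (simp add: algebra_simps)
  have ode: "hyp_ode lam m (2 * m) f w" if w: "w \<in> cut_plane" for w
  proof (rule hyp_odeI[OF open_cut_plane w df])
    let ?i = "1 / h w"
    let ?E = "(1 - w) powr (- lam / 2)"
    let ?u2 = "- (3 * ?i ^ 5 - ?i ^ 3) / 16"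
    let ?f2 = "?E * (lam * (lam + 2) * ?i ^ 4 * H (u w) / 4 + lam * ?i\<^sup>2 * u1 w * deriv H (u w) + ?u2 * deriv H (u w) + (u1 w)\<^sup>2 * deriv (deriv H) (u w))"
    show "(f1 has_field_derivative ?f2) (at w)"
      unfolding f1_def
      by (rule dE[OF w] dH[OF w] du1[OF w] di[OF w] derivative_eq_intros refl)+ (use hnz[OF w] in \<open>simp add: field_simps eval_nat_numeral\<close>)
    have "hyp_ode lam (2 * m - lam) (m + 1 / 2) H (u w)" unfolding H_def by (rule hyp2F1_reg_ode[OF uc[OF w]])
    then have "2 * u w * (1 - u w) * deriv (deriv H) (u w) + (2 * m + 1 - (4 * m + 2) * u w) * deriv H (u w) - 2 * lam * (2 * m - lam) * H (u w) = 0"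
      unfolding hyp_ode_def by algebra
    then have "4 * (w * (1 - w) * (?E * (lam * (lam + 2) * ?i ^ 4 * H (u w) + 4 * lam * ?i\<^sup>2 * u1 w * deriv H (u w) + 4 * ?u2 * deriv H (u w) + 4 * (u1 w)\<^sup>2 * deriv (deriv H) (u w)))
     + (2 * m - (lam + m + 1) * w) * (?E * (2 * lam * ?i\<^sup>2 * H (u w) + 4 * u1 w * deriv H (u w))) - 4 * lam * m * (?E * H (u w))) = 0"
      by (intro quadratic_transformation_cosh_algebra[where h = "h w" and u = "u w"]) (use hnz[OF w] h2[of w] in \<open>auto simp: u_def u1_def field_simps\<close>)
    then have "16 * (w * (1 - w) * ?f2 + (2 * m - (lam + m + 1) * w) * f1 w - lam * m * f w) = 0"
      unfolding f1_def f_def by (simp add: algebra_simps add_divide_distrib diff_divide_distrib)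
    then show "w * (1 - w) * ?f2 + (2 * m - (lam + m + 1) * w) * f1 w - lam * m * f w = 0" by (simp only: mult_eq_0_iff) simp
  qed
  have "f y = f 0 * Gamma (2 * m) * hyp2F1_reg lam m (2 * m) y"
  proof (rule hyp_ode_unique[OF _ open_cut_plane connected_cut_plane _ _ m _ y])
    show "f holomorphic_on cut_plane"
      unfolding holomorphic_on_def field_differentiable_def using df has_field_derivative_at_within by blast
    show "\<forall>\<^sub>F w in nhds 0. hyp_ode lam m (2 * m) f w"
      using eventually_nhds_in_open[OF open_cut_plane zero_in_cut_plane] by (rule eventually_mono) (auto simp: ode cut_plane_iff)
  qed (auto simp: cut_plane_iff)
  moreover have "f 0 = rGamma (m + 1 / 2)" by (simp add: f_def u_def h_def H_def hyp2F1_reg_0)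
  ultimately show ?thesis by (simp add: f_def u_def h_def H_def)
qed

section \<open>The product formula\<close>

text \<open>The integrand is the derivative of t^m (1 - t)^q M(t), which vanishes at both ends as Re
  m and Re q are positive.\<close>

lemma beta_weight_total_derivative:
  assumes m: "Re m > 0" and q: "Re q > 0"
    and M: "continuous_on {0..1} M"
    and dM: "\<And>t. 0 < t \<Longrightarrow> t < 1 \<Longrightarrow> (M has_vector_derivative M' t) (at t)"
  shows "((\<lambda>t. beta_weight m q t * ((m - (m + q) * of_real t) * M t + of_real t * (1 - of_real t) * M' t)) has_integral 0) {0<..<1}"
proof -
  let ?Q = "\<lambda>t. of_real t powr m * of_real (1 - t) powr q * M t"
  have "((\<lambda>t. beta_weight m q t * ((m - (m + q) * of_real t) * M t + of_real t * (1 - of_real t) * M' t)) has_integral (?Q 1 - ?Q 0)) {0..1}"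
  proof (rule fundamental_theorem_of_calculus_interior)
    show "continuous_on {0..1} ?Q"
      using m q by (intro continuous_intros M) (auto simp del: of_real_diff)
    fix t :: real assume t: "t \<in> {0<..<1}"
    have 1: "((\<lambda>t. complex_of_real t powr m) has_vector_derivative (m * of_real t powr (m - 1))) (at t)"
      by (rule has_vector_derivative_real_field) (use t in \<open>auto intro!: derivative_eq_intros simp: complex_nonpos_Reals_iff\<close>)
    have 2: "((\<lambda>t. complex_of_real (1 - t) powr q) has_vector_derivative (- q * of_real (1 - t) powr (q - 1))) (at t)"
      unfolding of_real_diff of_real_1
      by (rule has_vector_derivative_real_field) (use t in \<open>auto intro!: derivative_eq_intros simp: complex_nonpos_Reals_iff\<close>)
    have 3: "complex_of_real t powr m = of_real t * of_real t powr (m - 1)"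
      "complex_of_real (1 - t) powr q = (1 - of_real t) * of_real (1 - t) powr (q - 1)"
      using t by (auto simp: powr_diff)
    have "(?Q has_vector_derivative (of_real t powr m * of_real (1 - t) powr q * M' t +
        (of_real t powr m * (- q * of_real (1 - t) powr (q - 1)) + (m * of_real t powr (m - 1)) * of_real (1 - t) powr q) * M t)) (at t)"
      using t by (intro has_vector_derivative_mult 1 2 dM) auto
    then show "(?Q has_vector_derivative beta_weight m q t * ((m - (m + q) * of_real t) * M t + of_real t * (1 - of_real t) * M' t)) (at t)"
      unfolding beta_weight_def 3 by (rule back_subst[of "\<lambda>x. (_ has_vector_derivative x) (at t)"]) algebra
  qed auto
  then show ?thesis by (simp add: has_integral_Icc_iff_Ioo)
qed

text \<open>With P = 1 + x y - (x + y) t, the two conditions control P at t = 0 and t = 1, where it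
  equals 1 + x y and (1 - x) (1 - y); in between P is a convex combination of these. Both conditions
  are convex in y, so the set is connected; for 0 < |x| < 1 it contains 0 and the conjugate of
  x.\<close>

definition product_domain :: "complex \<Rightarrow> complex set" where
  "product_domain x = {y. cmod y + cmod x < Re (1 + x * y) \<and> 0 < Re ((1 - x) * (1 - y))}"

lemma open_product_domain: "open (product_domain x)"
  unfolding product_domain_def by (intro open_Collect_conj open_Collect_less continuous_intros)

lemma convex_product_domain: "convex (product_domain x)"
proof (rule convexI)
  fix y z :: complex and u v :: real
  assume y: "y \<in> product_domain x" and z: "z \<in> product_domain x" and uv: "0 \<le> u" "0 \<le> v" "u + v = 1"
  let ?w = "u *\<^sub>R y + v *\<^sub>R z"
  have v: "v = 1 - u" using uv by simp
  have "u * (cmod y + cmod x - Re (1 + x * y)) + v * (cmod z + cmod x - Re (1 + x * z)) < 0"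
    using y z uv by (intro convex_bound_lt) (auto simp: product_domain_def)
  moreover have "cmod ?w \<le> u * cmod y + v * cmod z"
    using norm_triangle_ineq[of "u *\<^sub>R y" "v *\<^sub>R z"] uv by simp
  moreover have "u * (cmod y + cmod x - Re (1 + x * y)) + v * (cmod z + cmod x - Re (1 + x * z))
      = u * cmod y + v * cmod z + cmod x - Re (1 + x * ?w)"
    by (simp add: v algebra_simps)
  ultimately have 1: "cmod ?w + cmod x < Re (1 + x * ?w)" by linarith
  have "u * - Re ((1 - x) * (1 - y)) + v * - Re ((1 - x) * (1 - z)) < 0"
    using y z uv by (intro convex_bound_lt) (auto simp: product_domain_def)
  moreover have "u * - Re ((1 - x) * (1 - y)) + v * - Re ((1 - x) * (1 - z)) = - Re ((1 - x) * (1 - ?w))"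
    by (simp add: v algebra_simps)
  ultimately have "0 < Re ((1 - x) * (1 - ?w))" by linarith
  with 1 show "?w \<in> product_domain x" unfolding product_domain_def by blast
qed

lemma cnj_in_product_domain:
  assumes "0 < cmod x" "cmod x < 1"
  shows "cnj x \<in> product_domain x" "0 \<in> product_domain x"
proof -
  have "Re ((1 - x) * (1 - cnj x)) = (cmod (1 - x))\<^sup>2"
    by (metis Re_complex_of_real complex_norm_square complex_cnj_diff complex_cnj_one)
  moreover have "1 - x \<noteq> 0" using assms by auto
  ultimately have "0 < Re ((1 - x) * (1 - cnj x))" by simp
  moreover have "Re (1 + x * cnj x) = 1 + (cmod x)\<^sup>2"
    by (simp only: complex_norm_square[symmetric] plus_complex.sel one_complex.sel Re_complex_of_real)
  moreover have "0 < (1 - cmod x)\<^sup>2" using assms by simp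
  then have "cmod (cnj x) + cmod x < 1 + (cmod x)\<^sup>2" by (simp add: power2_eq_square algebra_simps)
  ultimately show "cnj x \<in> product_domain x" unfolding product_domain_def mem_Collect_eq by simp
  show "0 \<in> product_domain x" using assms abs_Re_le_cmod[of x] by (auto simp: product_domain_def)
qed

text \<open>Convexity in t gives Re P > (1 - t) (|x| + |y|), and 4 |x| |y| \<le> (|x| + |y|)^2 turns
  this into modulus below 1 for the argument of the hypergeometric factor.\<close>

lemma product_domain_bounds:
  assumes y: "y \<in> product_domain x" and t: "0 \<le> t" "t \<le> 1"
  defines "P \<equiv> 1 + x * y - (x + y) * of_real t"
  shows "P \<notin> \<real>\<^sub>\<le>\<^sub>0" "P \<noteq> 0" "4 * x * y * (1 - of_real t)\<^sup>2 * (1 / P)\<^sup>2 \<in> ball 0 1"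
proof -
  have "P = of_real (1 - t) * (1 + x * y) + of_real t * ((1 - x) * (1 - y))"
    unfolding P_def by (simp add: algebra_simps)
  moreover have "Re (of_real a * w + of_real b * z) = a * Re w + b * Re z" for a b w z by simp
  ultimately have RP: "Re P = (1 - t) * Re (1 + x * y) + t * Re ((1 - x) * (1 - y))" by metis
  have y': "cmod y + cmod x < Re (1 + x * y)" "0 < Re ((1 - x) * (1 - y))" using y by (auto simp: product_domain_def)
  have *: "(1 - t) * (cmod x + cmod y) < Re P"
  proof (cases "t = 1")
    case False
    then have "(1 - t) * (cmod x + cmod y) < (1 - t) * Re (1 + x * y)" using t y' by (intro mult_strict_left_mono) auto
    moreover have "0 \<le> t * Re ((1 - x) * (1 - y))" using t y' by (intro mult_nonneg_nonneg) auto
    ultimately show ?thesis unfolding RP by linarith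
  qed (use y' RP in simp)
  moreover have "0 \<le> (1 - t) * (cmod x + cmod y)" using t by simp
  ultimately have pos: "Re P > 0" by linarith
  then show "P \<notin> \<real>\<^sub>\<le>\<^sub>0" by (auto simp: complex_nonpos_Reals_iff)
  then show nz: "P \<noteq> 0" by auto
  have "4 * cmod x * cmod y * (1 - t)\<^sup>2 \<le> ((1 - t) * (cmod x + cmod y))\<^sup>2"
  proof -
    have "4 * cmod x * cmod y \<le> (cmod x + cmod y)\<^sup>2"
      using zero_le_power2[of "cmod x - cmod y"] by (simp add: power2_eq_square algebra_simps)
    then have "(4 * cmod x * cmod y) * (1 - t)\<^sup>2 \<le> (cmod x + cmod y)\<^sup>2 * (1 - t)\<^sup>2" by (rule mult_right_mono) simp
    then show ?thesis by (simp add: power_mult_distrib mult_ac)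
  qed
  also have "\<dots> < (cmod P)\<^sup>2"
    using * t complex_Re_le_cmod[of P] by (intro power_strict_mono) auto
  finally have "4 * cmod x * cmod y * (1 - t)\<^sup>2 < (cmod P)\<^sup>2" .
  moreover have "cmod (1 - of_real t) = 1 - t" using t by (metis norm_of_real of_real_1 of_real_diff abs_of_nonneg diff_ge_0_iff_ge)
  ultimately show "4 * x * y * (1 - of_real t)\<^sup>2 * (1 / P)\<^sup>2 \<in> ball 0 1"
    using nz by (simp add: norm_mult norm_divide norm_power power_divide divide_simps)
qed

context
  fixes x lam m c :: complex
  assumes x: "0 < cmod x" "cmod x < 1" and m: "Re m > 0" and q: "Re (lam - 2 * m + 1) > 0"
    and c: "c = lam - m + 1"
begin

private definition "P y t = 1 + x * y - (x + y) * t" for y t :: complex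
private definition "K = hyp2F1_reg (lam / 2) ((lam + 1) / 2) c"
private definition "v y t = 1 / P y t" for y t
private definition "s y t = 4 * x * y * (1 - t)\<^sup>2 * (v y t)\<^sup>2" for y t
private definition "sy y t = 4 * x * (1 - t)\<^sup>2 * (v y t)\<^sup>2 - 8 * x * y * (1 - t)\<^sup>2 * (x - t) * v y t ^ 3" for y t
private definition "syy y t = - 16 * x * (1 - t)\<^sup>2 * (x - t) * v y t ^ 3 + 24 * x * y * (1 - t)\<^sup>2 * (x - t)\<^sup>2 * v y t ^ 4" for y t
private definition "\<delta> y = (1 - x) * (1 - y)" for y
private definition "st y t = - 8 * x * y * (1 - t) * v y t ^ 3 * \<delta> y" for y t
private definition "E y t = P y t powr (- lam)" for y t
text \<open>\<open>N\<close> is the kernel of the product formula; \<open>N1\<close> and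
  \<open>N2\<close> are its first two derivatives in y.\<close>

private definition "N y t = E y t * K (s y t)" for y t
private definition "N1 y t = E y t * (sy y t * deriv K (s y t) - lam * (x - t) * v y t * K (s y t))" for y t
private definition "N2 y t = E y t * (lam * (lam + 1) * (x - t)\<^sup>2 * (v y t)\<^sup>2 * K (s y t) - 2 * lam * (x - t) * v y t * sy y t * deriv K (s y t)
    + syy y t * deriv K (s y t) + (sy y t)\<^sup>2 * deriv (deriv K) (s y t))" for y t
text \<open>\<open>M\<close> is minus the derivative of P^(-lam) K(4 x y (1 - t)^2 / P^2) in P with
  x, y, t held fixed; \<open>M1\<close> is the t-derivative of \<open>M\<close>.\<close>

private definition "M y t = E y t * v y t * (lam * K (s y t) + 2 * s y t * deriv K (s y t))" for y t
private definition "M1 y t = E y t * ((x + y) * (v y t)\<^sup>2 * (lam + 1) * (lam * K (s y t) + 2 * s y t * deriv K (s y t))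
    + v y t * st y t * (lam * deriv K (s y t) + 2 * deriv K (s y t) + 2 * s y t * deriv (deriv K) (s y t)))" for y t

private abbreviation "S \<equiv> product_domain x"

private lemma bounds:
  assumes "y \<in> S" "0 \<le> t" "t \<le> 1"
  shows "P y (of_real t) \<notin> \<real>\<^sub>\<le>\<^sub>0" "P y (of_real t) \<noteq> 0" "s y (of_real t) \<in> ball 0 1" "s y (of_real t) \<in> cut_plane"
  using product_domain_bounds[OF assms] ball_subset_cut_plane by (auto simp: P_def s_def v_def)

private lemma cP: "continuous_on (S \<times> {0..1}) (\<lambda>p. P (fst p) (complex_of_real (snd p)))"
  unfolding P_def by (intro continuous_intros)

private lemma cv: "continuous_on (S \<times> {0..1}) (\<lambda>p. v (fst p) (complex_of_real (snd p)))"
  unfolding v_def by (intro continuous_intros cP) (auto simp: bounds)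

private lemma cE: "continuous_on (S \<times> {0..1}) (\<lambda>p. E (fst p) (complex_of_real (snd p)))"
  unfolding E_def by (intro continuous_on_powr_slit cP) (auto simp: bounds)

private lemma cont_s: "continuous_on (S \<times> {0..1}) (\<lambda>p. s (fst p) (complex_of_real (snd p)))"
  unfolding s_def by (intro continuous_intros cv)

private lemma cK:
  "continuous_on (S \<times> {0..1}) (\<lambda>p. K (s (fst p) (complex_of_real (snd p))))"
  "continuous_on (S \<times> {0..1}) (\<lambda>p. deriv K (s (fst p) (complex_of_real (snd p))))"
  by (rule continuous_on_compose2[OF _ cont_s, of cut_plane];
      auto simp: bounds K_def intro!: holomorphic_on_imp_continuous_on holomorphic_deriv hyp2F1_reg_holomorphic open_cut_plane)+

private lemma cN:
  "continuous_on (S \<times> {0..1}) (\<lambda>(y, t). N y (complex_of_real t))"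
  "continuous_on (S \<times> {0..1}) (\<lambda>(y, t). N1 y (complex_of_real t))"
  unfolding case_prod_unfold N_def N1_def sy_def by (intro continuous_intros cE cK cv)+

private lemma dv_y: "((\<lambda>y. v y t) has_field_derivative - (x - t) * (v y t)\<^sup>2) (at y)" if "P y t \<noteq> 0" for y t
  unfolding v_def P_def using that[unfolded P_def]
  by (auto intro!: derivative_eq_intros simp: divide_simps power2_eq_square)

private lemma dE_y: "((\<lambda>y. E y t) has_field_derivative - lam * (x - t) * v y t * E y t) (at y)" if "P y t \<notin> \<real>\<^sub>\<le>\<^sub>0" "P y t \<noteq> 0" for y t
  unfolding v_def E_def P_def using that[unfolded P_def]
  by (auto intro!: derivative_eq_intros simp: powr_diff)

private lemma dv_t: "((\<lambda>t. v y t) has_field_derivative (x + y) * (v y t)\<^sup>2) (at t)" if "P y t \<noteq> 0" for y t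
  unfolding v_def P_def using that[unfolded P_def]
  by (auto intro!: derivative_eq_intros simp: divide_simps power2_eq_square)

private lemma dE_t: "((\<lambda>t. E y t) has_field_derivative lam * (x + y) * v y t * E y t) (at t)" if "P y t \<notin> \<real>\<^sub>\<le>\<^sub>0" "P y t \<noteq> 0" for y t
  unfolding v_def E_def P_def using that[unfolded P_def]
  by (auto intro!: derivative_eq_intros simp: powr_diff field_simps)

private lemma ds_y: "((\<lambda>y. s y t) has_field_derivative sy y t) (at y)" if "P y t \<noteq> 0" for y t
  unfolding s_def sy_def
  by (rule dv_y[OF that] derivative_eq_intros refl)+ (simp add: algebra_simps power2_eq_square power3_eq_cube)

private lemma dsy_y: "((\<lambda>y. sy y t) has_field_derivative syy y t) (at y)" if "P y t \<noteq> 0" for y t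
  unfolding sy_def syy_def
  by (rule dv_y[OF that] derivative_eq_intros refl)+ (simp add: algebra_simps eval_nat_numeral)

private lemma ds_t: "((\<lambda>t. s y t) has_field_derivative st y t) (at t)" if P: "P y t \<noteq> 0" for y t
proof -
  have "((\<lambda>t. s y t) has_field_derivative 8 * x * y * (1 - t) * (v y t)\<^sup>2 * ((1 - t) * (x + y) * v y t - 1)) (at t)"
    unfolding s_def
    by (rule dv_t[OF P] derivative_eq_intros refl)+ (simp add: algebra_simps power2_eq_square power3_eq_cube)
  also have "(1 - t) * (x + y) * v y t - 1 = - \<delta> y * v y t"
    using P by (simp add: v_def \<delta>_def divide_simps) (simp add: P_def algebra_simps)
  finally show ?thesis by (simp add: st_def mult_ac power2_eq_square power3_eq_cube)
qed

text \<open>One chain rule for both directions: the path given by \<open>f\<close> and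
  \<open>g\<close> either moves y at fixed t or moves t at fixed y.\<close>

private lemma dK:
  assumes "s y t \<in> cut_plane" "((\<lambda>u. s (f u) (g u)) has_field_derivative s') (at u)" "f u = y" "g u = t"
  shows "((\<lambda>u. K (s (f u) (g u))) has_field_derivative deriv K (s y t) * s') (at u)"
    and "((\<lambda>u. deriv K (s (f u) (g u))) has_field_derivative deriv (deriv K) (s y t) * s') (at u)"
  using DERIV_chain2[OF hyp2F1_reg_deriv(1)[OF assms(1)[folded assms(3,4)]] assms(2)]
    DERIV_chain2[OF hyp2F1_reg_deriv(2)[OF assms(1)[folded assms(3,4)]] assms(2)] assms(3,4) unfolding K_def by auto

private lemma dN: assumes y: "y \<in> S" and t: "0 \<le> t" "t \<le> 1"
  shows "((\<lambda>y. N y (of_real t)) has_field_derivative N1 y (of_real t)) (at y)"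
    and "((\<lambda>y. N1 y (of_real t)) has_field_derivative N2 y (of_real t)) (at y)"
proof -
  note b = bounds[OF y t]
  note dK' = dK[where f = "\<lambda>y. y" and g = "\<lambda>_. of_real t", OF b(4) ds_y[OF b(2)] refl refl]
  show "((\<lambda>y. N y (of_real t)) has_field_derivative N1 y (of_real t)) (at y)"
    unfolding N_def N1_def
    by (rule dE_y[OF b(1,2)] dK' derivative_eq_intros refl)+ (simp add: algebra_simps)
  show "((\<lambda>y. N1 y (of_real t)) has_field_derivative N2 y (of_real t)) (at y)"
    unfolding N1_def N2_def
    by (rule dE_y[OF b(1,2)] dK' dsy_y[OF b(2)] dv_y[OF b(2)] derivative_eq_intros refl)+ (simp add: algebra_simps power2_eq_square)
qed

private lemma dM: assumes y: "y \<in> S" and t: "0 \<le> t" "t \<le> 1"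
  shows "((\<lambda>t. M y t) has_field_derivative M1 y (of_real t)) (at (of_real t))"
proof -
  note b = bounds[OF y t]
  note dK' = dK[where f = "\<lambda>_. y" and g = "\<lambda>t. t", OF b(4) ds_t[OF b(2)] refl refl]
  show ?thesis
    unfolding M_def M1_def
    by (rule dE_t[OF b(1,2)] dK' ds_t[OF b(2)] dv_t[OF b(2)] derivative_eq_intros refl)+ (simp add: algebra_simps power2_eq_square)
qed

text \<open>Weighted with K'', K' and K, the identities of \<open>product_kernel_algebra\<close> add
  up to a multiple of the equation for K at s. Times the beta weight, the bracket on the right is
  the derivative of t^m (1 - t)^(c - m) M.\<close>

private lemma kernel_identity: assumes y: "y \<in> S" and t: "0 \<le> t" "t \<le> 1"
  shows "(1 - y) * (y * (1 - y) * N2 y (of_real t) + (c - (lam + m + 1) * y) * N1 y (of_real t) - lam * m * N y (of_real t)) =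
     - \<delta> y * ((m - c * of_real t) * M y (of_real t) + of_real t * (1 - of_real t) * M1 y (of_real t))"
proof -
  note b = bounds[OF y t]
  define T where "T = complex_of_real t"
  define \<kappa> where "\<kappa> = 4 * x * (1 - T)\<^sup>2 * (v y T)\<^sup>2 * (1 - y)\<^sup>2"
  note ids = product_kernel_algebra[OF P_def[of y T] b(2)[folded T_def] c refl v_def \<delta>_def s_def st_def sy_def syy_def \<kappa>_def]
  have ode: "4 * s y T * (1 - s y T) * deriv (deriv K) (s y T) + (4 * c - (4 * lam + 6) * s y T) * deriv K (s y T) - lam * (lam + 1) * K (s y T) = 0"
    using half_params_ode[OF b(4) K_def] by (simp add: T_def)
  define k0 k1 k2 where "k0 = K (s y T)" "k1 = deriv K (s y T)" "k2 = deriv (deriv K) (s y T)"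
  have "4 * ((1 - y) * (y * (1 - y) * N2 y T + (c - (lam + m + 1) * y) * N1 y T - lam * m * N y T)) =
     4 * (- \<delta> y * ((m - c * T) * M y T + T * (1 - T) * M1 y T))"
    using ids ode unfolding N2_def N1_def N_def M_def M1_def k0_k1_k2_def[symmetric] by algebra
  then show ?thesis unfolding T_def by simp
qed

text \<open>As a function of \<open>y\<close> the integral solves the hypergeometric equation, because the operator maps the
  kernel to a total \<open>t\<close>-derivative.\<close>

lemma product_formula:
  assumes y: "y \<in> product_domain x"
  shows "integral {0<..<1} (\<lambda>t. beta_weight m (lam - 2 * m + 1) t *
      ((1 + x * y - (x + y) * of_real t) powr (- lam) *
       hyp2F1_reg (lam / 2) ((lam + 1) / 2) c (4 * x * y * (1 - of_real t)\<^sup>2 / (1 + x * y - (x + y) * of_real t)\<^sup>2)))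
     = Gamma m * Gamma (lam - 2 * m + 1) * hyp2F1_reg lam m c x * hyp2F1_reg lam m c y"
proof -
  let ?w = "beta_weight m (lam - 2 * m + 1)"
  have cq: "c - m = lam - 2 * m + 1" and mq: "m + (lam - 2 * m + 1) = c" by (simp_all add: c)
  have "Re c > 0" using m q by (simp add: c)
  then have c0: "c \<notin> \<int>\<^sub>\<le>\<^sub>0" by (rule Re_pos_notin_nonpos_Ints)
  note w = beta_weight_absolutely_integrable[OF m q] continuous_on_beta_weight[of m "lam - 2 * m + 1"]
  define f where "f y = integral {0<..<1} (\<lambda>t. ?w t * N y (of_real t))" for y
  define f1 where "f1 y = integral {0<..<1} (\<lambda>t. ?w t * N1 y (of_real t))" for y
  define f2 where "f2 y = integral {0<..<1} (\<lambda>t. ?w t * N2 y (of_real t))" for y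
  have hN: "(\<lambda>z. N z (of_real t)) holomorphic_on S" "(\<lambda>z. N1 z (of_real t)) holomorphic_on S" if "t \<in> {0<..<1}" for t :: real
    unfolding holomorphic_on_def field_differentiable_def
    using dN[of _ t] that has_field_derivative_at_within by (fastforce intro!: exI)+
  have dN': "deriv (\<lambda>z. N z (of_real t)) y = N1 y (of_real t)" "deriv (\<lambda>z. N1 z (of_real t)) y = N2 y (of_real t)"
    if "t \<in> {0<..<1}" "y \<in> S" for t :: real and y using dN[of y t] that by (auto intro!: DERIV_imp_deriv)
  note h0 = holomorphic_weighted_integral[OF open_product_domain w cN(1) hN(1)]
  note h1 = holomorphic_weighted_integral[OF open_product_domain w cN(2) hN(2)]
  have df: "(f has_field_derivative f1 y) (at y)" if "y \<in> S" for y
  proof -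
    have "integral {0<..<1} (\<lambda>t. ?w t * deriv (\<lambda>z. N z (of_real t)) y) = f1 y"
      unfolding f1_def by (intro integral_cong) (simp add: dN' that)
    then show ?thesis using h0(3)[OF _ that] unfolding f_def by simp
  qed
  have df1: "(f1 has_field_derivative f2 y) (at y)" if "y \<in> S" for y
  proof -
    have "integral {0<..<1} (\<lambda>t. ?w t * deriv (\<lambda>z. N1 z (of_real t)) y) = f2 y"
      unfolding f2_def by (intro integral_cong) (simp add: dN' that)
    then show ?thesis using h1(3)[OF _ that] unfolding f1_def by simp
  qed
  have ode: "hyp_ode lam m c f y" if y: "y \<in> S" for y
  proof (rule hyp_odeI[OF open_product_domain y df df1[OF y]])
    have i0: "(\<lambda>t. ?w t * N y (of_real t)) integrable_on {0<..<1}"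
      using h0(1)[OF _ y] by (auto simp: absolutely_integrable_on_def)
    have i1: "(\<lambda>t. ?w t * N1 y (of_real t)) integrable_on {0<..<1}"
      using h1(1)[OF _ y] by (auto simp: absolutely_integrable_on_def)
    have "(\<lambda>t. ?w t * deriv (\<lambda>z. N1 z (of_real t)) y) integrable_on {0<..<1}"
      using h1(2)[OF _ y] by (auto simp: absolutely_integrable_on_def)
    then have i2: "(\<lambda>t. ?w t * N2 y (of_real t)) integrable_on {0<..<1}"
      by (rule integrable_eq) (simp add: dN' y)
    have "((\<lambda>t. (1 - y) * (y * (1 - y) * (?w t * N2 y (of_real t)) + (c - (lam + m + 1) * y) * (?w t * N1 y (of_real t)) - lam * m * (?w t * N y (of_real t))))
       has_integral (1 - y) * (y * (1 - y) * f2 y + (c - (lam + m + 1) * y) * f1 y - lam * m * f y)) {0<..<1}"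
      unfolding f_def f1_def f2_def
      by (intro has_integral_mult_right has_integral_add has_integral_diff integrable_integral i0 i1 i2)
    moreover have "((\<lambda>t. (1 - y) * (y * (1 - y) * (?w t * N2 y (of_real t)) + (c - (lam + m + 1) * y) * (?w t * N1 y (of_real t)) - lam * m * (?w t * N y (of_real t))))
       has_integral 0) {0<..<1}"
    proof -
      have cM: "continuous_on {0..1} (\<lambda>t. M y (complex_of_real t))"
      proof (rule continuous_at_imp_continuous_on, rule ballI)
        fix t :: real assume "t \<in> {0..1}"
        then have hM: "isCont (\<lambda>t. M y t) (of_real t)" using dM[OF y, of t] DERIV_isCont by auto
        then show "isCont (\<lambda>t. M y (complex_of_real t)) t" by (rule isCont_o2[where f = complex_of_real and g = "M y", rotated]) (auto intro!: continuous_intros)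
      qed
      have "((\<lambda>t. ?w t * ((m - (m + (lam - 2 * m + 1)) * of_real t) * M y (of_real t) + of_real t * (1 - of_real t) * M1 y (of_real t))) has_integral 0) {0<..<1}"
        by (rule beta_weight_total_derivative[OF m q cM]) (auto intro!: has_vector_derivative_real_field dM y)
      from has_integral_mult_right[OF this, of "- \<delta> y"]
      have "((\<lambda>t. - \<delta> y * (?w t * ((m - c * of_real t) * M y (of_real t) + of_real t * (1 - of_real t) * M1 y (of_real t)))) has_integral 0) {0<..<1}"
        unfolding mq by simp
      then show ?thesis
      proof (rule has_integral_eq[rotated])
        fix t :: real assume "t \<in> {0<..<1}"
        then have "?w t * ((1 - y) * (y * (1 - y) * N2 y (of_real t) + (c - (lam + m + 1) * y) * N1 y (of_real t) - lam * m * N y (of_real t))) =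
          ?w t * (- \<delta> y * ((m - c * of_real t) * M y (of_real t) + of_real t * (1 - of_real t) * M1 y (of_real t)))"
          using kernel_identity[OF y, of t] by simp
        then show "- \<delta> y * (?w t * ((m - c * of_real t) * M y (of_real t) + of_real t * (1 - of_real t) * M1 y (of_real t))) =
          (1 - y) * (y * (1 - y) * (?w t * N2 y (of_real t)) + (c - (lam + m + 1) * y) * (?w t * N1 y (of_real t)) - lam * m * (?w t * N y (of_real t)))"
          by (simp add: algebra_simps)
      qed
    qed
    ultimately have "(1 - y) * (y * (1 - y) * f2 y + (c - (lam + m + 1) * y) * f1 y - lam * m * f y) = 0"
      by (rule has_integral_unique)
    \<comment> \<open>The factor 1 - y of \<open>kernel_identity\<close> can be cancelled because Re
      ((1 - x) (1 - y)) > 0 on the domain.\<close>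
    moreover have "1 - y \<noteq> 0" using y by (auto simp: product_domain_def)
    ultimately show "y * (1 - y) * f2 y + (c - (lam + m + 1) * y) * f1 y - lam * m * f y = 0" by simp
  qed
  have "f y = f 0 * Gamma c * hyp2F1_reg lam m c y"
  proof (rule hyp_ode_unique[OF _ open_product_domain convex_connected[OF convex_product_domain] _ _ c0 _ y])
    show "f holomorphic_on S"
      unfolding holomorphic_on_def field_differentiable_def using df has_field_derivative_at_within by blast
    show "\<forall>\<^sub>F w in nhds 0. hyp_ode lam m c f w"
      by (rule eventually_mono[OF eventually_nhds_in_open[OF open_product_domain cnj_in_product_domain(2)[OF x]] ode])
    show "0 \<in> S" by (rule cnj_in_product_domain(2)[OF x])
    show "S \<subseteq> cut_plane"
    proof
      fix y assume y: "y \<in> S"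
      have "cmod y + cmod x < 1 + cmod x * cmod y"
        using y complex_Re_le_cmod[of "x * y"] by (auto simp: product_domain_def norm_mult)
      then have "0 < (1 - cmod x) * (1 - cmod y)" by (simp add: algebra_simps)
      then have "cmod y < 1" using x by (simp add: zero_less_mult_iff)
      then show "y \<in> cut_plane" using ball_subset_cut_plane by auto
    qed
  qed
  \<comment> \<open>At y = 0 the kernel is (1 - x t)^(-lam) times a constant, so the integral is
    Euler's.\<close>
  moreover have "f 0 * Gamma c = Gamma m * Gamma (lam - 2 * m + 1) * hyp2F1_reg lam m c x"
  proof -
    have "x \<in> cut_plane" using x ball_subset_cut_plane by auto
    from euler_integral[OF m, of c, unfolded cq, OF q this, of lam]
    have "integral {0<..<1} (\<lambda>t. ?w t * (1 - x * of_real t) powr - lam) = Gamma m * Gamma (lam - 2 * m + 1) * hyp2F1_reg lam m c x" .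
    moreover have "f 0 = integral {0<..<1} (\<lambda>t. ?w t * (1 - x * of_real t) powr - lam) * rGamma c"
      unfolding f_def N_def by (subst integral_mult_left[symmetric]) (simp add: E_def P_def s_def K_def hyp2F1_reg_0 mult.assoc)
    ultimately show ?thesis using c0 by (simp add: rGamma_inverse_Gamma Gamma_eq_zero_iff)
  qed
  ultimately show ?thesis by (simp add: f_def N_def E_def P_def s_def v_def K_def power_divide)
qed

end

section \<open>Behaviour at 1, and criteria for non-integrability\<close>

lemma rGamma_nonzero:
  assumes "(c::complex) \<notin> \<int>\<^sub>\<le>\<^sub>0"
  shows "rGamma c \<noteq> 0"
  using assms by (simp add: rGamma_eq_zero_iff)

lemma pochhammer_Suc_eq_rGamma_series:
  assumes "n > 0"
  shows "pochhammer (z::complex) (Suc n) = rGamma_series z n * (fact n * exp (z * of_real (ln (real n))))"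
  using assms by (simp add: rGamma_series_def)

text \<open>By Euler's limit, a (a + 1) ... (a + n) is \<open>rGamma_series a n\<close> times n!
  n^a. The factors n! n^a and their analogues cancel because a + b = c + d.\<close>

lemma pochhammer_ratio_limit:
  fixes a b c d :: complex
  assumes abcd: "a + b = c + d" and c: "c \<notin> \<int>\<^sub>\<le>\<^sub>0" and d: "d \<notin> \<int>\<^sub>\<le>\<^sub>0"
  shows "(\<lambda>n. pochhammer a n * pochhammer b n / (pochhammer c n * pochhammer d n)) \<longlonglongrightarrow>
           rGamma a * rGamma b / (rGamma c * rGamma d)"
proof -
  have "(\<lambda>n. rGamma_series a n * rGamma_series b n / (rGamma_series c n * rGamma_series d n)) \<longlonglongrightarrow>
     rGamma a * rGamma b / (rGamma c * rGamma d)"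
    using rGamma_nonzero[OF c] rGamma_nonzero[OF d]
    by (intro tendsto_intros) auto
  moreover have "eventually (\<lambda>n. rGamma_series a n * rGamma_series b n / (rGamma_series c n * rGamma_series d n) =
     pochhammer a (Suc n) * pochhammer b (Suc n) / (pochhammer c (Suc n) * pochhammer d (Suc n))) sequentially"
    using eventually_gt_at_top[of 0]
  proof eventually_elim
    case (elim n)
    have "exp (a * of_real (ln (real n))) * exp (b * of_real (ln (real n))) =
          exp (c * of_real (ln (real n))) * exp (d * of_real (ln (real n)))"
      unfolding exp_add[symmetric] distrib_right[symmetric] abcd ..
    then have e: "(fact n * exp (a * of_real (ln (real n)))) * (fact n * exp (b * of_real (ln (real n)))) =
          (fact n * exp (c * of_real (ln (real n)))) * (fact n * exp (d * of_real (ln (real n))) :: complex)"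
      by (simp add: mult_ac)
    have rearr: "(A * p) * (B * q) / ((C * r) * (D * s)) = A * B / (C * D)" if "p * q = r * s" "r * s \<noteq> 0" for A B C D p q r s :: complex
      using that by (simp add: divide_simps)
    show ?case unfolding pochhammer_Suc_eq_rGamma_series[OF elim]
      by (rule rearr[symmetric, OF e]) simp
  qed
  ultimately have "(\<lambda>n. pochhammer a (Suc n) * pochhammer b (Suc n) / (pochhammer c (Suc n) * pochhammer d (Suc n))) \<longlonglongrightarrow>
     rGamma a * rGamma b / (rGamma c * rGamma d)"
    by (rule Lim_transform_eventually)
  then show ?thesis by (rule LIMSEQ_imp_Suc)
qed

lemma hyp_fps_nth_eq:
  assumes "c \<notin> \<int>\<^sub>\<le>\<^sub>0"
  shows "fps_nth (hyp_fps a b c) n = rGamma c * (pochhammer a n * pochhammer b n / (pochhammer c n * fact n))"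
proof -
  have "pochhammer c n \<noteq> 0" using assms pochhammer_rGamma[of c n] by (auto simp: rGamma_eq_zero_iff)
  then show ?thesis using pochhammer_rGamma[of c n] by (simp add: field_simps)
qed

text \<open>The coefficients grow at most like n^(Re (a + b - c) - 1), those of (1 - u)^(-\<eta>)
  like n^(\<eta> - 1); Euler's limit shows that the quotient is bounded.\<close>

lemma hyp_fps_nth_bound:
  assumes c: "(c::complex) \<notin> \<int>\<^sub>\<le>\<^sub>0" and \<eta>: "\<eta> > 0" and le: "Re (a + b - c) \<le> \<eta>"
  obtains C where "C \<ge> 0" "\<And>n. norm (fps_nth (hyp_fps a b c) n) \<le> C * (pochhammer \<eta> n / fact n)"
proof -
  define X where "X n = norm (pochhammer a n * pochhammer b n / (pochhammer c n * of_real (pochhammer \<eta> n)))" for n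
  define Y where "Y n = norm (rGamma_series a n * rGamma_series b n / (rGamma_series c n * rGamma_series (of_real \<eta>) n))" for n
  have \<eta>': "complex_of_real \<eta> \<notin> \<int>\<^sub>\<le>\<^sub>0" using \<eta> by (intro Re_pos_notin_nonpos_Ints) simp
  have "Y \<longlonglongrightarrow> norm (rGamma a * rGamma b / (rGamma c * rGamma (of_real \<eta>)))"
    unfolding Y_def using rGamma_nonzero[OF c] rGamma_nonzero[OF \<eta>']
    by (intro tendsto_intros) auto
  then have "Bseq Y" using convergent_imp_Bseq convergentI by blast
  moreover have "eventually (\<lambda>n. norm (X (Suc n)) \<le> norm (Y n)) sequentially"
    using eventually_gt_at_top[of 0]
  proof eventually_elim
    case (elim n)
    have \<eta>p: "complex_of_real (pochhammer \<eta> (Suc n)) = rGamma_series (of_real \<eta>) n * (fact n * exp (of_real \<eta> * of_real (ln (real n))))"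
      using pochhammer_Suc_eq_rGamma_series[OF elim, of "of_real \<eta>"] by (simp add: pochhammer_of_real)
    have "X (Suc n) = Y n * norm (exp (a * of_real (ln (real n))) * exp (b * of_real (ln (real n))) / (exp (c * of_real (ln (real n))) * exp (of_real \<eta> * of_real (ln (real n)))))"
      unfolding X_def Y_def \<eta>p pochhammer_Suc_eq_rGamma_series[OF elim] norm_mult[symmetric]
      by (simp add: norm_mult norm_divide mult_ac)
    also have "exp (a * of_real (ln (real n))) * exp (b * of_real (ln (real n))) / (exp (c * of_real (ln (real n))) * exp (of_real \<eta> * of_real (ln (real n))))
       = exp ((a + b - c - of_real \<eta>) * of_real (ln (real n)))"
      by (simp add: exp_add[symmetric] exp_diff[symmetric] algebra_simps)
    also have "norm \<dots> = exp ((Re (a + b - c) - \<eta>) * ln (real n))" by simp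
    also have "Y n * exp ((Re (a + b - c) - \<eta>) * ln (real n)) \<le> Y n * 1"
      using le elim by (intro mult_left_mono) (simp_all add: mult_nonpos_nonneg Y_def)
    finally have "X (Suc n) \<le> Y n * 1" .
    then show ?case by (simp add: X_def Y_def)
  qed
  ultimately have "Bseq (\<lambda>n. X (Suc n))" by (rule Bseq_eventually_mono[rotated])
  then have "Bseq X" by (simp add: Bseq_Suc_iff)
  then obtain B where B: "B > 0" "\<And>n. norm (X n) \<le> B" by (auto simp: Bseq_def)
  show ?thesis
  proof (rule that)
    show "norm (rGamma c) * B \<ge> 0" using B by simp
    fix n
    have "pochhammer \<eta> n > 0" using \<eta> by (rule pochhammer_pos)
    then have "norm (fps_nth (hyp_fps a b c) n) = norm (rGamma c) * (X n * (pochhammer \<eta> n / fact n))"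
      unfolding hyp_fps_nth_eq[OF c] X_def by (simp add: norm_mult norm_divide)
    also have "\<dots> \<le> norm (rGamma c) * (B * (pochhammer \<eta> n / fact n))"
      using B(2)[of n] \<open>pochhammer \<eta> n > 0\<close> by (intro mult_left_mono mult_right_mono) auto
    finally show "norm (fps_nth (hyp_fps a b c) n) \<le> norm (rGamma c) * B * (pochhammer \<eta> n / fact n)" by (simp add: mult.assoc)
  qed
qed

lemma binomial_series_neg:
  fixes \<eta> u :: real
  assumes "0 \<le> u" "u < 1"
  shows "(\<lambda>n. pochhammer \<eta> n / fact n * u ^ n) sums (1 - u) powr (- \<eta>)"
proof -
  have "(- 1) ^ n * pochhammer \<eta> n / fact n * (- u) ^ n = pochhammer \<eta> n / fact n * u ^ n" for n
    by (cases "even n") simp_all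
  note eq = this
  show ?thesis using gen_binomial_real[of "- u" "- \<eta>"] assms unfolding gbinomial_pochhammer minus_minus eq by simp
qed

lemma binomial_series_neg_complex:
  fixes u :: complex
  assumes "norm u < 1"
  shows "(\<lambda>n. pochhammer \<sigma> n / fact n * u ^ n) sums (1 - u) powr (- \<sigma>)"
proof -
  have "(- 1) ^ n * pochhammer \<sigma> n / fact n * (- u) ^ n = pochhammer \<sigma> n / fact n * u ^ n" for n
    by (cases "even n") simp_all
  note eq = this
  show ?thesis using gen_binomial_complex[of "- u" "- \<sigma>"] assms unfolding gbinomial_pochhammer minus_minus eq by simp
qed

text \<open>Termwise comparison with the binomial series of (1 - u)^(-\<eta>).\<close>

lemma hyp2F1_reg_growth:
  assumes c: "(c::complex) \<notin> \<int>\<^sub>\<le>\<^sub>0" and \<eta>: "\<eta> > 0" and le: "Re (a + b - c) \<le> \<eta>"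
  obtains C where "C \<ge> 0" "\<And>u. 0 \<le> u \<Longrightarrow> u < 1 \<Longrightarrow> norm (hyp2F1_reg a b c (of_real u)) \<le> C * (1 - u) powr (- \<eta>)"
proof -
  obtain C where C: "C \<ge> 0" "\<And>n. norm (fps_nth (hyp_fps a b c) n) \<le> C * (pochhammer \<eta> n / fact n)"
    using hyp_fps_nth_bound[OF assms] by blast
  show ?thesis
  proof (rule that[OF C(1)])
    fix u :: real assume u: "0 \<le> u" "u < 1"
    have s: "(\<lambda>n. C * (pochhammer \<eta> n / fact n * u ^ n)) sums (C * (1 - u) powr (- \<eta>))"
      by (intro sums_mult binomial_series_neg u)
    have "norm (\<Sum>n. fps_nth (hyp_fps a b c) n * of_real u ^ n) \<le> (\<Sum>n. C * (pochhammer \<eta> n / fact n * u ^ n))"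
    proof (rule norm_suminf_le)
      show "norm (fps_nth (hyp_fps a b c) n * of_real u ^ n) \<le> C * (pochhammer \<eta> n / fact n * u ^ n)" for n
        using mult_right_mono[OF C(2)[of n], of "u ^ n"] u by (simp add: norm_mult norm_power mult.assoc del: hyp_fps_nth)
    qed (use s in \<open>simp add: sums_iff\<close>)
    moreover have "(\<Sum>n. fps_nth (hyp_fps a b c) n * of_real u ^ n) = hyp2F1_reg a b c (of_real u)"
      using hyp2F1_reg_sums[of "of_real u" a b c] u by (simp add: sums_iff del: hyp_fps_nth)
    ultimately show "norm (hyp2F1_reg a b c (of_real u)) \<le> C * (1 - u) powr (- \<eta>)" using s by (simp add: sums_iff)
  qed
qed

text \<open>An Abelian argument: with s = a + b - c, the coefficients are k + o(1) times those of (1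
  - u)^(-s). After multiplication by (1 - u)^s finitely many terms of the difference tend to 0, and
  the tail is at most \<epsilon>' C.\<close>

lemma hyp2F1_reg_at_1:
  assumes c: "c \<notin> \<int>\<^sub>\<le>\<^sub>0" and \<sigma>: "Re (a + b - c) > 0"
  shows "((\<lambda>u. hyp2F1_reg a b c (of_real u) * of_real (1 - u) powr (a + b - c)) \<longlongrightarrow>
            Gamma (a + b - c) * rGamma a * rGamma b) (at_left 1)"
proof -
  define s where "s = a + b - c"
  define k where "k = Gamma s * rGamma a * rGamma b"
  have s: "Re s > 0" using \<sigma> by (simp add: s_def)
  have s0: "s \<notin> \<int>\<^sub>\<le>\<^sub>0" using s by (rule Re_pos_notin_nonpos_Ints)
  have G: "Gamma s * rGamma s = 1" using s0 by (simp add: rGamma_inverse_Gamma Gamma_eq_zero_iff)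
  define r where "r n = rGamma c * (pochhammer a n * pochhammer b n / (pochhammer c n * pochhammer s n))" for n
  have "r \<longlonglongrightarrow> rGamma c * (rGamma a * rGamma b / (rGamma c * rGamma s))"
    unfolding r_def by (intro tendsto_mult tendsto_const pochhammer_ratio_limit c s0) (simp add: s_def)
  moreover have "rGamma c * (rGamma a * rGamma b / (rGamma c * rGamma s)) = k"
    using G rGamma_nonzero[OF c] rGamma_nonzero[OF s0]
    unfolding k_def by (simp add: field_simps)
  ultimately have r: "r \<longlonglongrightarrow> k" by simp
  let ?f = "fps_nth (hyp_fps a b c)"
  define e where "e n = ?f n - k * (pochhammer s n / fact n)" for n
  have ps: "pochhammer s n \<noteq> 0" for n using s0 pochhammer_rGamma[of s n] by (auto simp: rGamma_eq_zero_iff)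
  have e: "e n = (r n - k) * (pochhammer s n / fact n)" for n
    unfolding e_def hyp_fps_nth_eq[OF c] r_def using ps[of n] by (simp add: field_simps)
  have one: "(1::complex) \<notin> \<int>\<^sub>\<le>\<^sub>0" by (rule Re_pos_notin_nonpos_Ints) simp
  \<comment> \<open>The special case F(s, 1; 1) bounds the coefficients of (1 - u)^(-s) with complex
    s by those with exponent Re s.\<close>
  obtain C where C: "C \<ge> 0" "\<And>n. norm (fps_nth (hyp_fps s 1 1) n) \<le> C * (pochhammer (Re s) n / fact n)"
    using hyp_fps_nth_bound[OF one s, of s 1] by auto
  have sb: "norm (pochhammer s n / fact n) \<le> C * (pochhammer (Re s) n / fact n)" for n
    using C(2)[of n] unfolding hyp_fps_nth_eq[OF one] by (simp add: pochhammer_fact[symmetric])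
  have main: "eventually (\<lambda>u. norm (hyp2F1_reg a b c (of_real u) * of_real (1 - u) powr s - k) < \<epsilon>) (at_left 1)" if \<epsilon>: "\<epsilon> > 0" for \<epsilon>
  proof -
    define \<epsilon>' where "\<epsilon>' = \<epsilon> / (2 * (C + 1))"
    have \<epsilon>': "\<epsilon>' > 0" using \<epsilon> C(1) by (simp add: \<epsilon>'_def)
    obtain N where N: "\<And>n. n \<ge> N \<Longrightarrow> norm (r n - k) < \<epsilon>'"
      using r \<epsilon>' by (meson LIMSEQ_D)
    define A where "A = (\<Sum>n<N. norm (e n))"
    have b: "norm (hyp2F1_reg a b c (of_real u) * of_real (1 - u) powr s - k) \<le> A * (1 - u) powr Re s + \<epsilon>' * C" if u: "0 \<le> u" "u < 1" for u
    proof -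
      have su: "(\<lambda>n. e n * of_real u ^ n) sums (hyp2F1_reg a b c (of_real u) - k * (1 - of_real u) powr (- s))"
        using sums_diff[OF hyp2F1_reg_sums[of "of_real u" a b c] sums_mult[OF binomial_series_neg_complex[of "of_real u" s], of k]] u
        by (simp add: e_def algebra_simps del: hyp_fps_nth)
      define h where "h n = (if n < N then norm (e n) else 0) + \<epsilon>' * (C * (pochhammer (Re s) n / fact n * u ^ n))" for n
      have "h sums (A + \<epsilon>' * (C * (1 - u) powr (- Re s)))"
        unfolding h_def A_def using sums_If_finite_set[of "{..<N}" "\<lambda>n. norm (e n)"]
        by (intro sums_add sums_mult binomial_series_neg u) simp
      moreover have "norm (e n * of_real u ^ n) \<le> h n" for n
      proof (cases "n < N")
        case True
        have "norm (e n * of_real u ^ n) \<le> norm (e n) * 1"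
          unfolding norm_mult norm_power using u by (intro mult_left_mono power_le_one) auto
        moreover have "0 \<le> \<epsilon>' * (C * (pochhammer (Re s) n / fact n * u ^ n))"
          using \<epsilon>' C(1) u pochhammer_pos[OF s, of n] by simp
        ultimately show ?thesis using True by (simp add: h_def)
      next
        case False
        have "norm (e n * of_real u ^ n) \<le> \<epsilon>' * (C * (pochhammer (Re s) n / fact n)) * u ^ n"
          unfolding e norm_mult[of _ "_ ^ _"] norm_power norm_of_real norm_mult[of "r n - k"]
          using u N[of n] False sb[of n] \<epsilon>' C(1) pochhammer_pos[OF s, of n] by (intro mult_mono) auto
        then show ?thesis using False by (simp add: h_def mult.assoc)
      qed
      ultimately have "norm (hyp2F1_reg a b c (of_real u) - k * (1 - of_real u) powr (- s)) \<le> A + \<epsilon>' * (C * (1 - u) powr (- Re s))"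
        using norm_suminf_le[of "\<lambda>n. e n * of_real u ^ n" h] su by (simp add: sums_iff)
      then have "norm (hyp2F1_reg a b c (of_real u) - k * (1 - of_real u) powr (- s)) * (1 - u) powr Re s \<le> (A + \<epsilon>' * (C * (1 - u) powr (- Re s))) * (1 - u) powr Re s"
        by (rule mult_right_mono) simp
      also have "\<dots> = A * (1 - u) powr Re s + \<epsilon>' * C"
        using u by (simp add: algebra_simps powr_minus)
      also have "norm (hyp2F1_reg a b c (of_real u) - k * (1 - of_real u) powr (- s)) * (1 - u) powr Re s
         = norm ((hyp2F1_reg a b c (of_real u) - k * (1 - of_real u) powr (- s)) * of_real (1 - u) powr s)"
        using u by (simp add: norm_mult norm_powr_real_powr del: of_real_diff)
      also have "(hyp2F1_reg a b c (of_real u) - k * (1 - of_real u) powr (- s)) * of_real (1 - u) powr s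
         = hyp2F1_reg a b c (of_real u) * of_real (1 - u) powr s - k"
        using u by (auto simp: algebra_simps powr_minus)
      finally show ?thesis .
    qed
    have "((\<lambda>u. A * (1 - u) powr Re s + \<epsilon>' * C) \<longlongrightarrow> A * 0 + \<epsilon>' * C) (at_left 1)"
    proof (intro tendsto_intros)
      have "((\<lambda>u::real. (1 - u)) \<longlongrightarrow> 1 - 1) (at_left 1)" by (intro tendsto_intros)
      then show "((\<lambda>u. (1 - u) powr Re s) \<longlongrightarrow> 0) (at_left 1)"
        using s by (intro tendsto_zero_powrI[where b = "Re s"]) (auto intro!: eventually_at_leftI[of 0])
    qed
    moreover have "\<epsilon>' * C < \<epsilon>"
    proof -
      have "\<epsilon>' * C \<le> \<epsilon>' * (C + 1)" using \<epsilon>' by simp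
      also have "\<dots> = \<epsilon> / 2" using C(1) by (simp add: \<epsilon>'_def field_simps)
      also have "\<dots> < \<epsilon>" using \<epsilon> by simp
      finally show ?thesis .
    qed
    ultimately have "eventually (\<lambda>u. A * (1 - u) powr Re s + \<epsilon>' * C < \<epsilon>) (at_left 1)"
      by (intro order_tendstoD(2)[where y = "A * 0 + \<epsilon>' * C"]) auto
    moreover have "eventually (\<lambda>u::real. u \<in> {0<..<1}) (at_left 1)"
      by (rule eventually_at_leftI[of 0]) auto
    ultimately show ?thesis
    proof eventually_elim
      case (elim u)
      then show ?case using b[of u] by auto
    qed
  qed
  show ?thesis unfolding s_def[symmetric] k_def[symmetric]
    by (rule tendstoI) (use main in \<open>simp add: dist_norm\<close>)
qed

section \<open>Power-like functions that are not integrable\<close>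

lemma norm_integral_lower_bound:
  fixes f :: "real \<Rightarrow> complex"
  assumes f: "f integrable_on {a..b}" and ab: "a \<le> b"
    and le: "\<And>y. a \<le> y \<Longrightarrow> y \<le> b \<Longrightarrow> norm (f y - A) \<le> B"
  shows "norm (integral {a..b} f) \<ge> (norm A - B) * (b - a)"
proof -
  have "((\<lambda>y. f y - A) has_integral (integral {a..b} f - (b - a) *\<^sub>R A)) {a..b}"
    using has_integral_const_real[of A a b] ab by (intro has_integral_diff integrable_integral f) simp
  then have "norm (integral {a..b} f - (b - a) *\<^sub>R A) \<le> B * (b - a)"
    using has_integral_bound[of B "\<lambda>y. f y - A" _ a b] le ab order_trans[OF norm_ge_zero le[of a]]
    by simp
  moreover have "norm ((b - a) *\<^sub>R A) = (b - a) * norm A" using ab by simp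
  ultimately show ?thesis
    using norm_triangle_ineq2[of "(b - a) *\<^sub>R A" "(b - a) *\<^sub>R A - integral {a..b} f"]
    by (simp add: norm_minus_commute algebra_simps)
qed

text \<open>On \<open>[y, r y]\<close> with \<open>r\<close> close to 1 the phase of \<open>y\<^sup>p\<close> is nearly constant, so there is no cancellation
  and the integral over \<open>[y, r y]\<close> is of order \<open>y\<^bsup>Re p + 1\<^esup>\<close>.\<close>

lemma power_like_integral_lower_bound:
  fixes f :: "real \<Rightarrow> complex"
  assumes lim: "((\<lambda>y. f y * of_real y powr (- p)) \<longlongrightarrow> k) F" and k: "k \<noteq> 0"
  obtains r \<delta> where "1 < r" "r \<le> 2" "\<delta> > 0"
    "\<And>Y. Y > 0 \<Longrightarrow> f integrable_on {Y..r * Y} \<Longrightarrow>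
        (\<And>y. Y \<le> y \<Longrightarrow> y \<le> r * Y \<Longrightarrow> norm (f y * of_real y powr (- p) - k) \<le> norm k / 4) \<Longrightarrow>
        norm (integral {Y..r * Y} f) \<ge> \<delta> * Y powr (Re p + 1)"
proof -
  have "((\<lambda>v::real. complex_of_real v powr p) \<longlongrightarrow> complex_of_real 1 powr p) (at 1)"
    by (intro tendsto_intros) auto
  then have "eventually (\<lambda>v. dist (complex_of_real v powr p) 1 < 1 / 4) (at 1)"
    by (intro tendstoD) auto
  then obtain d where d: "d > 0" "\<And>v. v \<noteq> 1 \<Longrightarrow> dist v 1 < d \<Longrightarrow> dist (complex_of_real v powr p) 1 < 1 / 4"
    unfolding eventually_at by auto
  define r where "r = 1 + min (d / 2) 1"
  have r: "1 < r" "r \<le> 2" "r - 1 < d" using d(1) by (auto simp: r_def)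
  have v: "norm (complex_of_real v powr p - 1) \<le> 1 / 4" if "1 \<le> v" "v \<le> r" for v
    using d(2)[of v] that r by (cases "v = 1") (auto simp: dist_norm)
  \<comment> \<open>The relative error of f on [Y, r Y] is at most 9/16 = 5/16 + 1/4, the first part
    from the limit and the second from the phase; 7/16 is what remains.\<close>
  define \<delta> where "\<delta> = norm k * (7 / 16) * (r - 1)"
  show ?thesis
  proof (rule that[OF r(1,2)])
    show "\<delta> > 0" using k r by (simp add: \<delta>_def)
    fix Y :: real
    assume Y: "Y > 0" and int: "f integrable_on {Y..r * Y}"
      and near: "\<And>y. Y \<le> y \<Longrightarrow> y \<le> r * Y \<Longrightarrow> norm (f y * of_real y powr (- p) - k) \<le> norm k / 4"
    have "norm (f y - of_real Y powr p * k) \<le> Y powr Re p * (norm k * (9 / 16))" if y: "Y \<le> y" "y \<le> r * Y" for y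
    proof -
      define w where "w = complex_of_real (y / Y) powr p"
      define h where "h = f y * of_real y powr (- p)"
      have "y > 0" using y Y by simp
      then have w: "complex_of_real y powr p = of_real Y powr p * w"
        using Y powr_times_real[of "complex_of_real Y" "complex_of_real (y / Y)" p] by (simp add: w_def)
      have fy: "f y = complex_of_real y powr p * h" using \<open>y > 0\<close> by (simp add: h_def powr_minus)
      have w1: "norm (w - 1) \<le> 1 / 4" unfolding w_def using y Y by (intro v) (auto simp: field_simps)
      then have "norm w \<le> 5 / 4" using norm_triangle_ineq[of "w - 1" 1] by simp
      have "norm (w * h - k) \<le> norm (w * (h - k)) + norm (k * (w - 1))"
        using norm_triangle_ineq[of "w * (h - k)" "k * (w - 1)"] by (simp add: algebra_simps)
      also have "\<dots> \<le> 5 / 4 * (norm k / 4) + norm k * (1 / 4)"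
        unfolding norm_mult using near[OF y] w1 \<open>norm w \<le> 5 / 4\<close>
        by (intro add_mono mult_mono) (auto simp: h_def)
      finally have "norm (w * h - k) \<le> norm k * (9 / 16)" by simp
      moreover have "f y - of_real Y powr p * k = of_real Y powr p * (w * h - k)"
        unfolding fy w by (simp add: algebra_simps)
      ultimately show ?thesis using Y by (simp add: norm_mult norm_powr_real_powr)
    qed
    from norm_integral_lower_bound[OF int _ this] Y r
    have "norm (integral {Y..r * Y} f) \<ge> (norm (complex_of_real Y powr p * k) - Y powr Re p * (norm k * (9 / 16))) * (r * Y - Y)"
      by simp
    also have "(norm (complex_of_real Y powr p * k) - Y powr Re p * (norm k * (9 / 16))) * (r * Y - Y) = \<delta> * Y powr (Re p + 1)"
      using Y by (simp add: \<delta>_def norm_mult norm_powr_real_powr powr_add algebra_simps)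
    finally show "norm (integral {Y..r * Y} f) \<ge> \<delta> * Y powr (Re p + 1)" .
  qed
qed

text \<open>Integrability is in the gauge sense, where cancellation is allowed, so divergence of the
  absolute value is not enough. The integrals over [Y, r Y] would have to tend to 0, but the lower
  bound keeps their modulus at least \<delta>.\<close>

lemma not_integrable_at_infinity:
  fixes f :: "real \<Rightarrow> complex"
  assumes f: "f integrable_on {1<..}" and lim: "((\<lambda>y. f y * of_real y powr (- p)) \<longlongrightarrow> k) at_top"
    and k: "k \<noteq> 0" and p: "Re p \<ge> -1"
  shows False
proof -
  obtain r \<delta> where r: "1 < r" "r \<le> 2" "\<delta> > 0" and
    lower: "\<And>Y. Y > 0 \<Longrightarrow> f integrable_on {Y..r * Y} \<Longrightarrow>
        (\<And>y. Y \<le> y \<Longrightarrow> y \<le> r * Y \<Longrightarrow> norm (f y * of_real y powr (- p) - k) \<le> norm k / 4) \<Longrightarrow>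
        norm (integral {Y..r * Y} f) \<ge> \<delta> * Y powr (Re p + 1)"
    using power_like_integral_lower_bound[OF lim k] by blast
  have "eventually (\<lambda>y. dist (f y * of_real y powr (- p)) k < norm k / 4) at_top"
    using k by (intro tendstoD[OF lim]) simp
  then obtain Y0 where Y0: "\<And>y. y \<ge> Y0 \<Longrightarrow> norm (f y * of_real y powr (- p) - k) < norm k / 4"
    unfolding eventually_at_top_linorder dist_norm by blast
  define g where "g x = (if x \<in> {1<..} then f x else 0)" for x
  obtain I where "(f has_integral I) {1<..}" using f by auto
  \<comment> \<open>Integrability on an unbounded set means that the integrals of the zero extension
    over large intervals approach I; this is used for [-Y, Y] and [-Y, r Y].\<close>
  then have gi: "\<And>a b. g integrable_on {a..b}"
    and "\<forall>e>0. \<exists>B>0. \<forall>a b. ball 0 B \<subseteq> {a..b} \<longrightarrow> norm (integral {a..b} g - I) < e"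
    unfolding has_integral_alt'[of f I] g_def by auto
  then obtain B where B: "B > 0" "\<And>a b. ball 0 B \<subseteq> {a..b} \<Longrightarrow> norm (integral {a..b} g - I) < \<delta> / 2"
    using r(3) by (meson half_gt_zero)
  define Y where "Y = Max {Y0, B, 2}"
  have Y: "Y \<ge> Y0" "Y \<ge> B" "Y \<ge> 2" by (auto simp: Y_def)
  have Y': "r * Y \<ge> Y" using Y r by simp
  have 1: "norm (integral {- Y..Y} g - I) < \<delta> / 2" "norm (integral {- Y..r * Y} g - I) < \<delta> / 2"
  proof -
    have "x \<in> {- Y..Y} \<and> x \<in> {- Y..r * Y}" if "x \<in> ball 0 B" for x
    proof -
      have "\<bar>x\<bar> < B" using that by (simp add: dist_norm)
      then have "- Y \<le> x" "x \<le> Y" using Y by linarith+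
      then show ?thesis using Y' order_trans by auto
    qed
    then have "ball 0 B \<subseteq> {- Y..Y}" "ball 0 B \<subseteq> {- Y..r * Y}" by blast+
    then show "norm (integral {- Y..Y} g - I) < \<delta> / 2" "norm (integral {- Y..r * Y} g - I) < \<delta> / 2"
      using B(2) by blast+
  qed
  have "integral {- Y..Y} g + integral {Y..r * Y} g = integral {- Y..r * Y} g"
    using Y Y' by (intro Henstock_Kurzweil_Integration.integral_combine gi) auto
  then have eq: "integral {Y..r * Y} g = (integral {- Y..r * Y} g - I) - (integral {- Y..Y} g - I)" by (simp add: algebra_simps)
  have 2: "norm (integral {Y..r * Y} g) < \<delta>"
    unfolding eq using 1 norm_triangle_ineq4[of "integral {- Y..r * Y} g - I" "integral {- Y..Y} g - I"] by linarith
  have eq': "integral {Y..r * Y} f = integral {Y..r * Y} g"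
    using Y by (intro integral_cong) (auto simp: g_def)
  have "norm (integral {Y..r * Y} f) \<ge> \<delta> * Y powr (Re p + 1)"
  proof (rule lower)
    show "f integrable_on {Y..r * Y}"
      by (rule integrable_eq[OF gi[of Y "r * Y"]]) (use Y in \<open>auto simp: g_def\<close>)
    show "norm (f y * of_real y powr (- p) - k) \<le> norm k / 4" if "Y \<le> y" "y \<le> r * Y" for y
      using that Y by (intro less_imp_le[OF Y0]) linarith
  qed (use Y in linarith)
  moreover have "\<delta> * Y powr (Re p + 1) \<ge> \<delta> * 1"
    using p Y r(3) by (intro mult_left_mono ge_one_powr_ge_zero) auto
  ultimately show False using 2 eq' by simp
qed

text \<open>The indefinite integral from a is continuous at a, so the integrals over
  [a + Y, a + r Y] tend to 0 with Y, against the same lower bound.\<close>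

lemma not_integrable_at_right:
  fixes f :: "real \<Rightarrow> complex"
  assumes f: "f integrable_on {a<..}" and lim: "((\<lambda>y. f y * of_real (y - a) powr (- p)) \<longlongrightarrow> k) (at_right a)"
    and k: "k \<noteq> 0" and p: "Re p \<le> -1"
  shows False
proof -
  define h where "h y = f (a + y)" for y
  have lim': "((\<lambda>y. h y * of_real y powr (- p)) \<longlongrightarrow> k) (at_right 0)"
    using lim unfolding h_def by (subst (asm) filterlim_at_right_to_0) (simp add: add.commute)
  obtain r \<delta> where r: "1 < r" "r \<le> 2" "\<delta> > 0" and
    lower: "\<And>Y. Y > 0 \<Longrightarrow> h integrable_on {Y..r * Y} \<Longrightarrow>
        (\<And>y. Y \<le> y \<Longrightarrow> y \<le> r * Y \<Longrightarrow> norm (h y * of_real y powr (- p) - k) \<le> norm k / 4) \<Longrightarrow>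
        norm (integral {Y..r * Y} h) \<ge> \<delta> * Y powr (Re p + 1)"
    using power_like_integral_lower_bound[OF lim' k] by blast
  have "eventually (\<lambda>y. dist (h y * of_real y powr (- p)) k < norm k / 4) (at_right 0)"
    using k by (intro tendstoD[OF lim']) simp
  then obtain Y0 where Y0: "Y0 > 0" "\<And>y. y > 0 \<Longrightarrow> y < Y0 \<Longrightarrow> norm (h y * of_real y powr (- p) - k) < norm k / 4"
    unfolding eventually_at_right_field dist_norm by auto
  define g where "g x = (if x \<in> {a<..} then f x else 0)" for x
  have "g integrable_on UNIV" using f unfolding g_def by (simp only: integrable_restrict_UNIV)
  then have gi: "\<And>b c. g integrable_on {b..c}" by (simp add: integrable_on_subinterval)
  have "continuous_on {a..a + 1} (\<lambda>x. integral {a..x} g)" by (rule indefinite_integral_continuous_1[OF gi])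
  then have "((\<lambda>x. integral {a..x} g) \<longlongrightarrow> integral {a..a} g) (at a within {a..a + 1})"
    unfolding continuous_on_def by (rule bspec) simp
  then have "eventually (\<lambda>x. dist (integral {a..x} g) 0 < \<delta> / 2) (at a within {a..a + 1})"
    using r(3) by (intro tendstoD) auto
  then obtain d where d: "d > 0" "\<And>x. x \<in> {a..a + 1} \<Longrightarrow> x \<noteq> a \<Longrightarrow> dist x a < d \<Longrightarrow> norm (integral {a..x} g) < \<delta> / 2"
    unfolding eventually_at by (auto simp: dist_norm)
  define Y where "Y = Min {Y0, d, 1} / 4"
  have Y: "Y > 0" "4 * Y \<le> Y0" "4 * Y \<le> d" "4 * Y \<le> 1" using Y0 d by (auto simp: Y_def)
  have rY: "r * Y \<le> 2 * Y" "Y \<le> r * Y" using r Y by auto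
  have 1: "norm (integral {a..a + Y} g) < \<delta> / 2" "norm (integral {a..a + r * Y} g) < \<delta> / 2"
    using d(2)[of "a + Y"] d(2)[of "a + r * Y"] Y rY by (auto simp: dist_norm)
  have "integral {a..a + Y} g + integral {a + Y..a + r * Y} g = integral {a..a + r * Y} g"
    using Y rY by (intro Henstock_Kurzweil_Integration.integral_combine gi) auto
  then have 2: "norm (integral {a + Y..a + r * Y} g) < \<delta>"
    using 1 norm_triangle_ineq4[of "integral {a..a + r * Y} g" "integral {a..a + Y} g"] by (smt (verit) add_diff_cancel_left' field_sum_of_halves)
  have "f integrable_on {a + Y..a + r * Y}"
    by (rule integrable_eq[OF gi[of "a + Y" "a + r * Y"]]) (use Y in \<open>auto simp: g_def\<close>)
  moreover have "integral {a + Y..a + r * Y} f = integral {a + Y..a + r * Y} g"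
    using Y by (intro integral_cong) (auto simp: g_def)
  ultimately have "(f has_integral integral {a + Y..a + r * Y} g) {a + Y..a + r * Y}"
    using integrable_integral by metis
  then have h: "(h has_integral integral {a + Y..a + r * Y} g) {Y..r * Y}"
    using has_integral_affinity'[of f "integral {a + Y..a + r * Y} g" "a + Y" "a + r * Y" 1 a] unfolding h_def by (simp add: add.commute)
  have "norm (integral {Y..r * Y} h) \<ge> \<delta> * Y powr (Re p + 1)"
  proof (rule lower[OF Y(1)])
    show "h integrable_on {Y..r * Y}" using h by blast
    show "norm (h y * of_real y powr (- p) - k) \<le> norm k / 4" if "Y \<le> y" "y \<le> r * Y" for y
      using that Y rY by (intro less_imp_le Y0(2)) linarith+
  qed
  moreover have "\<delta> * Y powr (Re p + 1) \<ge> \<delta> * 1"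
    using p Y r(3) powr_mono'[of "Re p + 1" 0 Y] by (intro mult_left_mono) auto
  ultimately show False using 2 integral_unique[OF h] by simp
qed

section \<open>Legendre and Ferrers functions\<close>

definition legendre_domain :: "complex set" where "legendre_domain = - complex_of_real ` {..1}"

lemma legendre_domain_iff: "z \<in> legendre_domain \<longleftrightarrow> Im z \<noteq> 0 \<or> Re z > 1"
  by (auto simp: legendre_domain_def image_iff complex_eq_iff)

lemma open_legendre_domain: "open legendre_domain"
proof -
  have eq: "legendre_domain = {z. Im z < 0} \<union> {z. Im z > 0} \<union> {z. Re z > 1}"
    by (auto simp: legendre_domain_iff)
  show ?thesis unfolding eq
    by (intro open_Un open_halfspace_Im_lt open_halfspace_Im_gt open_halfspace_Re_gt)
qed

lemma connected_legendre_domain: "connected legendre_domain"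
proof (rule starlike_imp_connected)
  show "starlike legendre_domain"
    unfolding starlike_def
  proof (intro bexI[of _ 2] ballI subsetI)
    fix x y assume x: "x \<in> legendre_domain" and "y \<in> closed_segment 2 x"
    then obtain u where u: "0 \<le> u" "u \<le> 1" "y = (1 - u) *\<^sub>R 2 + u *\<^sub>R x"
      by (auto simp: closed_segment_def)
    have "Re y - 1 = (1 - u) + u * (Re x - 1)" unfolding u(3) by (simp add: algebra_simps)
    moreover have "(1 - u) + u * (Re x - 1) > 0" if "Re x > 1"
      using that u by (cases "u = 1") (auto intro!: add_pos_nonneg)
    moreover have "Im y = u * Im x" using u(3) by simp
    ultimately show "y \<in> legendre_domain" using x u by (cases "u = 0") (auto simp: legendre_domain_iff)
  qed (simp add: legendre_domain_iff)
qed

lemma legendre_domain_slits: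
  assumes "z \<in> legendre_domain"
  shows "z \<notin> \<real>\<^sub>\<le>\<^sub>0" "z - 1 \<notin> \<real>\<^sub>\<le>\<^sub>0" "z + 1 \<notin> \<real>\<^sub>\<le>\<^sub>0" "z \<noteq> 0" "1 / z\<^sup>2 \<in> cut_plane"
proof -
  show 1: "z \<notin> \<real>\<^sub>\<le>\<^sub>0" "z - 1 \<notin> \<real>\<^sub>\<le>\<^sub>0" "z + 1 \<notin> \<real>\<^sub>\<le>\<^sub>0"
    using assms by (auto simp: legendre_domain_iff complex_nonpos_Reals_iff)
  show z: "z \<noteq> 0" using 1 by auto
  show "1 / z\<^sup>2 \<in> cut_plane"
  proof (rule ccontr)
    assume "1 / z\<^sup>2 \<notin> cut_plane"
    then obtain r where r: "1 / z\<^sup>2 = of_real r" "r \<ge> 1" by (auto simp: cut_plane_def)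
    then have "z\<^sup>2 = of_real (1 / r)" using z by (simp add: field_simps)
    also have "\<dots> = (of_real (sqrt (1 / r)))\<^sup>2" using r by (metis of_real_power real_sqrt_pow2 zero_le_divide_1_iff order_trans zero_le_one)
    finally have *: "z = of_real (sqrt (1 / r)) \<or> z = - of_real (sqrt (1 / r))" by (simp only: power2_eq_iff)
    define q where "q = sqrt (1 / r)"
    have "0 \<le> q" "q \<le> 1" using r by (auto simp: q_def)
    moreover have "z = of_real q \<or> z = - of_real q" using * unfolding q_def .
    ultimately show False using assms by (auto simp: legendre_domain_iff)
  qed
qed

lemma zero_notin_legendre_domain [simp]: "0 \<notin> legendre_domain"
  by (simp add: legendre_domain_iff)

text \<open>The defining formula for |z| > 1 is already holomorphic on the whole domain, since 1 /
  z^2 avoids the cut there; it is therefore the continuation that was chosen.\<close>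

lemma legendreQ_eq:
  assumes z: "z \<in> legendre_domain"
  shows "legendreQ \<nu> \<mu> z = of_real (sqrt pi) * exp (\<i> * of_real pi * \<mu>) * Gamma (\<nu> + \<mu> + 1) *
            ((z - 1) powr (\<mu> / 2) * (z + 1) powr (\<mu> / 2)) /
            (2 powr (\<nu> + 1) * z powr (\<nu> + \<mu> + 1)) *
            hyp2F1_reg ((\<nu> + \<mu> + 1) / 2) ((\<nu> + \<mu> + 2) / 2) (\<nu> + 3 / 2) (1 / z\<^sup>2)"
proof -
  define q where "q z = of_real (sqrt pi) * exp (\<i> * of_real pi * \<mu>) * Gamma (\<nu> + \<mu> + 1) *
            ((z - 1) powr (\<mu> / 2) * (z + 1) powr (\<mu> / 2)) /
            (2 powr (\<nu> + 1) * z powr (\<nu> + \<mu> + 1)) *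
            hyp2F1_reg ((\<nu> + \<mu> + 1) / 2) ((\<nu> + \<mu> + 2) / 2) (\<nu> + 3 / 2) (1 / z\<^sup>2)" for z
  have F: "(\<lambda>z. hyp2F1_reg a b c (1 / z\<^sup>2)) holomorphic_on legendre_domain" for a b c
    by (rule holomorphic_on_compose_gen[OF _ hyp2F1_reg_holomorphic, unfolded o_def, where f = "\<lambda>z. 1 / z\<^sup>2"])
       (auto intro!: holomorphic_intros legendre_domain_slits)
  have hq: "q holomorphic_on legendre_domain"
    unfolding q_def by (intro holomorphic_intros F) (auto dest: legendre_domain_slits)
  let ?A = "{z. norm z > 1 \<and> z \<notin> \<real>\<^sub>\<le>\<^sub>0}"
  let ?P = "\<lambda>g. g holomorphic_on legendre_domain \<and> (\<forall>z\<in>?A. g z = q z)"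
  have "legendreQ \<nu> \<mu> = (SOME g. ?P g)"
    unfolding legendreQ_def analytic_continuation_def legendre_domain_def q_def ..
  moreover have "?P (SOME g. ?P g)" by (rule someI[of ?P q]) (use hq in auto)
  ultimately have P: "?P (legendreQ \<nu> \<mu>)" by simp
  have "legendreQ \<nu> \<mu> z = q z"
  proof (rule holomorphic_eq_if_eq_on_real_interval[OF _ hq open_legendre_domain connected_legendre_domain _ _ _ z])
    show "legendreQ \<nu> \<mu> holomorphic_on legendre_domain" using P by blast
    show "(1::real) < 2" by simp
    show "complex_of_real ` {1<..<2} \<subseteq> legendre_domain" by (auto simp: legendre_domain_iff)
    show "legendreQ \<nu> \<mu> (of_real t) = q (of_real t)" if "1 < t" "t < 2" for t :: real using P that by auto
  qed
  then show ?thesis by (simp add: q_def)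
qed

lemma legendreQ_holomorphic: "legendreQ \<nu> \<mu> holomorphic_on legendre_domain"
proof -
  have F: "(\<lambda>z. hyp2F1_reg a b c (1 / z\<^sup>2)) holomorphic_on legendre_domain" for a b c
    by (rule holomorphic_on_compose_gen[OF _ hyp2F1_reg_holomorphic, unfolded o_def, where f = "\<lambda>z. 1 / z\<^sup>2"])
       (auto intro!: holomorphic_intros legendre_domain_slits)
  have "(\<lambda>z. of_real (sqrt pi) * exp (\<i> * of_real pi * \<mu>) * Gamma (\<nu> + \<mu> + 1) *
            ((z - 1) powr (\<mu> / 2) * (z + 1) powr (\<mu> / 2)) /
            (2 powr (\<nu> + 1) * z powr (\<nu> + \<mu> + 1)) *
            hyp2F1_reg ((\<nu> + \<mu> + 1) / 2) ((\<nu> + \<mu> + 2) / 2) (\<nu> + 3 / 2) (1 / z\<^sup>2)) holomorphic_on legendre_domain"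
    by (intro holomorphic_intros F) (auto dest: legendre_domain_slits)
  then show ?thesis by (rule holomorphic_transform) (simp add: legendreQ_eq)
qed

lemma powr_of_real_eq_exp: "x > 0 \<Longrightarrow> complex_of_real x powr a = exp (a * of_real (ln x))"
  by (simp add: powr_def Ln_of_real)

text \<open>Euler's transformation contributes (1 - 1/z^2)^\<mu>, which reverses the sign of \<mu>
  in the powers of z - 1 and z + 1. The new parameters lam/2 and (lam + 1)/2 are those of the
  quadratic transformation.\<close>

lemma legendreQ_eq_whipple:
  assumes z: "z \<in> legendre_domain" and c: "\<nu> + 3 / 2 \<notin> \<int>\<^sub>\<le>\<^sub>0"
  shows "legendreQ \<nu> (- \<mu>) z = of_real (sqrt pi) * exp (- \<i> * of_real pi * \<mu>) * Gamma (\<nu> - \<mu> + 1) / 2 powr (\<nu> + 1) *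
            ((z - 1) powr (\<mu> / 2) * (z + 1) powr (\<mu> / 2)) * z powr (- (\<nu> + \<mu> + 1)) *
            hyp2F1_reg ((\<nu> + \<mu> + 1) / 2) ((\<nu> + \<mu> + 1 + 1) / 2) (\<nu> + 3 / 2) (1 / z\<^sup>2)"
proof -
  let ?F = "hyp2F1_reg ((\<nu> + \<mu> + 1) / 2) ((\<nu> + \<mu> + 1 + 1) / 2) (\<nu> + 3 / 2)"
  note sl = legendre_domain_slits
  \<comment> \<open>On (1, 2) all bases are positive and the identity follows from ln (1 - 1/t^2) =
    ln (t - 1) + ln (t + 1) - 2 ln t.\<close>
  have p: "((z - 1) powr (- \<mu> / 2) * (z + 1) powr (- \<mu> / 2)) / z powr (\<nu> - \<mu> + 1) * (1 - 1 / z\<^sup>2) powr \<mu> =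
      ((z - 1) powr (\<mu> / 2) * (z + 1) powr (\<mu> / 2)) * z powr (- (\<nu> + \<mu> + 1))"
  proof (rule holomorphic_eq_if_eq_on_real_interval[OF _ _ open_legendre_domain connected_legendre_domain _ _ _ z])
    show "(1::real) < 2" by simp
    show "complex_of_real ` {1<..<2} \<subseteq> legendre_domain" by (auto simp: legendre_domain_iff)
    show "(\<lambda>z. ((z - 1) powr (- \<mu> / 2) * (z + 1) powr (- \<mu> / 2)) / z powr (\<nu> - \<mu> + 1) * (1 - 1 / z\<^sup>2) powr \<mu>) holomorphic_on legendre_domain"
      using one_minus_notin_nonpos[OF sl(5)] by (intro holomorphic_intros) (auto dest: sl)
    show "(\<lambda>z. ((z - 1) powr (\<mu> / 2) * (z + 1) powr (\<mu> / 2)) * z powr (- (\<nu> + \<mu> + 1))) holomorphic_on legendre_domain"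
      by (intro holomorphic_intros) (auto dest: sl)
  next
    fix t :: real assume t: "1 < t" "t < 2"
    have e: "complex_of_real t - 1 = of_real (t - 1)" "complex_of_real t + 1 = of_real (t + 1)" "1 - 1 / (complex_of_real t)\<^sup>2 = of_real (1 - 1 / t\<^sup>2)"
      by simp_all
    have pos: "1 - 1 / t\<^sup>2 > 0" using t by (simp add: field_simps power2_eq_square) (metis mult_strict_mono' zero_le_one mult_1 less_eq_real_def)
    have "1 - 1 / t\<^sup>2 = (t - 1) * (t + 1) / t ^ 2" using t by (simp add: field_simps power2_eq_square)
    then have ln: "ln (1 - 1 / t\<^sup>2) = ln (t - 1) + ln (t + 1) - 2 * ln t"
      using t by (simp add: ln_mult ln_div ln_realpow)
    show "((complex_of_real t - 1) powr (- \<mu> / 2) * (of_real t + 1) powr (- \<mu> / 2)) / of_real t powr (\<nu> - \<mu> + 1) * (1 - 1 / (of_real t)\<^sup>2) powr \<mu> =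
      ((of_real t - 1) powr (\<mu> / 2) * (of_real t + 1) powr (\<mu> / 2)) * of_real t powr (- (\<nu> + \<mu> + 1))"
      unfolding e using t pos
      by (simp add: powr_of_real_eq_exp ln exp_add[symmetric] exp_diff[symmetric] del: of_real_diff of_real_add) (simp add: algebra_simps)
  qed
  have par: "\<nu> + 3 / 2 - (\<nu> - \<mu> + 1) / 2 = (\<nu> + \<mu> + 1 + 1) / 2" "\<nu> + 3 / 2 - (\<nu> - \<mu> + 2) / 2 = (\<nu> + \<mu> + 1) / 2"
    "(\<nu> + \<mu> + 1 + 1) / 2 - (\<nu> - \<mu> + 2) / 2 = \<mu>"
    by (simp_all add: field_simps)
  have "hyp2F1_reg ((\<nu> - \<mu> + 1) / 2) ((\<nu> - \<mu> + 2) / 2) (\<nu> + 3 / 2) (1 / z\<^sup>2) = (1 - 1 / z\<^sup>2) powr \<mu> * ?F (1 / z\<^sup>2)"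
    using euler_transformation[OF c sl(5)[OF z], of "(\<nu> - \<mu> + 1) / 2" "(\<nu> - \<mu> + 2) / 2", unfolded par]
      hyp2F1_reg_commute[OF sl(5)[OF z], of "(\<nu> + \<mu> + 1) / 2" "(\<nu> + \<mu> + 1 + 1) / 2"] by simp
  then have "legendreQ \<nu> (- \<mu>) z = of_real (sqrt pi) * exp (- \<i> * of_real pi * \<mu>) * Gamma (\<nu> - \<mu> + 1) / 2 powr (\<nu> + 1) *
     (((z - 1) powr (- \<mu> / 2) * (z + 1) powr (- \<mu> / 2)) / z powr (\<nu> - \<mu> + 1) * (1 - 1 / z\<^sup>2) powr \<mu>) * ?F (1 / z\<^sup>2)"
    unfolding legendreQ_eq[OF z] by simp
  then show ?thesis unfolding p by (simp add: mult.assoc)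
qed

section \<open>The Ferrers domain and the arc cosine\<close>

lemma ferrers_domain_iff: "x \<in> ferrers_domain \<longleftrightarrow> Im x \<noteq> 0 \<or> \<bar>Re x\<bar> < 1"
  by (auto simp: ferrers_domain_def image_iff complex_eq_iff)

lemma open_ferrers_domain: "open ferrers_domain"
proof -
  have eq: "ferrers_domain = {z. Im z < 0} \<union> {z. Im z > 0} \<union> ({z. Re z < 1} \<inter> {z. Re z > -1})"
    by (auto simp: ferrers_domain_iff)
  show ?thesis unfolding eq
    by (intro open_Un open_Int open_halfspace_Im_lt open_halfspace_Im_gt open_halfspace_Re_gt open_halfspace_Re_lt)
qed

lemma connected_ferrers_domain: "connected ferrers_domain"
proof (rule starlike_imp_connected)
  show "starlike ferrers_domain"
    unfolding starlike_def
  proof (intro bexI[of _ 0] ballI subsetI)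
    fix x y assume x: "x \<in> ferrers_domain" and "y \<in> closed_segment 0 x"
    then obtain u where u: "0 \<le> u" "u \<le> 1" "y = of_real u * x"
      by (auto simp: closed_segment_def scaleR_conv_of_real)
    have "\<bar>u * Re x\<bar> < 1" if "\<bar>Re x\<bar> < 1"
      using that u by (auto simp: abs_mult intro: le_less_trans[OF mult_left_le_one_le])
    then show "y \<in> ferrers_domain" using x u by (cases "u = 0") (auto simp: ferrers_domain_iff)
  qed (simp add: ferrers_domain_iff)
qed

lemma ferrers_domain_slits:
  assumes "x \<in> ferrers_domain"
  shows "1 - x \<notin> \<real>\<^sub>\<le>\<^sub>0" "1 + x \<notin> \<real>\<^sub>\<le>\<^sub>0" "(1 - x) / 2 \<in> cut_plane" "1 - x \<noteq> 0" "1 + x \<noteq> 0" "1 - x\<^sup>2 \<notin> \<real>\<^sub>\<le>\<^sub>0"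
proof -
  show 1: "1 - x \<notin> \<real>\<^sub>\<le>\<^sub>0" "1 + x \<notin> \<real>\<^sub>\<le>\<^sub>0" "(1 - x) / 2 \<in> cut_plane"
    using assms by (auto simp: ferrers_domain_iff complex_nonpos_Reals_iff cut_plane_iff)
  show "1 - x \<noteq> 0" "1 + x \<noteq> 0" using 1 by auto
  show "1 - x\<^sup>2 \<notin> \<real>\<^sub>\<le>\<^sub>0"
  proof
    assume "1 - x\<^sup>2 \<in> \<real>\<^sub>\<le>\<^sub>0"
    then have *: "Re x * Im x = 0" "1 - (Re x)\<^sup>2 + (Im x)\<^sup>2 \<le> 0" by (auto simp: complex_nonpos_Reals_iff Re_power2 Im_power2)
    then have "Im x = 0" by (auto simp: power2_eq_square) (smt (verit) not_sum_power2_lt_zero zero_le_square)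
    moreover from this * have "\<bar>Re x\<bar> \<ge> 1" by (simp add: abs_le_square_iff[of 1, simplified])
    ultimately show False using assms by (auto simp: ferrers_domain_iff)
  qed
qed

lemma one_minus_square_powr:
  assumes "x \<in> ferrers_domain"
  shows "(1 - x\<^sup>2) powr a = (1 - x) powr a * (1 + x) powr a"
proof (rule holomorphic_eq_if_eq_on_real_interval[OF _ _ open_ferrers_domain connected_ferrers_domain _ _ _ assms])
  show "(0::real) < 1" by simp
  show "complex_of_real ` {0<..<1} \<subseteq> ferrers_domain" by (auto simp: ferrers_domain_iff)
  show "(\<lambda>x. (1 - x\<^sup>2) powr a) holomorphic_on ferrers_domain" "(\<lambda>x. (1 - x) powr a * (1 + x) powr a) holomorphic_on ferrers_domain"
    by (intro holomorphic_intros; auto dest: ferrers_domain_slits)+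
  fix t :: real assume t: "0 < t" "t < 1"
  have e: "1 - (complex_of_real t)\<^sup>2 = of_real ((1 - t) * (1 + t))" "1 - complex_of_real t = of_real (1 - t)" "1 + complex_of_real t = of_real (1 + t)"
    by (simp_all add: power2_eq_square algebra_simps)
  have pos: "1 - t > 0" "1 + t > 0" "(1 - t) * (1 + t) > 0" using t by auto
  have ln: "ln ((1 - t) * (1 + t)) = ln (1 - t) + ln (1 + t)" using pos by (subst ln_mult) auto
  show "(1 - (complex_of_real t)\<^sup>2) powr a = (1 - of_real t) powr a * (1 + of_real t) powr a"
    unfolding e powr_of_real_eq_exp[OF pos(1)] powr_of_real_eq_exp[OF pos(2)] powr_of_real_eq_exp[OF pos(3)] ln
    by (simp add: exp_add[symmetric] distrib_left)
qed

lemma Arccos_holomorphic: "Arccos holomorphic_on ferrers_domain"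
  by (rule holomorphic_on_Arccos) (auto simp: ferrers_domain_iff)

text \<open>sin (Re (Arccos y)) does not vanish on the connected domain and Re (Arccos 0) = \<pi>/2,
  so the real part cannot leave (0, \<pi>).\<close>

lemma Re_Arccos_ferrers:
  assumes x: "x \<in> ferrers_domain"
  shows "0 < Re (Arccos x)" "Re (Arccos x) < pi"
proof -
  have nz: "Im (exp (\<i> * Arccos y)) \<noteq> 0" if "y \<in> ferrers_domain" for y
  proof -
    have "exp (\<i> * Arccos y) = y + \<i> * csqrt (1 - y\<^sup>2)"
      unfolding Arccos_def using Arccos_body_lemma[of y] by simp
    then show ?thesis using isCont_Arccos_lemma[of y] that by (auto simp: ferrers_domain_iff)
  qed
  then have s: "sin (Re (Arccos y)) \<noteq> 0" if "y \<in> ferrers_domain" for y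
    using nz[OF that] by (simp add: Im_exp)
  have n0: "Re (Arccos y) \<noteq> 0" "Re (Arccos y) \<noteq> pi" if "y \<in> ferrers_domain" for y using s[OF that] by auto
  have "connected ((\<lambda>y. Re (Arccos y)) ` ferrers_domain)"
    by (intro connected_continuous_image continuous_intros holomorphic_on_imp_continuous_on Arccos_holomorphic connected_ferrers_domain)
  moreover have "pi / 2 \<in> (\<lambda>y. Re (Arccos y)) ` ferrers_domain"
    by (rule image_eqI[of _ _ 0]) (auto simp: ferrers_domain_iff)
  ultimately have "0 \<in> (\<lambda>y. Re (Arccos y)) ` ferrers_domain" if "Re (Arccos x) \<le> 0"
    using connectedD_interval[OF _ imageI[OF x, of "\<lambda>y. Re (Arccos y)"] _ that, of "pi / 2"] by simp
  then show "0 < Re (Arccos x)" using n0(1) by force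
  show "Re (Arccos x) < pi" using n0(2)[OF x] Re_Arccos_bounds[of x] by auto
qed

text \<open>Im (cos (p + i q)) = - sin p sinh q with sin p > 0. The sign decides which of e^(-2 i
  \<theta>) and e^(2 i \<theta>) lies in the unit disc, that is, which branch belongs to which half
  plane.\<close>

lemma Im_Arccos_sign:
  assumes "Im x \<noteq> 0"
  shows "Im x * Im (Arccos x) < 0"
proof -
  have x: "x \<in> ferrers_domain" using assms by (simp add: ferrers_domain_iff)
  define p q where "p = Re (Arccos x)" "q = Im (Arccos x)"
  have Im: "Im x = sin p * (exp (- q) - exp q) / 2"
    using Im_cos[of "Arccos x"] by (simp add: p_q_def)
  have "sin p > 0" using Re_Arccos_ferrers[OF x] unfolding p_q_def by (intro sin_gt_zero) auto
  moreover have "q \<noteq> 0" using assms Im by auto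
  then have "(exp (- q) - exp q) * q < 0" by (cases "q > 0") (auto simp: mult_less_0_iff)
  ultimately have "sin p * ((exp (- q) - exp q) * q) < 0" by (rule mult_pos_neg)
  then show ?thesis unfolding Im p_q_def(2)[symmetric] by (simp add: mult.assoc)
qed

text \<open>The value is real only if cos (Re (Arccos x)) = 0, and then it is negative.\<close>

lemma exp_Arccos_in_cut_plane:
  assumes x: "x \<in> ferrers_domain" and s: "s = 1 \<or> s = -1"
  shows "exp (- (2 * of_real s * \<i> * Arccos x)) \<in> cut_plane"
proof -
  let ?p = "Re (Arccos x)"
  let ?r = "exp (2 * s * Im (Arccos x))"
  have "sin ?p > 0" using Re_Arccos_ferrers[OF x] by (intro sin_gt_zero) auto
  moreover have "Im (exp (- (2 * of_real s * \<i> * Arccos x))) = - (s * ?r * (2 * sin ?p * cos ?p))"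
    using s by (auto simp: Im_exp sin_double[symmetric])
  moreover have "Re (exp (- (2 * of_real s * \<i> * Arccos x))) = ?r * (2 * (cos ?p)\<^sup>2 - 1)"
    using s by (auto simp: Re_exp cos_double_cos[symmetric])
  moreover have "-1 < exp y" for y :: real using exp_gt_zero[of y] by linarith
  ultimately show ?thesis using s by (auto simp: cut_plane_iff)
qed

text \<open>With \<open>x = cos \<theta>\<close>, \<open>0 < Re \<theta> < \<pi>\<close>, the two functions \<open>ferrers_branch (\<plusminus>1) lam m\<close> are
  \<open>e\<^bsup>\<mp>i lam \<theta>\<^esup> F(lam, m; lam - m + 1; e\<^bsup>\<mp>2 i \<theta>\<^esup>)\<close>; up to elementary factors they are the boundary values
  of \<open>Q\<close> on the two sides of the cut.\<close>

definition ferrers_branch :: "real \<Rightarrow> complex \<Rightarrow> complex \<Rightarrow> complex \<Rightarrow> complex" where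
  "ferrers_branch s lam m x = exp (- (of_real s * \<i> * lam * Arccos x)) *
     hyp2F1_reg lam m (lam - m + 1) (exp (- (2 * of_real s * \<i> * Arccos x)))"

lemma ferrers_branch_holomorphic:
  assumes "s = 1 \<or> s = -1"
  shows "ferrers_branch s lam m holomorphic_on ferrers_domain"
  unfolding ferrers_branch_def
proof (intro holomorphic_on_mult holomorphic_intros Arccos_holomorphic)
  show "(\<lambda>x. hyp2F1_reg lam m (lam - m + 1) (exp (- (2 * of_real s * \<i> * Arccos x)))) holomorphic_on ferrers_domain"
    by (rule holomorphic_on_compose_gen[OF _ hyp2F1_reg_holomorphic, unfolded o_def, where f = "\<lambda>x. exp (- (2 * of_real s * \<i> * Arccos x))"])
       (use exp_Arccos_in_cut_plane[OF _ assms] in \<open>auto intro!: holomorphic_intros Arccos_holomorphic\<close>)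
qed

section \<open>Q and P in terms of the branches\<close>

lemma minus_one_powr:
  assumes s: "s = 1 \<or> s = -1" and z: "s * Im z > 0"
  shows "(z - 1) powr a = exp (of_real s * \<i> * of_real pi * a) * (1 - z) powr a"
proof -
  have nz: "1 - z \<noteq> 0" using z by auto
  have "Ln (z - 1) = Ln (1 - z) + of_real s * \<i> * of_real pi"
    using Ln_minus[OF nz] s z by auto
  moreover have "z - 1 \<noteq> 0" using nz by auto
  ultimately show ?thesis using nz by (simp add: powr_def exp_add[symmetric] algebra_simps)
qed

text \<open>Write z = cos \<theta> with \<theta> = s Arccos z. In the half plane s Im z > 0 the
  number X = e^(-2 i \<theta>) has modulus below 1 and 1 / z^2 = 4 X / (1 + X)^2, so
  \<open>legendreQ_eq_whipple\<close> and the quadratic transformation combine.\<close>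

lemma legendreQ_half_plane:
  assumes c: "\<nu> + 3 / 2 \<notin> \<int>\<^sub>\<le>\<^sub>0" and s: "s = 1 \<or> s = -1" and z: "s * Im z > 0"
  shows "legendreQ \<nu> (- \<mu>) z = of_real (sqrt pi) * exp (- \<i> * of_real pi * \<mu>) * Gamma (\<nu> - \<mu> + 1) * 2 powr \<mu> *
     exp (of_real s * \<i> * of_real pi * \<mu> / 2) * ((1 - z) powr (\<mu> / 2) * (1 + z) powr (\<mu> / 2)) *
     ferrers_branch s (\<nu> + \<mu> + 1) (\<mu> + 1 / 2) z"
proof -
  define lam m where "lam = \<nu> + \<mu> + 1" "m = \<mu> + 1 / 2"
  have cm: "\<nu> + 3 / 2 = lam - m + 1" by (simp add: lam_m_def)
  define \<theta> where "\<theta> = of_real s * Arccos z"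
  define e where "e = exp (\<i> * \<theta>)"
  define X where "X = exp (- (2 * \<i> * \<theta>))"
  have Im0: "Im z \<noteq> 0" using z by auto
  have zf: "z \<in> ferrers_domain" and zl: "z \<in> legendre_domain" using Im0 by (auto simp: ferrers_domain_iff legendre_domain_iff)
  have "s * Im (Arccos z) < 0" using Im_Arccos_sign[OF Im0] s z by (auto simp: mult_less_0_iff)
  then have X1: "norm X < 1" by (simp add: X_def \<theta>_def)
  have "cos \<theta> = z" using s by (auto simp: \<theta>_def)
  have Xe: "X * e\<^sup>2 = 1" by (simp add: X_def e_def exp_minus exp_double[symmetric] mult.assoc)
  have e0: "e \<noteq> 0" by (simp add: e_def)
  have "exp (- (\<i> * \<theta>)) = X * e" using Xe e0 by (simp add: e_def exp_minus divide_simps power2_eq_square mult.assoc)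
  then have ze: "z = e * (1 + X) / 2" using \<open>cos \<theta> = z\<close>
    by (simp add: cos_exp_eq e_def algebra_simps)
  note k = koebe_map_in_cut_plane[OF X1]
  have X0: "1 + X \<noteq> 0" using k(1) by auto
  have z0: "z \<noteq> 0" unfolding ze using e0 X0 by simp
  have zz: "1 / z\<^sup>2 = 4 * X / (1 + X)\<^sup>2"
    using Xe e0 X0 unfolding ze by (simp add: power_mult_distrib power_divide divide_simps)
  have QT: "hyp2F1_reg (lam / 2) ((lam + 1) / 2) (lam - m + 1) (1 / z\<^sup>2) = (1 + X) powr lam * hyp2F1_reg lam m (lam - m + 1) X"
    unfolding zz by (rule quadratic_transformation) (use c X1 in \<open>simp_all add: cm\<close>)
  \<comment> \<open>z = e^(i \<theta>) (1 + X) / 2 fixes the logarithm up to a multiple of 2 \<pi>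
    i, and the bounds on the imaginary parts leave only the multiple 0.\<close>
  have "Ln z = Ln (1 + X) + \<i> * \<theta> - of_real (ln 2)"
  proof (rule exp_complex_eqI)
    have "Re (1 + X) > 0" using X1 abs_Re_le_cmod[of X] by simp
    then have a: "\<bar>Im (Ln (1 + X))\<bar> < pi / 2" using Re_Ln_pos_lt_imp[of "1 + X"] by simp
    have b: "0 < Re (Arccos z)" "Re (Arccos z) < pi" using Re_Arccos_ferrers[OF zf] by auto
    show "\<bar>Im (Ln z) - Im (Ln (1 + X) + \<i> * \<theta> - of_real (ln 2))\<bar> < 2 * pi"
    proof (cases "s = 1")
      case True
      then have "0 < Im (Ln z) \<and> Im (Ln z) < pi" using z by (intro Im_Ln_pos_lt_imp) simp
      then show ?thesis using a b True by (simp add: \<theta>_def abs_if split: if_splits)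
    next
      case False
      then have "s = -1" "Im z < 0" using s z by auto
      then have "Im (Ln z) < 0" "- pi < Im (Ln z)" using Im_Ln_pos_le[OF z0] mpi_less_Im_Ln[OF z0] Im_Ln_le_pi[OF z0] by auto
      then show ?thesis using a b \<open>s = -1\<close> by (simp add: \<theta>_def abs_if split: if_splits)
    qed
    show "exp (Ln z) = exp (Ln (1 + X) + \<i> * \<theta> - of_real (ln 2))"
      using z0 X0 by (simp add: exp_add exp_diff exp_of_real ze e_def)
  qed
  then have "z powr (- lam) * (1 + X) powr lam = exp (- lam * (Ln (1 + X) + \<i> * \<theta> - of_real (ln 2))) * exp (lam * Ln (1 + X))"
    using z0 X0 by (simp add: powr_def)
  also have "\<dots> = 2 powr lam * exp (- (\<i> * lam * \<theta>))"
    by (simp add: powr_def Ln_of_real[of 2, simplified] exp_add[symmetric] algebra_simps)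
  finally have zp: "z powr (- lam) * (1 + X) powr lam = 2 powr lam * exp (- (\<i> * lam * \<theta>))" .
  have "legendreQ \<nu> (- \<mu>) z = of_real (sqrt pi) * exp (- \<i> * of_real pi * \<mu>) * Gamma (\<nu> - \<mu> + 1) / 2 powr (\<nu> + 1) *
            ((z - 1) powr (\<mu> / 2) * (z + 1) powr (\<mu> / 2)) * (z powr (- lam) * (1 + X) powr lam) * hyp2F1_reg lam m (lam - m + 1) X"
    using legendreQ_eq_whipple[OF zl c, of \<mu>] QT by (simp add: lam_m_def[symmetric] cm mult.assoc)
  also have "\<dots> = of_real (sqrt pi) * exp (- \<i> * of_real pi * \<mu>) * Gamma (\<nu> - \<mu> + 1) * (2 powr lam / 2 powr (\<nu> + 1)) *
      exp (of_real s * \<i> * of_real pi * (\<mu> / 2)) * ((1 - z) powr (\<mu> / 2) * (1 + z) powr (\<mu> / 2)) *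
      (exp (- (\<i> * lam * \<theta>)) * hyp2F1_reg lam m (lam - m + 1) X)"
    unfolding zp minus_one_powr[OF s z] by (simp add: add.commute)
  also have "(2::complex) powr lam / 2 powr (\<nu> + 1) = 2 powr \<mu>"
    by (subst powr_diff[symmetric]) (simp add: lam_m_def)
  also have "exp (- (\<i> * lam * \<theta>)) * hyp2F1_reg lam m (lam - m + 1) X = ferrers_branch s lam m z"
    by (simp add: ferrers_branch_def X_def \<theta>_def mult_ac)
  finally show ?thesis by (simp add: lam_m_def)
qed

text \<open>The formula of \<open>legendreQ_half_plane\<close> is continuous across (-1, 1), so the
  one-sided limits are its values there. The resulting combination is holomorphic on the Ferrers
  domain and hence is the chosen continuation.\<close>

lemma ferrersQ_eq:
  assumes c: "\<nu> + 3 / 2 \<notin> \<int>\<^sub>\<le>\<^sub>0" and x: "x \<in> ferrers_domain"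
  shows "ferrersQ \<nu> (- \<mu>) x = of_real (sqrt pi) * Gamma (\<nu> - \<mu> + 1) * 2 powr \<mu> / 2 * ((1 - x) powr (\<mu> / 2) * (1 + x) powr (\<mu> / 2)) *
     (exp (\<i> * of_real pi * \<mu>) * ferrers_branch 1 (\<nu> + \<mu> + 1) (\<mu> + 1 / 2) x +
      exp (- \<i> * of_real pi * \<mu>) * ferrers_branch (-1) (\<nu> + \<mu> + 1) (\<mu> + 1 / 2) x)"
proof -
  define B where "B s = ferrers_branch s (\<nu> + \<mu> + 1) (\<mu> + 1 / 2)" for s
  define W where "W x = (1 - x) powr (\<mu> / 2) * (1 + x) powr (\<mu> / 2)" for x :: complex
  define A where "A = of_real (sqrt pi) * exp (- \<i> * of_real pi * \<mu>) * Gamma (\<nu> - \<mu> + 1) * 2 powr \<mu>"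
  define G where "G x = of_real (sqrt pi) * Gamma (\<nu> - \<mu> + 1) * 2 powr \<mu> / 2 * W x *
     (exp (\<i> * of_real pi * \<mu>) * B 1 x + exp (- \<i> * of_real pi * \<mu>) * B (-1) x)" for x
  have hB: "B 1 holomorphic_on ferrers_domain" "B (-1) holomorphic_on ferrers_domain"
    unfolding B_def by (rule ferrers_branch_holomorphic; simp)+
  have hW: "W holomorphic_on ferrers_domain"
    unfolding W_def by (intro holomorphic_intros) (auto dest: ferrers_domain_slits)
  have hG: "G holomorphic_on ferrers_domain"
    unfolding G_def by (intro holomorphic_intros hB hW) auto
  have L: "Lim (at_right 0) (\<lambda>\<epsilon>. legendreQ \<nu> (- \<mu>) (x + of_real s * (\<i> * of_real \<epsilon>))) = A * exp (of_real s * \<i> * of_real pi * \<mu> / 2) * W x * B s x"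
    if x: "x \<in> complex_of_real ` {-1<..<1}" and s: "s = 1 \<or> s = -1" for x and s :: real
  proof (rule tendsto_Lim)
    have xf: "x \<in> ferrers_domain" using x by (auto simp: ferrers_domain_iff)
    have "isCont (\<lambda>z. A * exp (of_real s * \<i> * of_real pi * \<mu> / 2) * W z * B s z) x"
    proof (rule continuous_on_interior)
      show "continuous_on ferrers_domain (\<lambda>z. A * exp (of_real s * \<i> * of_real pi * \<mu> / 2) * W z * B s z)"
        using hB hW s by (intro holomorphic_on_imp_continuous_on holomorphic_intros) auto
      show "x \<in> interior ferrers_domain" using xf by (simp add: interior_open open_ferrers_domain)
    qed
    moreover have "((\<lambda>\<epsilon>. x + of_real s * (\<i> * of_real \<epsilon>)) \<longlongrightarrow> x + of_real s * (\<i> * of_real 0)) (at_right 0)"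
      by (intro tendsto_intros)
    ultimately have "((\<lambda>\<epsilon>. A * exp (of_real s * \<i> * of_real pi * \<mu> / 2) * W (x + of_real s * (\<i> * of_real \<epsilon>)) * B s (x + of_real s * (\<i> * of_real \<epsilon>))) \<longlongrightarrow>
        A * exp (of_real s * \<i> * of_real pi * \<mu> / 2) * W x * B s x) (at_right 0)"
      by (intro isCont_tendsto_compose[where g = "\<lambda>z. A * exp (of_real s * \<i> * of_real pi * \<mu> / 2) * W z * B s z"]) simp_all
    moreover have "eventually (\<lambda>\<epsilon>. A * exp (of_real s * \<i> * of_real pi * \<mu> / 2) * W (x + of_real s * (\<i> * of_real \<epsilon>)) * B s (x + of_real s * (\<i> * of_real \<epsilon>))
        = legendreQ \<nu> (- \<mu>) (x + of_real s * (\<i> * of_real \<epsilon>))) (at_right (0::real))"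
    proof (rule eventually_at_rightI[of 0 1])
      fix \<epsilon> :: real assume "\<epsilon> \<in> {0<..<1}"
      moreover have "Im x = 0" using x by auto
      ultimately have "s * Im (x + of_real s * (\<i> * of_real \<epsilon>)) > 0" using s by auto
      from legendreQ_half_plane[OF c s this, of \<mu>]
      show "A * exp (of_real s * \<i> * of_real pi * \<mu> / 2) * W (x + of_real s * (\<i> * of_real \<epsilon>)) * B s (x + of_real s * (\<i> * of_real \<epsilon>))
        = legendreQ \<nu> (- \<mu>) (x + of_real s * (\<i> * of_real \<epsilon>))"
        by (simp add: A_def W_def B_def mult.assoc)
    qed simp
    ultimately show "((\<lambda>\<epsilon>. legendreQ \<nu> (- \<mu>) (x + of_real s * (\<i> * of_real \<epsilon>))) \<longlongrightarrow> A * exp (of_real s * \<i> * of_real pi * \<mu> / 2) * W x * B s x) (at_right 0)"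
      by (rule Lim_transform_eventually)
  qed simp
  let ?q = "\<lambda>x. 1 / 2 * exp (- \<i> * of_real pi * (- \<mu>)) *
            (exp (- \<i> * of_real pi * (- \<mu>) / 2) *
               Lim (at_right (0::real)) (\<lambda>\<epsilon>. legendreQ \<nu> (- \<mu>) (x + \<i> * of_real \<epsilon>)) +
             exp (\<i> * of_real pi * (- \<mu>) / 2) *
               Lim (at_right (0::real)) (\<lambda>\<epsilon>. legendreQ \<nu> (- \<mu>) (x - \<i> * of_real \<epsilon>)))"
  let ?P = "\<lambda>g. g holomorphic_on ferrers_domain \<and> (\<forall>z\<in>complex_of_real ` {-1<..<1}. g z = ?q z)"
  have q: "?q x = G x" if x: "x \<in> complex_of_real ` {-1<..<1}" for x
  proof -
    \<comment> \<open>All phases are powers of \<open>E\<close>: the prefactors of the definition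
      and those of the two boundary values multiply to E^2 and E^(-2).\<close>
    define E where "E = exp (\<i> * of_real pi * \<mu> / 2)"
    have E0: "E \<noteq> 0" by (simp add: E_def)
    have E: "exp (\<i> * of_real pi * \<mu>) = E\<^sup>2" by (simp add: E_def exp_double[symmetric])
    have E': "exp (- \<i> * of_real pi * (- \<mu>)) = E\<^sup>2" "exp (- \<i> * of_real pi * (- \<mu>) / 2) = E"
      "exp (\<i> * of_real pi * (- \<mu>) / 2) = inverse E" "exp (- \<i> * of_real pi * \<mu>) = inverse (E\<^sup>2)"
      using E by (simp_all add: E_def exp_minus)
    have l1: "Lim (at_right (0::real)) (\<lambda>\<epsilon>. legendreQ \<nu> (- \<mu>) (x + \<i> * of_real \<epsilon>)) = A * E * W x * B 1 x"
      using L[OF x, of 1] by (simp add: E_def)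
    have l2: "Lim (at_right (0::real)) (\<lambda>\<epsilon>. legendreQ \<nu> (- \<mu>) (x - \<i> * of_real \<epsilon>)) = A * inverse E * W x * B (-1) x"
      using L[OF x, of "-1"] by (simp add: E_def exp_minus)
    show ?thesis unfolding l1 l2 G_def A_def E E' using E0 by (simp add: field_simps power2_eq_square)
  qed
  have "ferrersQ \<nu> (- \<mu>) = (SOME g. ?P g)"
    unfolding ferrersQ_def analytic_continuation_def ..
  moreover have "?P (SOME g. ?P g)" by (rule someI[of ?P G]) (use hG q in auto)
  ultimately have P: "?P (ferrersQ \<nu> (- \<mu>))" by simp
  have "ferrersQ \<nu> (- \<mu>) x = G x"
  proof (rule holomorphic_eq_if_eq_on_real_interval[OF _ hG open_ferrers_domain connected_ferrers_domain _ _ _ x])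
    show "ferrersQ \<nu> (- \<mu>) holomorphic_on ferrers_domain" using P by blast
    show "(-1::real) < 1" by simp
    show "complex_of_real ` {-1<..<1} \<subseteq> ferrers_domain" by (auto simp: ferrers_domain_iff)
    show "ferrersQ \<nu> (- \<mu>) (of_real t) = G (of_real t)" if "-1 < t" "t < 1" for t :: real
    proof -
      have m: "complex_of_real t \<in> complex_of_real ` {-1<..<1}" using that by simp
      show ?thesis using bspec[OF conjunct2[OF P] m] q[OF m] by (rule trans)
    qed
  qed
  then show ?thesis by (simp add: G_def W_def B_def)
qed

text \<open>Euler's transformation brings the parameters to \<nu> + \<mu> + 1 = lam and \<mu> -
  \<nu> = 2 m - lam with 1 + \<mu> = m + 1/2, those on the left of
  \<open>quadratic_transformation_cosh\<close>.\<close>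

lemma ferrersP_eq:
  assumes c: "1 + \<mu> \<notin> \<int>\<^sub>\<le>\<^sub>0" and x: "x \<in> ferrers_domain"
  shows "ferrersP \<nu> (- \<mu>) x = 2 powr (- \<mu>) * ((1 - x) powr (\<mu> / 2) * (1 + x) powr (\<mu> / 2)) *
     hyp2F1_reg (\<nu> + \<mu> + 1) (\<mu> - \<nu>) (1 + \<mu>) ((1 - x) / 2)"
proof -
  note sl = ferrers_domain_slits
  have par: "1 + \<mu> - - \<nu> = \<nu> + \<mu> + 1" "1 + \<mu> - (\<nu> + 1) = \<mu> - \<nu>" "\<nu> + \<mu> + 1 - (\<nu> + 1) = \<mu>" "1 - (1 - x) / 2 = (1 + x) / 2"
    by (simp_all add: field_simps)
  \<comment> \<open>A quotient r \<le> 0 would give the real number x = (r - 1) / (r + 1), whose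
    modulus is at least 1; r = -1 is impossible.\<close>
  have "(1 + x) / (1 - x) \<notin> \<real>\<^sub>\<le>\<^sub>0" if x: "x \<in> ferrers_domain" for x
  proof
    assume "(1 + x) / (1 - x) \<in> \<real>\<^sub>\<le>\<^sub>0"
    then obtain r where r: "(1 + x) / (1 - x) = of_real r" "r \<le> 0" by (auto elim: nonpos_Reals_cases)
    then have "1 + x = of_real r * (1 - x)" using sl(4)[OF x] by (simp add: field_simps)
    then have "Im x * (1 + r) = 0" "Re x * (1 + r) = r - 1" by (auto simp: complex_eq_iff algebra_simps)
    then have "Im x = 0" "Re x * (1 + r) = r - 1" using r(2) by auto
    then have "\<bar>Re x\<bar> < 1" using x by (auto simp: ferrers_domain_iff)
    then have "\<bar>Re x * (1 + r)\<bar> \<le> \<bar>1 + r\<bar>" by (simp add: abs_mult mult_left_le_one_le)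
    with \<open>Re x * (1 + r) = r - 1\<close> have "\<bar>r - 1\<bar> \<le> \<bar>1 + r\<bar>" by simp
    then have "r = 0" using r(2) by linarith
    then show False using \<open>1 + x = of_real r * (1 - x)\<close> sl(5)[OF x] by simp
  qed
  note w = this
  have p: "((1 + x) / (1 - x)) powr (- \<mu> / 2) * ((1 + x) / 2) powr \<mu> = 2 powr (- \<mu>) * ((1 - x) powr (\<mu> / 2) * (1 + x) powr (\<mu> / 2))"
  proof (rule holomorphic_eq_if_eq_on_real_interval[OF _ _ open_ferrers_domain connected_ferrers_domain _ _ _ x])
    show "(0::real) < 1" by simp
    show "complex_of_real ` {0<..<1} \<subseteq> ferrers_domain" by (auto simp: ferrers_domain_iff)
    have "(1 + x) / 2 \<notin> \<real>\<^sub>\<le>\<^sub>0" if "x \<in> ferrers_domain" for x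
      using sl(2)[OF that] by (auto simp: complex_nonpos_Reals_iff)
    then show "(\<lambda>x. ((1 + x) / (1 - x)) powr (- \<mu> / 2) * ((1 + x) / 2) powr \<mu>) holomorphic_on ferrers_domain"
      using w by (intro holomorphic_intros) (auto dest: sl)
    show "(\<lambda>x. 2 powr (- \<mu>) * ((1 - x) powr (\<mu> / 2) * (1 + x) powr (\<mu> / 2))) holomorphic_on ferrers_domain"
      by (intro holomorphic_intros) (auto dest: sl)
    fix t :: real assume t: "0 < t" "t < 1"
    have e: "(1 + complex_of_real t) / (1 - of_real t) = of_real ((1 + t) / (1 - t))" "(1 + complex_of_real t) / 2 = of_real ((1 + t) / 2)"
      "1 - complex_of_real t = of_real (1 - t)" "1 + complex_of_real t = of_real (1 + t)" "(2::complex) = of_real 2" by simp_all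
    have pos: "(1 + t) / (1 - t) > 0" "(1 + t) / 2 > 0" "1 - t > 0" "1 + t > 0" "(2::real) > 0" using t by auto
    show "((1 + complex_of_real t) / (1 - of_real t)) powr (- \<mu> / 2) * ((1 + of_real t) / 2) powr \<mu> =
      2 powr (- \<mu>) * ((1 - of_real t) powr (\<mu> / 2) * (1 + of_real t) powr (\<mu> / 2))"
      using t unfolding e(1)[THEN arg_cong[where f = "\<lambda>z. z powr (- \<mu> / 2)"]] powr_of_real_eq_exp[OF pos(1)]
        e(2)[THEN arg_cong[where f = "\<lambda>z. z powr \<mu>"]] powr_of_real_eq_exp[OF pos(2)]
        e(3)[THEN arg_cong[where f = "\<lambda>z. z powr (\<mu> / 2)"]] powr_of_real_eq_exp[OF pos(3)]
        e(4)[THEN arg_cong[where f = "\<lambda>z. z powr (\<mu> / 2)"]] powr_of_real_eq_exp[OF pos(4)]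
        e(5)[THEN arg_cong[where f = "\<lambda>z. z powr - \<mu>"]] powr_of_real_eq_exp[OF pos(5)]
      by (simp add: ln_div exp_add[symmetric]) (simp add: field_simps)
  qed
  have "ferrersP \<nu> (- \<mu>) x = ((1 + x) / (1 - x)) powr (- \<mu> / 2) * hyp2F1_reg (- \<nu>) (\<nu> + 1) (1 + \<mu>) ((1 - x) / 2)"
    by (simp add: ferrersP_def)
  also have "\<dots> = (((1 + x) / (1 - x)) powr (- \<mu> / 2) * ((1 + x) / 2) powr \<mu>) * hyp2F1_reg (\<nu> + \<mu> + 1) (\<mu> - \<nu>) (1 + \<mu>) ((1 - x) / 2)"
    using euler_transformation[OF c sl(3)[OF x], of "- \<nu>" "\<nu> + 1", unfolded par] by simp
  finally show ?thesis unfolding p .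
qed

section \<open>Substitutions and power weights on the line\<close>

text \<open>Used with k = 2 (1 - x^2) for real x, where it produces the kernel of the product
  formula, and with k = 2 where the substitution must not depend on x or \<theta>.\<close>

lemma moebius_substitution:
  fixes f :: "real \<Rightarrow> 'a :: euclidean_space"
  assumes k: "k > 0"
  shows "(\<lambda>t. (k / (1 - t)\<^sup>2) *\<^sub>R f (1 + k * t / (1 - t))) absolutely_integrable_on {0<..<1} \<longleftrightarrow> f absolutely_integrable_on {1<..}"
    and "f absolutely_integrable_on {1<..} \<Longrightarrow>
      integral {0<..<1} (\<lambda>t. (k / (1 - t)\<^sup>2) *\<^sub>R f (1 + k * t / (1 - t))) = integral {1<..} f"
proof -
  let ?g = "\<lambda>t. 1 + k * t / (1 - t)"
  have im: "?g ` {0<..<1} = {1<..}"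
  proof (intro equalityI subsetI)
    fix w :: real assume w: "w \<in> {1<..}"
    define D where "D = w - 1 + k"
    have D: "D > 0" "1 - (w - 1) / D = k / D" using w k by (auto simp: D_def field_simps)
    then have "?g ((w - 1) / D) = w \<and> (w - 1) / D \<in> {0<..<1}"
      using w k by (simp add: D(2)) (simp add: D_def)
    then show "w \<in> ?g ` {0<..<1}" by force
  qed (use k in auto)
  have der: "(?g has_field_derivative k / (1 - t)\<^sup>2) (at t within {0<..<1})" if "t \<in> {0<..<1}" for t
    using that by (auto intro!: derivative_eq_intros simp: field_simps power2_eq_square)
  have inj: "inj_on ?g {0<..<1}"
  proof (rule inj_onI)
    fix s t :: real assume st: "s \<in> {0<..<1}" "t \<in> {0<..<1}" "?g s = ?g t"
    then have "s * (1 - t) = t * (1 - s)" using k by (simp add: field_simps)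
    then show "s = t" by (simp add: algebra_simps)
  qed
  have ab: "\<bar>k / (1 - t)\<^sup>2\<bar> = k / (1 - t)\<^sup>2" for t using k by simp
  note cov = has_absolute_integral_change_of_variables_real[of "{0<..<1}" ?g "\<lambda>t. k / (1 - t)\<^sup>2", OF _ der inj, unfolded im ab]
  show 1: "(\<lambda>t. (k / (1 - t)\<^sup>2) *\<^sub>R f (1 + k * t / (1 - t))) absolutely_integrable_on {0<..<1} \<longleftrightarrow> f absolutely_integrable_on {1<..}"
    using cov[of f "integral {0<..<1} (\<lambda>t. (k / (1 - t)\<^sup>2) *\<^sub>R f (1 + k * t / (1 - t)))"] cov[of f "integral {1<..} f"] by auto
  show "integral {0<..<1} (\<lambda>t. (k / (1 - t)\<^sup>2) *\<^sub>R f (1 + k * t / (1 - t))) = integral {1<..} f" if "f absolutely_integrable_on {1<..}"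
    using cov[of f "integral {1<..} f"] that by auto
qed

lemma affine_substitution:
  fixes f :: "real \<Rightarrow> 'a :: euclidean_space"
  shows "(\<lambda>t. 2 *\<^sub>R f (1 - 2 * t)) absolutely_integrable_on {0<..<1} \<longleftrightarrow> f absolutely_integrable_on {-1<..<1}"
    and "f absolutely_integrable_on {-1<..<1} \<Longrightarrow> integral {0<..<1} (\<lambda>t. 2 *\<^sub>R f (1 - 2 * t)) = integral {-1<..<1} f"
proof -
  let ?g = "\<lambda>t::real. 1 - 2 * t"
  have im: "?g ` {0<..<1} = {-1<..<1}"
    by (auto simp: image_iff intro!: bexI[of _ "(1 - _) / 2"] simp: field_simps)
  have ab: "\<bar>- 2 :: real\<bar> = 2" by simp
  have der: "(?g has_field_derivative - 2) (at t within {0<..<1})" for t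
    by (auto intro!: derivative_eq_intros)
  have inj: "inj_on ?g {0<..<1}" by (auto simp: inj_on_def)
  note cov = has_absolute_integral_change_of_variables_real[of "{0<..<1}" ?g "\<lambda>t. - 2", OF _ der inj, unfolded im ab]
  show "(\<lambda>t. 2 *\<^sub>R f (1 - 2 * t)) absolutely_integrable_on {0<..<1} \<longleftrightarrow> f absolutely_integrable_on {-1<..<1}"
    using cov[of f "integral {0<..<1} (\<lambda>t. 2 *\<^sub>R f (1 - 2 * t))"] cov[of f "integral {-1<..<1} f"] by auto
  show "integral {0<..<1} (\<lambda>t. 2 *\<^sub>R f (1 - 2 * t)) = integral {-1<..<1} f" if "f absolutely_integrable_on {-1<..<1}"
    using cov[of f "integral {-1<..<1} f"] that by auto
qed

lemma reflect_substitution: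
  fixes f :: "real \<Rightarrow> 'a :: euclidean_space"
  shows "(\<lambda>t. f (- t)) absolutely_integrable_on {1<..} \<longleftrightarrow> f absolutely_integrable_on {..<-1}"
    and "f absolutely_integrable_on {..<-1} \<Longrightarrow> integral {1<..} (\<lambda>t. f (- t)) = integral {..<-1} f"
proof -
  have im: "uminus ` {1<..} = {..<-1::real}" by (auto simp: image_iff intro!: bexI[of _ "- _"])
  have ab: "\<bar>- 1 :: real\<bar> *\<^sub>R x = x" for x :: 'a by simp
  have der: "(uminus has_field_derivative - 1) (at t within {1<..})" for t :: real
    by (auto intro!: derivative_eq_intros)
  note cov = has_absolute_integral_change_of_variables_real[of "{1<..}" uminus "\<lambda>t. - 1", OF _ der, unfolded im ab]
  show "(\<lambda>t. f (- t)) absolutely_integrable_on {1<..} \<longleftrightarrow> f absolutely_integrable_on {..<-1}"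
    using cov[of f "integral {1<..} (\<lambda>t. f (- t))"] cov[of f "integral {..<-1} f"] by auto
  show "integral {1<..} (\<lambda>t. f (- t)) = integral {..<-1} f" if "f absolutely_integrable_on {..<-1}"
    using cov[of f "integral {..<-1} f"] that by auto
qed

lemma absolutely_integrable_on_line_iff:
  fixes f :: "real \<Rightarrow> 'a :: euclidean_space"
  shows "f absolutely_integrable_on UNIV \<longleftrightarrow>
     f absolutely_integrable_on {..<-1} \<and> f absolutely_integrable_on {-1<..<1} \<and> f absolutely_integrable_on {1<..}" (is "?l \<longleftrightarrow> ?r")
    and "f absolutely_integrable_on UNIV \<Longrightarrow>
     integral UNIV f = integral {..<-1} f + integral {-1<..<1} f + integral {1<..} f"
proof -
  let ?U = "{..<-1} \<union> {-1<..<1} \<union> {1<..} :: real set"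
  have U: "UNIV - ?U \<subseteq> {-1, 1}" by auto
  have neg: "negligible (UNIV - ?U)" by (rule negligible_subset[OF _ U]) simp
  have sp: "f absolutely_integrable_on UNIV \<longleftrightarrow> f absolutely_integrable_on ?U"
    by (rule absolutely_integrable_spike_set_eq; rule negligible_subset[OF neg]; auto)
  show iff: "?l \<longleftrightarrow> ?r"
    unfolding sp by (auto intro!: set_integrable_Un intro: set_integrable_subset)
  assume f: "f absolutely_integrable_on UNIV"
  then have i: "f integrable_on {..<-1}" "f integrable_on {-1<..<1}" "f integrable_on {1<..}"
    using iff by (auto simp: absolutely_integrable_on_def)
  have e: "({..<-1} \<union> {-1<..<1}) \<inter> {1<..} = ({} :: real set)" "{..<-1} \<inter> {-1<..<1} = ({} :: real set)" by auto
  have "integral UNIV f = integral ?U f"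
    by (rule integral_spike_set) (rule negligible_subset[OF neg], auto)+
  also have "\<dots> = integral ({..<-1} \<union> {-1<..<1}) f + integral {1<..} f"
    by (intro Henstock_Kurzweil_Integration.integral_Un integrable_Un i) (simp_all only: e negligible_empty)
  also have "integral ({..<-1} \<union> {-1<..<1}) f = integral {..<-1} f + integral {-1<..<1} f"
    by (intro Henstock_Kurzweil_Integration.integral_Un i) (simp_all only: e negligible_empty)
  finally show "integral UNIV f = integral {..<-1} f + integral {-1<..<1} f + integral {1<..} f" .
qed

lemma norm_powr_le: "norm (z powr a) \<le> exp (pi * \<bar>Im a\<bar>) * norm z powr Re a"
proof -
  have "- Im a * Arg z \<le> \<bar>Im a\<bar> * \<bar>Arg z\<bar>" by (metis abs_ge_self abs_minus_cancel abs_mult)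
  also have "\<dots> \<le> \<bar>Im a\<bar> * pi" using Arg_le_pi[of z] mpi_less_Arg[of z] by (intro mult_left_mono) (auto simp: abs_le_iff)
  finally have "exp (- Im a * Arg z) \<le> exp (pi * \<bar>Im a\<bar>)" by (simp add: mult.commute)
  then show ?thesis unfolding norm_powr_complex by (subst mult.commute) (intro mult_right_mono, auto)
qed

text \<open>The sum of the two constants covers both signs of p at once.\<close>

lemma powr_le_if_between:
  fixes X Y :: real
  assumes "0 < X" "0 < c1" "c1 * X \<le> Y" "Y \<le> c2 * X"
  shows "Y powr p \<le> (c1 powr p + c2 powr p) * X powr p"
proof -
  have "0 < c1 * X" using assms by simp
  then have "0 < Y" using assms by linarith
  moreover from this have "0 < c2 * X" using assms by linarith
  ultimately have Y: "0 < Y" "0 < c2" using assms by (auto simp: zero_less_mult_iff)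
  have "Y powr p \<le> max ((c1 * X) powr p) ((c2 * X) powr p)"
  proof (cases "p \<ge> 0")
    case True
    then have "Y powr p \<le> (c2 * X) powr p" using assms Y by (intro powr_mono2) auto
    then show ?thesis by simp
  next
    case False
    then have "Y powr p \<le> (c1 * X) powr p" using assms Y by (intro powr_mono2') auto
    then show ?thesis by simp
  qed
  also have "\<dots> \<le> (c1 * X) powr p + (c2 * X) powr p" by (simp add: max_def)
  also have "\<dots> = (c1 powr p + c2 powr p) * X powr p" using assms Y by (simp add: powr_mult algebra_simps)
  finally show ?thesis .
qed

text \<open>Majorants for the contour argument: the first has the singularities at the branch points
  1 and -1 that appear on the real line, the second is the decay along lines strictly below it. On
  the half line beyond 1 both become beta integrands with second parameter r - 2 p - 1.\<close>

lemma line_weight_integrable: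
  fixes p r :: real
  assumes p: "p > -1" and r: "r - 2 * p > 1"
  shows "(\<lambda>\<xi>. \<bar>1 - \<xi>\<^sup>2\<bar> powr p * (1 + \<bar>\<xi>\<bar>) powr (- r)) absolutely_integrable_on UNIV"
    and "(\<lambda>\<xi>. (1 + \<bar>\<xi>\<bar>) powr (2 * p - r)) absolutely_integrable_on UNIV"
proof -
  have beta: "(\<lambda>t. t powr (a - 1) * (1 - t) powr (b - 1)) absolutely_integrable_on {0<..<1}" if "a > 0" "b > 0" for a b :: real
    using has_integral_Beta_real[OF that] by (intro nonnegative_absolutely_integrable_1) (auto simp: has_integral_Icc_iff_Ioo)
  have even: "f absolutely_integrable_on UNIV" if "f absolutely_integrable_on {1<..}" "f absolutely_integrable_on {-1<..<1}" "\<And>x. f (- x) = f x" for f :: "real \<Rightarrow> real"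
    unfolding absolutely_integrable_on_line_iff using that by (simp flip: reflect_substitution(1))
  show "(\<lambda>\<xi>. \<bar>1 - \<xi>\<^sup>2\<bar> powr p * (1 + \<bar>\<xi>\<bar>) powr (- r)) absolutely_integrable_on UNIV"
  proof (rule even)
    let ?f = "\<lambda>\<xi>::real. \<bar>1 - \<xi>\<^sup>2\<bar> powr p * (1 + \<bar>\<xi>\<bar>) powr (- r)"
    have "(\<lambda>t. 2 * 4 powr p * 2 powr (- r) * (t powr ((p + 1) - 1) * (1 - t) powr ((r - 2 * p - 1) - 1))) absolutely_integrable_on {0<..<1}"
      using p r by (intro set_integrable_mult_right beta) auto
    moreover have "(2 / (1 - t)\<^sup>2) *\<^sub>R ?f (1 + 2 * t / (1 - t)) = 2 * 4 powr p * 2 powr (- r) * (t powr ((p + 1) - 1) * (1 - t) powr ((r - 2 * p - 1) - 1))"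
      if "t \<in> {0<..<1}" for t
    proof -
      have e: "\<bar>1 - (1 + 2 * t / (1 - t))\<^sup>2\<bar> = 4 * t / (1 - t)\<^sup>2" "1 + \<bar>1 + 2 * t / (1 - t)\<bar> = 2 / (1 - t)"
      proof -
        have "1 + 2 * t / (1 - t) = (1 + t) / (1 - t)" using that by (simp add: field_simps)
        then have "1 - (1 + 2 * t / (1 - t))\<^sup>2 = ((1 - t)\<^sup>2 - (1 + t)\<^sup>2) / (1 - t)\<^sup>2"
          using that by (simp add: power_divide diff_divide_distrib)
        also have "(1 - t)\<^sup>2 - (1 + t)\<^sup>2 = - (4 * t)" by (simp add: power2_eq_square algebra_simps)
        finally have "1 - (1 + 2 * t / (1 - t))\<^sup>2 = - (4 * t / (1 - t)\<^sup>2)" by simp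
        moreover have "0 \<le> 4 * t / (1 - t)\<^sup>2" using that by simp
        ultimately show "\<bar>1 - (1 + 2 * t / (1 - t))\<^sup>2\<bar> = 4 * t / (1 - t)\<^sup>2" by linarith
        have "0 \<le> 2 * t / (1 - t)" using that by simp
        then show "1 + \<bar>1 + 2 * t / (1 - t)\<bar> = 2 / (1 - t)" using that by (simp add: field_simps)
      qed
      have q: "(1 - t)\<^sup>2 = (1 - t) powr 2" using that by simp
      have q': "((1 - t)\<^sup>2) powr p = (1 - t) powr (p * 2)" by (simp only: q powr_powr) (simp add: mult.commute)
      show ?thesis unfolding e using that
        by (simp add: q' powr_mult powr_divide powr_powr powr_minus powr_diff powr_add field_simps)
    qed
    ultimately show "?f absolutely_integrable_on {1<..}"
      unfolding moebius_substitution(1)[of 2, symmetric, simplified]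
      by (subst set_integrable_cong[OF refl]) (assumption | simp)+
    have "(\<lambda>\<xi>. (1 + 2 powr (- r)) * \<bar>1 - \<xi>\<^sup>2\<bar> powr p) absolutely_integrable_on {-1<..<1}"
    proof (rule set_integrable_mult_right)
      have "(\<lambda>t. 2 * 4 powr p * (t powr ((p + 1) - 1) * (1 - t) powr ((p + 1) - 1))) absolutely_integrable_on {0<..<1}"
        using p by (intro set_integrable_mult_right beta) auto
      moreover have "2 *\<^sub>R (\<bar>1 - (1 - 2 * t)\<^sup>2\<bar> powr p) = 2 * 4 powr p * (t powr ((p + 1) - 1) * (1 - t) powr ((p + 1) - 1))"
        if "t \<in> {0<..<1}" for t
      proof -
        have "\<bar>1 - (1 - 2 * t)\<^sup>2\<bar> = 4 * (t * (1 - t))" using that by (simp add: power2_eq_square algebra_simps abs_of_nonneg mult_left_le)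
        then show ?thesis using that by (simp add: powr_mult)
      qed
      ultimately show "(\<lambda>\<xi>::real. \<bar>1 - \<xi>\<^sup>2\<bar> powr p) absolutely_integrable_on {-1<..<1}"
        unfolding affine_substitution(1)[symmetric]
        by (subst set_integrable_cong[OF refl]) (assumption | simp)+
    qed
    then have "(\<lambda>\<xi>. (1 + 2 powr (- r)) * \<bar>1 - \<xi>\<^sup>2\<bar> powr p) integrable_on {-1<..<1}" by (simp add: absolutely_integrable_on_def)
    then show "?f absolutely_integrable_on {-1<..<1}"
    proof (rule measurable_bounded_by_integrable_imp_absolutely_integrable[rotated 2])
      show "?f \<in> borel_measurable (lebesgue_on {-1<..<1})"
        by (intro continuous_imp_measurable_on_sets_lebesgue continuous_intros) (auto simp: power2_eq_1_iff)
      fix x :: real assume "x \<in> {-1<..<1}"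
      then have "(1 + \<bar>x\<bar>) powr (- r) \<le> (1 powr (- r) + 2 powr (- r)) * 1 powr (- r)" by (intro powr_le_if_between) auto
      then have "(1 + \<bar>x\<bar>) powr (- r) * \<bar>1 - x\<^sup>2\<bar> powr p \<le> (1 + 2 powr (- r)) * \<bar>1 - x\<^sup>2\<bar> powr p" by (intro mult_right_mono) auto
      then show "norm (?f x) \<le> (1 + 2 powr (- r)) * \<bar>1 - x\<^sup>2\<bar> powr p" by (simp add: mult.commute)
    qed auto
  qed simp
  show "(\<lambda>\<xi>. (1 + \<bar>\<xi>\<bar>) powr (2 * p - r)) absolutely_integrable_on UNIV"
  proof (rule even)
    let ?f = "\<lambda>\<xi>::real. (1 + \<bar>\<xi>\<bar>) powr (2 * p - r)"
    have "(\<lambda>t. 2 * 2 powr (2 * p - r) * (t powr (1 - 1) * (1 - t) powr ((r - 2 * p - 1) - 1))) absolutely_integrable_on {0<..<1}"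
      using p r by (intro set_integrable_mult_right beta) auto
    moreover have "(2 / (1 - t)\<^sup>2) *\<^sub>R ?f (1 + 2 * t / (1 - t)) = 2 * 2 powr (2 * p - r) * (t powr (1 - 1) * (1 - t) powr ((r - 2 * p - 1) - 1))"
      if "t \<in> {0<..<1}" for t
    proof -
      have "0 \<le> 2 * t / (1 - t)" using that by simp
      then have e: "1 + \<bar>1 + 2 * t / (1 - t)\<bar> = 2 / (1 - t)" using that by (simp add: field_simps)
      have q: "(1 - t)\<^sup>2 = (1 - t) powr 2" using that by simp
      show ?thesis unfolding e q using that
        by (simp add: powr_mult powr_divide powr_powr powr_minus powr_diff powr_add field_simps)
    qed
    ultimately show "?f absolutely_integrable_on {1<..}"
      unfolding moebius_substitution(1)[of 2, symmetric, simplified]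
      by (subst set_integrable_cong[OF refl]) (assumption | simp)+
    have "?f absolutely_integrable_on {-1..1}"
      by (intro absolutely_integrable_continuous_real continuous_intros) auto
    then show "?f absolutely_integrable_on {-1<..<1}" by (rule set_integrable_subset) auto
  qed simp
qed

section \<open>The connection formula\<close>

lemma euler_integrand_absolutely_integrable:
  assumes "Re b > 0" "Re d > 0" "z \<in> cut_plane"
  shows "(\<lambda>t. beta_weight b d t * (1 - z * of_real t) powr (- a)) absolutely_integrable_on {0<..<1}"
proof -
  have "(\<lambda>z. (1 - z * complex_of_real t) powr (- a)) holomorphic_on cut_plane" if "t \<in> {0<..<1}" for t
    using that by (intro holomorphic_intros one_minus_mult_notin_nonpos) auto
  from holomorphic_weighted_integral(1)[OF open_cut_plane beta_weight_absolutely_integrable[OF assms(1,2)]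
      continuous_on_beta_weight euler_integrand_continuous this assms(3)]
  show ?thesis .
qed

lemma exp_minus_2i_slits:
  assumes "\<bar>\<theta>\<bar> < pi / 2"
  shows "exp (- (2 * \<i> * complex_of_real \<theta>)) \<notin> \<real>\<^sub>\<le>\<^sub>0"
    and "\<theta> \<noteq> 0 \<Longrightarrow> exp (- (2 * \<i> * complex_of_real \<theta>)) \<in> cut_plane"
proof -
  have c: "cos \<theta> > 0" using assms by (intro cos_gt_zero_pi) auto
  have Im: "Im (exp (- (2 * \<i> * complex_of_real \<theta>))) = - (2 * sin \<theta> * cos \<theta>)"
    by (simp add: Im_exp sin_double[symmetric])
  have Re: "Re (exp (- (2 * \<i> * complex_of_real \<theta>))) = 1 - 2 * (sin \<theta>)\<^sup>2"
    by (simp add: Re_exp cos_double_sin[symmetric])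
  show "exp (- (2 * \<i> * complex_of_real \<theta>)) \<notin> \<real>\<^sub>\<le>\<^sub>0"
    using c unfolding complex_nonpos_Reals_iff Im Re by auto
  have "sin \<theta> \<noteq> 0" if "\<theta> \<noteq> 0"
    using that assms sin_gt_zero[of \<theta>] sin_gt_zero[of "- \<theta>"] by (cases "\<theta> > 0") auto
  then show "exp (- (2 * \<i> * complex_of_real \<theta>)) \<in> cut_plane" if "\<theta> \<noteq> 0"
    using c that unfolding cut_plane_iff Im by auto
qed

text \<open>The logarithms add without a multiple of 2 \<pi> i: the factors have arguments below
  \<pi>/2 and \<pi> in modulus, the product below \<pi>/2.\<close>

lemma laplace_base_factor:
  assumes \<theta>: "\<bar>\<theta>\<bar> < pi / 2" and eq: "of_real (cos \<theta>) + \<i> * of_real (sin \<theta>) * z = exp (\<i> * of_real \<theta>) * (of_real k * w)"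
    and k: "k > 0" and w: "w \<notin> \<real>\<^sub>\<le>\<^sub>0" and Re: "Re (of_real (cos \<theta>) + \<i> * of_real (sin \<theta>) * z) > 0"
  shows "(of_real (cos \<theta>) + \<i> * of_real (sin \<theta>) * z) powr a = exp (\<i> * of_real \<theta> * a) * (of_real k powr a * w powr a)"
proof -
  let ?L = "of_real (cos \<theta>) + \<i> * of_real (sin \<theta>) * z"
  have nz: "?L \<noteq> 0" "w \<noteq> 0" using Re w by (metis less_irrefl zero_complex.sel(1)) (use w in auto)
  have "Ln ?L = \<i> * of_real \<theta> + of_real (ln k) + Ln w"
  proof (rule exp_complex_eqI)
    have a: "\<bar>Im (Ln ?L)\<bar> < pi / 2" using Re Re_Ln_pos_lt_imp by blast
    have b: "\<bar>Im (Ln w)\<bar> < pi"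
      using w mpi_less_Im_Ln[OF nz(2)] Im_Ln_le_pi[OF nz(2)] Im_Ln_eq_pi[OF nz(2)]
      by (auto simp: abs_less_iff complex_nonpos_Reals_iff less_le)
    have c: "Im (\<i> * of_real \<theta> + of_real (ln k) + Ln w) = \<theta> + Im (Ln w)" by simp
    show "\<bar>Im (Ln ?L) - Im (\<i> * of_real \<theta> + of_real (ln k) + Ln w)\<bar> < 2 * pi"
      unfolding c using a b \<theta> by linarith
    show "exp (Ln ?L) = exp (\<i> * of_real \<theta> + of_real (ln k) + Ln w)"
      using nz k by (simp only: exp_Ln exp_add) (simp add: eq exp_of_real)
  qed
  then have "a * Ln ?L = \<i> * of_real \<theta> * a + (a * of_real (ln k) + a * Ln w)" by (simp only: distrib_left) (simp add: mult_ac)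
  then have "exp (a * Ln ?L) = exp (\<i> * of_real \<theta> * a) * (exp (a * of_real (ln k)) * exp (a * Ln w))" by (simp only: exp_add)
  then show ?thesis using nz powr_of_real_eq_exp[OF k, of a] by (simp only: powr_def if_False)
qed

lemma laplace_integral_outer:
  assumes m: "Re m > 0" and q: "Re (lam - 2 * m + 1) > 0" and \<theta>: "\<bar>\<theta>\<bar> < pi / 2" "\<theta> \<noteq> 0"
  shows "integral {1<..} (\<lambda>\<xi>. of_real (\<xi>\<^sup>2 - 1) powr (m - 1) * (of_real (cos \<theta>) + \<i> * of_real (sin \<theta>) * of_real \<xi>) powr (- lam)) =
     2 powr (2 * m - 1) * Gamma m * Gamma (lam - 2 * m + 1) *
     (exp (- (\<i> * of_real \<theta> * lam)) * hyp2F1_reg lam m (lam - m + 1) (exp (- (2 * \<i> * of_real \<theta>))))"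
proof -
  let ?f = "\<lambda>\<xi>. complex_of_real (\<xi>\<^sup>2 - 1) powr (m - 1) * (of_real (cos \<theta>) + \<i> * of_real (sin \<theta>) * of_real \<xi>) powr (- lam)"
  define X where "X = exp (- (2 * \<i> * complex_of_real \<theta>))"
  have X: "X \<in> cut_plane" unfolding X_def by (rule exp_minus_2i_slits(2)[OF \<theta>])
  have nX: "norm X = 1" by (simp add: X_def)
  have c: "cos \<theta> > 0" using \<theta> by (intro cos_gt_zero_pi) auto
  let ?w = "beta_weight m (lam - 2 * m + 1)"
  let ?K = "2 powr (2 * m - 1) * exp (- (\<i> * of_real \<theta> * lam))"
  have f: "(2 / (1 - t)\<^sup>2) *\<^sub>R ?f (1 + 2 * t / (1 - t)) = ?K * (?w t * (1 - X * of_real t) powr (- lam))" if t: "t \<in> {0<..<1}" for t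
  proof -
    define \<xi> where "\<xi> = 1 + 2 * t / (1 - t)"
    have \<xi>: "\<xi> = (1 + t) / (1 - t)" using t by (simp add: \<xi>_def field_simps)
    have e1: "\<xi>\<^sup>2 - 1 = 4 * t * (1 / (1 - t)\<^sup>2)"
    proof -
      have "\<xi>\<^sup>2 - 1 = ((1 + t)\<^sup>2 - (1 - t)\<^sup>2) / (1 - t)\<^sup>2" unfolding \<xi> using t by (simp add: power_divide diff_divide_distrib)
      also have "(1 + t)\<^sup>2 - (1 - t)\<^sup>2 = 4 * t" by (simp add: power2_eq_square algebra_simps)
      finally show ?thesis by simp
    qed
    have eX: "exp (\<i> * of_real \<theta>) * X = exp (- (\<i> * of_real \<theta>))"
      unfolding X_def exp_add[symmetric] by simp
    have cs: "2 * complex_of_real (cos \<theta>) = exp (\<i> * of_real \<theta>) + exp (- (\<i> * of_real \<theta>))"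
       "2 * \<i> * complex_of_real (sin \<theta>) = exp (\<i> * of_real \<theta>) - exp (- (\<i> * of_real \<theta>))"
      by (simp_all add: cos_exp_eq sin_exp_eq flip: cos_of_real sin_of_real)
    have L: "of_real (cos \<theta>) + \<i> * of_real (sin \<theta>) * of_real \<xi> = exp (\<i> * of_real \<theta>) * (of_real (1 / (1 - t)) * (1 - X * of_real t))"
    proof -
      have t': "1 - complex_of_real t \<noteq> 0" using t by (metis eq_iff_diff_eq_0 greaterThanLessThan_iff of_real_eq_1_iff less_irrefl)
      have "2 * (1 - of_real t) * (of_real (cos \<theta>) + \<i> * of_real (sin \<theta>) * of_real \<xi>)
         = (1 - of_real t) * (2 * complex_of_real (cos \<theta>)) + (1 + of_real t) * (2 * \<i> * complex_of_real (sin \<theta>))"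
        unfolding \<xi> using t' by (simp add: field_simps)
      also have "\<dots> = 2 * (exp (\<i> * of_real \<theta>) - exp (- (\<i> * of_real \<theta>)) * of_real t)" unfolding cs by (simp add: algebra_simps)
      also have "\<dots> = 2 * (1 - of_real t) * (exp (\<i> * of_real \<theta>) * (of_real (1 / (1 - t)) * (1 - X * of_real t)))"
        unfolding eX[symmetric] using t' by (simp add: field_simps)
      finally have eq: "2 * (1 - of_real t) * (of_real (cos \<theta>) + \<i> * of_real (sin \<theta>) * of_real \<xi>) = \<dots>" .
      have "2 * (1 - complex_of_real t) \<noteq> 0" using t' by simp
      from mult_left_cancel[THEN iffD1, OF this eq] show ?thesis .
    qed
    have w: "1 - X * of_real t \<notin> \<real>\<^sub>\<le>\<^sub>0" using one_minus_mult_notin_nonpos[OF X] t by simp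
    have "(of_real (cos \<theta>) + \<i> * of_real (sin \<theta>) * of_real \<xi>) powr (- lam) =
       exp (\<i> * of_real \<theta> * (- lam)) * (of_real (1 / (1 - t)) powr (- lam) * (1 - X * of_real t) powr (- lam))"
      by (rule laplace_base_factor[OF \<theta>(1) L _ w]) (use t c in auto)
    moreover have "of_real (\<xi>\<^sup>2 - 1) powr (m - 1) = 2 powr (2 * m - 2) * of_real t powr (m - 1) * of_real (1 - t) powr (2 - 2 * m)"
    proof -
      have p: "4 * t * (1 / (1 - t)\<^sup>2) > 0" using t by simp
      have "ln (4 * t * (1 / (1 - t)\<^sup>2)) = 2 * ln 2 + ln t - 2 * ln (1 - t)"
        using t ln_realpow[of 2 2] by (simp add: ln_mult ln_div ln_realpow)
      then show ?thesis unfolding e1 powr_of_real_eq_exp[OF p]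
        using t powr_of_real_eq_exp[of 2 "2 * m - 2"] powr_of_real_eq_exp[of t "m - 1"] powr_of_real_eq_exp[of "1 - t" "2 - 2 * m"]
        by (simp add: exp_add[symmetric] del: of_real_diff) (simp add: algebra_simps)
    qed
    moreover have "complex_of_real (2 / (1 - t)\<^sup>2) * 2 powr (2 * m - 2) * of_real (1 - t) powr (2 - 2 * m) * of_real (1 / (1 - t)) powr (- lam)
        = 2 powr (2 * m - 1) * of_real (1 - t) powr (lam - 2 * m + 1 - 1)"
    proof -
      have t1: "1 - t > 0" "1 / (1 - t) > 0" using t by auto
      have "complex_of_real (2 / (1 - t)\<^sup>2) = exp (of_real (ln 2 - 2 * ln (1 - t)))"
        using t1 by (simp add: exp_of_real exp_diff exp_double ln_div power2_eq_square flip: of_real_exp)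
      moreover have "ln (1 / (1 - t)) = - ln (1 - t)" using t1 by (simp add: ln_div)
      ultimately show ?thesis
        unfolding powr_of_real_eq_exp[OF t1(1)] powr_of_real_eq_exp[OF t1(2)]
        using powr_of_real_eq_exp[of 2 "2 * m - 2"] powr_of_real_eq_exp[of 2 "2 * m - 1"]
        by (simp add: exp_add[symmetric]) (simp add: algebra_simps)
    qed
    ultimately show ?thesis unfolding \<xi>_def[symmetric] beta_weight_def scaleR_conv_of_real by (simp add: mult_ac)
  qed
  have ai: "(\<lambda>t. ?K * (?w t * (1 - X * of_real t) powr (- lam))) absolutely_integrable_on {0<..<1}"
    by (intro set_integrable_mult_right euler_integrand_absolutely_integrable m q X)
  have "(\<lambda>t. (2 / (1 - t)\<^sup>2) *\<^sub>R ?f (1 + 2 * t / (1 - t))) absolutely_integrable_on {0<..<1}"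
    by (subst set_integrable_cong[OF refl refl f]) (use ai in auto)
  then have "?f absolutely_integrable_on {1<..}" using moebius_substitution(1)[of 2 ?f] by simp
  from moebius_substitution(2)[OF _ this, of 2]
  have "integral {1<..} ?f = integral {0<..<1} (\<lambda>t. (2 / (1 - t)\<^sup>2) *\<^sub>R ?f (1 + 2 * t / (1 - t)))" by simp
  also have "\<dots> = integral {0<..<1} (\<lambda>t. ?K * (?w t * (1 - X * of_real t) powr (- lam)))"
    by (rule integral_cong) (rule f)
  also have "\<dots> = ?K * (Gamma m * Gamma (lam - 2 * m + 1) * hyp2F1_reg lam m (lam - m + 1) X)"
  proof -
    have cq: "lam - m + 1 - m = lam - 2 * m + 1" by simp
    show ?thesis using euler_integral[OF m, of "lam - m + 1", unfolded cq, OF q X, of lam] by simp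
  qed
  finally show ?thesis by (simp add: X_def mult_ac)
qed

text \<open>With \<xi> = 1 - 2 t and X = e^(-2 i \<theta>) the base becomes e^(i \<theta>) (1 - (1 -
  X) t), and 1 - \<xi>^2 = 4 t (1 - t): Euler's integral with c = 2 m at 1 - X.\<close>

lemma laplace_integral_inner:
  assumes m: "Re m > 0" and \<theta>: "\<bar>\<theta>\<bar> < pi / 2"
  shows "integral {-1<..<1} (\<lambda>\<xi>. of_real (1 - \<xi>\<^sup>2) powr (m - 1) * (of_real (cos \<theta>) + \<i> * of_real (sin \<theta>) * of_real \<xi>) powr (- lam)) =
     2 powr (2 * m - 1) * (Gamma m)\<^sup>2 *
     (exp (- (\<i> * of_real \<theta> * lam)) * hyp2F1_reg lam m (2 * m) (1 - exp (- (2 * \<i> * of_real \<theta>))))"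
proof -
  let ?f = "\<lambda>\<xi>. complex_of_real (1 - \<xi>\<^sup>2) powr (m - 1) * (of_real (cos \<theta>) + \<i> * of_real (sin \<theta>) * of_real \<xi>) powr (- lam)"
  define X where "X = exp (- (2 * \<i> * complex_of_real \<theta>))"
  have X: "1 - X \<in> cut_plane"
    using exp_minus_2i_slits(1)[OF \<theta>] unfolding X_def[symmetric] by (auto simp: cut_plane_iff complex_nonpos_Reals_iff)
  have c: "cos \<theta> > 0" using \<theta> by (intro cos_gt_zero_pi) auto
  let ?w = "beta_weight m m"
  let ?K = "2 powr (2 * m - 1) * exp (- (\<i> * of_real \<theta> * lam))"
  have f: "2 *\<^sub>R ?f (1 - 2 * t) = ?K * (?w t * (1 - (1 - X) * of_real t) powr (- lam))" if t: "t \<in> {0<..<1}" for t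
  proof -
    have eX: "exp (\<i> * of_real \<theta>) * X = exp (- (\<i> * of_real \<theta>))"
      unfolding X_def exp_add[symmetric] by simp
    have cs: "2 * complex_of_real (cos \<theta>) = exp (\<i> * of_real \<theta>) + exp (- (\<i> * of_real \<theta>))"
       "2 * \<i> * complex_of_real (sin \<theta>) = exp (\<i> * of_real \<theta>) - exp (- (\<i> * of_real \<theta>))"
      by (simp_all add: cos_exp_eq sin_exp_eq flip: cos_of_real sin_of_real)
    have L: "of_real (cos \<theta>) + \<i> * of_real (sin \<theta>) * of_real (1 - 2 * t) = exp (\<i> * of_real \<theta>) * (of_real 1 * (1 - (1 - X) * of_real t))"
    proof -
      have "2 * (of_real (cos \<theta>) + \<i> * of_real (sin \<theta>) * of_real (1 - 2 * t))
         = 2 * complex_of_real (cos \<theta>) + (1 - 2 * of_real t) * (2 * \<i> * complex_of_real (sin \<theta>))"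
        by (simp add: algebra_simps)
      also have "\<dots> = 2 * (exp (\<i> * of_real \<theta>) * (1 - of_real t) + exp (- (\<i> * of_real \<theta>)) * of_real t)" unfolding cs by (simp add: algebra_simps)
      also have "\<dots> = 2 * (exp (\<i> * of_real \<theta>) * (of_real 1 * (1 - (1 - X) * of_real t)))"
        unfolding eX[symmetric] by (simp add: algebra_simps)
      finally have eq: "2 * (of_real (cos \<theta>) + \<i> * of_real (sin \<theta>) * of_real (1 - 2 * t)) = \<dots>" .
      from mult_left_cancel[THEN iffD1, OF _ eq] show ?thesis by simp
    qed
    have w: "1 - (1 - X) * of_real t \<notin> \<real>\<^sub>\<le>\<^sub>0" using one_minus_mult_notin_nonpos[OF X] t by simp
    have "(of_real (cos \<theta>) + \<i> * of_real (sin \<theta>) * of_real (1 - 2 * t)) powr (- lam) =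
       exp (\<i> * of_real \<theta> * (- lam)) * (of_real 1 powr (- lam) * (1 - (1 - X) * of_real t) powr (- lam))"
      by (rule laplace_base_factor[OF \<theta>(1) L _ w]) (use c in auto)
    moreover have "2 * complex_of_real (1 - (1 - 2 * t)\<^sup>2) powr (m - 1) = 2 powr (2 * m - 1) * (of_real t powr (m - 1) * of_real (1 - t) powr (m - 1))"
    proof -
      have e1: "1 - (1 - 2 * t)\<^sup>2 = 4 * (t * (1 - t))" by (simp add: power2_eq_square algebra_simps)
      have p: "4 * (t * (1 - t)) > 0" using t by simp
      have "ln (4 * (t * (1 - t))) = 2 * ln 2 + ln t + ln (1 - t)"
        using t ln_realpow[of 2 2] by (simp add: ln_mult)
      then have "2 * complex_of_real (4 * (t * (1 - t))) powr (m - 1) = exp (of_real (ln 2)) * exp ((m - 1) * of_real (2 * ln 2 + ln t + ln (1 - t)))"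
        unfolding powr_of_real_eq_exp[OF p] by (simp add: exp_of_real)
      also have "\<dots> = exp ((2 * m - 1) * of_real (ln 2)) * (exp ((m - 1) * of_real (ln t)) * exp ((m - 1) * of_real (ln (1 - t))))"
        unfolding exp_add[symmetric] by (rule arg_cong[where f = exp]) (simp add: algebra_simps)
      also have "\<dots> = 2 powr (2 * m - 1) * (of_real t powr (m - 1) * of_real (1 - t) powr (m - 1))"
        using t powr_of_real_eq_exp[of 2 "2 * m - 1"] powr_of_real_eq_exp[of t "m - 1"] powr_of_real_eq_exp[of "1 - t" "m - 1"] by simp
      finally show ?thesis unfolding e1 .
    qed
    ultimately show ?thesis unfolding beta_weight_def scaleR_conv_of_real by (simp add: mult_ac)
  qed
  have ai: "(\<lambda>t. ?K * (?w t * (1 - (1 - X) * of_real t) powr (- lam))) absolutely_integrable_on {0<..<1}"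
    by (intro set_integrable_mult_right euler_integrand_absolutely_integrable m X)
  have "(\<lambda>t. 2 *\<^sub>R ?f (1 - 2 * t)) absolutely_integrable_on {0<..<1}"
    by (subst set_integrable_cong[OF refl refl f]) (use ai in auto)
  then have "?f absolutely_integrable_on {-1<..<1}" using affine_substitution(1)[of ?f] by simp
  from affine_substitution(2)[OF this]
  have "integral {-1<..<1} ?f = integral {0<..<1} (\<lambda>t. 2 *\<^sub>R ?f (1 - 2 * t))" by simp
  also have "\<dots> = integral {0<..<1} (\<lambda>t. ?K * (?w t * (1 - (1 - X) * of_real t) powr (- lam)))"
    by (rule integral_cong) (rule f)
  also have "\<dots> = ?K * (Gamma m * Gamma m * hyp2F1_reg lam m (2 * m) (1 - X))"
  proof -
    have cq: "2 * m - m = m" by simp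
    show ?thesis using euler_integral[OF m, of "2 * m", unfolded cq, OF m X, of lam] by simp
  qed
  finally show ?thesis by (simp add: X_def mult_ac power2_eq_square)
qed

section \<open>Vanishing of the integral along horizontal lines\<close>

lemma integral_shift_UNIV:
  fixes f :: "real \<Rightarrow> complex"
  assumes "f absolutely_integrable_on UNIV"
  shows "integral UNIV (\<lambda>x. f (x + a)) = integral UNIV f"
proof -
  have im: "(\<lambda>x. x + a) ` UNIV = UNIV" by (auto simp: image_iff intro!: exI[of _ "_ - a"])
  have der: "((\<lambda>x. x + a) has_field_derivative 1) (at x within UNIV)" for x by (auto intro!: derivative_eq_intros)
  note cov = has_absolute_integral_change_of_variables_real[of UNIV "\<lambda>x. x + a" "\<lambda>_. 1", OF _ der, unfolded im]
  show ?thesis using cov[of f "integral UNIV f"] assms by (simp add: inj_on_def)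
qed

context
  fixes m lam :: complex and \<theta> :: real
  assumes m: "Re m > 0" and q: "Re (lam - 2 * m + 1) > 0" and \<theta>: "0 < \<theta>" "\<theta> < pi / 2"
begin

text \<open>\<open>L\<close> has positive real part on the closed lower half plane, so
  \<open>f\<close> is holomorphic strictly below the real line; its boundary values from below are
  \<open>f0\<close>. \<open>p\<close> and \<open>r\<close> are the real exponents that govern
  absolute values, with r - 2 p > 1 for integrability at infinity.\<close>

private definition "L z = of_real (cos \<theta>) + \<i> * of_real (sin \<theta>) * z" for z :: complex
private definition "f z = (1 - z\<^sup>2) powr (m - 1) * L z powr (- lam)" for z :: complex
private definition "p = Re m - 1"
private definition "r = Re lam"
private definition "\<kappa> = min (cos \<theta>) (sin \<theta>)"

private lemma pr: "p > -1" "r - 2 * p > 1"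
  using m q by (auto simp: p_def r_def)

private lemma cs: "cos \<theta> > 0" "sin \<theta> > 0" "\<kappa> > 0" "cos \<theta> \<ge> \<kappa>" "sin \<theta> \<ge> \<kappa>" "\<kappa> \<le> 1"
proof -
  show "cos \<theta> > 0" using \<theta> by (intro cos_gt_zero_pi) auto
  moreover show "sin \<theta> > 0" using \<theta> by (intro sin_gt_zero) auto
  ultimately show "\<kappa> > 0" "cos \<theta> \<ge> \<kappa>" "sin \<theta> \<ge> \<kappa>" "\<kappa> \<le> 1"
    using cos_le_one[of \<theta>] by (auto simp: \<kappa>_def min_def)
qed

private lemma L_pos: "Im z \<le> 0 \<Longrightarrow> Re (L z) > 0"
  using cs mult_nonneg_nonpos[of "sin \<theta>" "Im z"] by (simp add: L_def)

private lemma L_slit: "Im z \<le> 0 \<Longrightarrow> L z \<notin> \<real>\<^sub>\<le>\<^sub>0"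
  using L_pos[of z] by (auto simp: complex_nonpos_Reals_iff)

text \<open>|L z|^2 = cos^2 \<theta> + sin^2 \<theta> |z|^2 - 2 cos \<theta> sin \<theta> Im z,
  where the last term is nonnegative on the closed lower half plane.\<close>

private lemma L_bounds:
  assumes z: "Im z \<le> 0"
  shows "\<kappa> / 2 * (1 + norm z) \<le> norm (L z)" "norm (L z) \<le> 1 * (1 + norm z)"
proof -
  have "(\<kappa> / 2 * (1 + norm z))\<^sup>2 \<le> (norm (L z))\<^sup>2"
  proof -
    have "(1 + norm z)\<^sup>2 \<le> 2 * (1 + (norm z)\<^sup>2)" using zero_le_power2[of "1 - norm z"] by (simp add: power2_eq_square algebra_simps)
    then have "\<kappa>\<^sup>2 * (1 + norm z)\<^sup>2 \<le> \<kappa>\<^sup>2 * (2 * (1 + (norm z)\<^sup>2))" by (intro mult_left_mono) auto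
    also have "\<dots> \<le> 2 * ((cos \<theta>)\<^sup>2 + (sin \<theta>)\<^sup>2 * (norm z)\<^sup>2)"
      using power_mono[OF cs(4), of 2] power_mono[OF cs(5), of 2] cs(3) mult_right_mono[of "\<kappa>\<^sup>2" "(sin \<theta>)\<^sup>2" "(norm z)\<^sup>2"]
      by (simp add: algebra_simps)
    also have "(cos \<theta>)\<^sup>2 + (sin \<theta>)\<^sup>2 * (norm z)\<^sup>2 \<le> (norm (L z))\<^sup>2"
    proof -
      have "(norm (L z))\<^sup>2 = (cos \<theta>)\<^sup>2 + (sin \<theta>)\<^sup>2 * (norm z)\<^sup>2 + 2 * cos \<theta> * sin \<theta> * (- Im z)"
        unfolding cmod_power2 L_def by (simp add: power2_eq_square algebra_simps)
      moreover have "2 * cos \<theta> * sin \<theta> * (- Im z) \<ge> 0" using cs z by (intro mult_nonneg_nonneg) auto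
      ultimately show ?thesis by linarith
    qed
    finally have "\<kappa>\<^sup>2 * (1 + norm z)\<^sup>2 \<le> 2 * (norm (L z))\<^sup>2" by simp
    then have "(\<kappa> / 2)\<^sup>2 * (1 + norm z)\<^sup>2 \<le> (norm (L z))\<^sup>2" by (simp add: power_divide field_simps) (smt (verit) zero_le_power2)
    then show ?thesis by (simp only: power_mult_distrib)
  qed
  then show "\<kappa> / 2 * (1 + norm z) \<le> norm (L z)" by (rule power2_le_imp_le) simp
  have "norm (L z) \<le> norm (complex_of_real (cos \<theta>)) + norm (\<i> * of_real (sin \<theta>) * z)"
    unfolding L_def by (rule norm_triangle_ineq)
  also have "\<dots> \<le> 1 + 1 * norm z"
    unfolding norm_mult by (intro add_mono mult_right_mono) auto
  finally show "norm (L z) \<le> 1 * (1 + norm z)" by simp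
qed

private definition "CL = exp (pi * \<bar>Im lam\<bar>) * ((\<kappa> / 2) powr (- r) + 1)"

private lemma L_powr_bound:
  assumes z: "Im z \<le> 0"
  shows "norm (L z powr (- lam)) \<le> CL * (1 + norm z) powr (- r)"
proof -
  have "norm (L z powr (- lam)) \<le> exp (pi * \<bar>Im lam\<bar>) * norm (L z) powr (- r)"
    using norm_powr_le[of "L z" "- lam"] by (simp add: r_def)
  also have "norm (L z) powr (- r) \<le> ((\<kappa> / 2) powr (- r) + 1 powr (- r)) * (1 + norm z) powr (- r)"
    using cs by (intro powr_le_if_between L_bounds z) (auto intro: add_pos_nonneg)
  finally show ?thesis by (simp add: CL_def mult.assoc mult_left_mono)
qed

private lemma CL_nonneg: "CL \<ge> 0" by (simp add: CL_def)

private definition "Cm = exp (pi * \<bar>Im m\<bar>)"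

private lemma m_powr_bound: "norm ((1 - z\<^sup>2) powr (m - 1)) \<le> Cm * norm (1 - z\<^sup>2) powr p"
  using norm_powr_le[of "1 - z\<^sup>2" "m - 1"] by (simp add: Cm_def p_def)

private lemma Cm_nonneg: "Cm \<ge> 0" by (simp add: Cm_def)

private lemma square_norm_upper: "norm (1 - z\<^sup>2) \<le> 1 * ((1 + norm z)\<^sup>2)" for z :: complex
proof -
  have "norm (1 - z\<^sup>2) \<le> 1 + (norm z)\<^sup>2" using norm_triangle_ineq4[of 1 "z\<^sup>2"] by (simp add: norm_power)
  also have "\<dots> \<le> (1 + norm z)\<^sup>2" by (simp add: power2_eq_square algebra_simps)
  finally show ?thesis by simp
qed

private lemma square_powr: "((1 + norm z)\<^sup>2) powr p = (1 + norm z) powr (2 * p)" for z :: complex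
proof -
  have "1 + norm z > 0" by (simp add: add_pos_nonneg)
  then have "(1 + norm z)\<^sup>2 = (1 + norm z) powr 2" by simp
  then show ?thesis by (simp only: powr_powr)
qed

text \<open>At distance \<eta> from the real line both 1 - z and 1 + z are comparable to 1 + |z|, so
  |f z| is at most a constant times (1 + |z|)^(2 p - r), whatever the sign of p.\<close>

private lemma f_bound_below:
  assumes \<eta>: "0 < \<eta>" "\<eta> \<le> 1" and z: "Im z \<le> - \<eta>"
  shows "norm (f z) \<le> Cm * (((\<eta> / 3)\<^sup>2) powr p + 1) * CL * (1 + norm z) powr (2 * p - r)"
proof -
  have a: "1 + norm z \<le> 3 / \<eta> * norm (1 - s * z)" if "s = 1 \<or> s = -1" for s :: complex
  proof -
    have "\<eta> \<le> \<bar>Im (1 - s * z)\<bar>" using that z \<eta> by auto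
    also have "\<dots> \<le> norm (1 - s * z)" by (rule abs_Im_le_cmod)
    finally have e: "\<eta> \<le> norm (1 - s * z)" .
    have "norm z = norm (1 - (1 - s * z))" using that by auto
    also have "\<dots> \<le> 1 + norm (1 - s * z)" using norm_triangle_ineq4[of 1 "1 - s * z"] by simp
    finally have "\<eta> * (1 + norm z) \<le> \<eta> * (2 + norm (1 - s * z))" using \<eta> by (intro mult_left_mono) auto
    also have "\<dots> \<le> 3 * norm (1 - s * z)"
      using e \<eta> mult_right_mono[of \<eta> 1 "norm (1 - s * z)"] by (simp add: algebra_simps)
    finally show ?thesis using \<eta> by (simp add: field_simps)
  qed
  have "(\<eta> / 3)\<^sup>2 * (1 + norm z)\<^sup>2 \<le> norm (1 - z) * norm (1 + z)"
  proof -
    have "\<eta> / 3 * (1 + norm z) \<le> norm (1 - z)" "\<eta> / 3 * (1 + norm z) \<le> norm (1 + z)"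
      using a[of 1] a[of "-1"] \<eta> by (simp_all add: field_simps)
    then have "(\<eta> / 3 * (1 + norm z)) * (\<eta> / 3 * (1 + norm z)) \<le> norm (1 - z) * norm (1 + z)"
      using \<eta> by (intro mult_mono) auto
    then show ?thesis by (simp add: power2_eq_square mult_ac)
  qed
  also have "\<dots> = norm (1 - z\<^sup>2)" by (simp add: norm_mult[symmetric] power2_eq_square algebra_simps)
  finally have "norm (1 - z\<^sup>2) powr p \<le> (((\<eta> / 3)\<^sup>2) powr p + 1 powr p) * ((1 + norm z)\<^sup>2) powr p"
    using \<eta> add_pos_nonneg[OF zero_less_one norm_ge_zero, of z]
    by (intro powr_le_if_between square_norm_upper) (auto intro!: zero_less_power)
  then have 1: "norm (1 - z\<^sup>2) powr p \<le> (((\<eta> / 3)\<^sup>2) powr p + 1) * (1 + norm z) powr (2 * p)"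
    unfolding square_powr by simp
  have "norm (f z) = norm ((1 - z\<^sup>2) powr (m - 1)) * norm (L z powr (- lam))" by (simp add: f_def norm_mult)
  also have "\<dots> \<le> (Cm * ((((\<eta> / 3)\<^sup>2) powr p + 1) * (1 + norm z) powr (2 * p))) * (CL * (1 + norm z) powr (- r))"
    using z \<eta> by (intro mult_mono L_powr_bound order_trans[OF m_powr_bound] mult_left_mono[OF 1] Cm_nonneg mult_nonneg_nonneg) auto
  also have "\<dots> = Cm * (((\<eta> / 3)\<^sup>2) powr p + 1) * CL * (1 + norm z) powr (2 * p - r)"
    by (simp add: powr_diff powr_minus field_simps)
  finally show ?thesis .
qed

text \<open>A bound independent of the distance e to the real line. For p \<ge> 0 the factor |1 -
  z^2|^p is at most (1 + |z|)^(2 p); for p < 0 it is at most its value |1 - \<xi>^2|^p on the real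
  line. The sum covers either sign.\<close>

private lemma f_bound_near:
  assumes e: "0 \<le> e" "e \<le> 1" and \<xi>: "\<xi> \<noteq> 1" "\<xi> \<noteq> -1"
  shows "norm (f (of_real \<xi> - \<i> * of_real e)) \<le>
    Cm * CL * (1 + 2 powr (- r)) * (\<bar>1 - \<xi>\<^sup>2\<bar> powr p * (1 + \<bar>\<xi>\<bar>) powr (- r)) +
    Cm * CL * (1 + 2 powr (2 * p - r)) * (1 + \<bar>\<xi>\<bar>) powr (2 * p - r)"
proof -
  define z where "z = complex_of_real \<xi> - \<i> * of_real e"
  have Imz: "Im z \<le> 0" using e by (simp add: z_def)
  have n: "1 * (1 + \<bar>\<xi>\<bar>) \<le> 1 + norm z" "1 + norm z \<le> 2 * (1 + \<bar>\<xi>\<bar>)"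
  proof -
    show "1 * (1 + \<bar>\<xi>\<bar>) \<le> 1 + norm z" using abs_Re_le_cmod[of z] by (simp add: z_def)
    have "norm z \<le> \<bar>\<xi>\<bar> + \<bar>e\<bar>" using norm_triangle_ineq4[of "complex_of_real \<xi>" "\<i> * of_real e"] by (simp add: z_def norm_mult)
    then show "1 + norm z \<le> 2 * (1 + \<bar>\<xi>\<bar>)" using e abs_ge_zero[of \<xi>] by simp
  qed
  have pow: "(1 + norm z) powr b \<le> (1 + 2 powr b) * (1 + \<bar>\<xi>\<bar>) powr b" for b
    using powr_le_if_between[OF _ _ n, of b] by (simp add: add_pos_nonneg)
  have low: "\<bar>1 - \<xi>\<^sup>2\<bar> \<le> norm (1 - z\<^sup>2)"
  proof -
    have "\<bar>1 - \<xi>\<^sup>2\<bar> = \<bar>1 - \<xi>\<bar> * \<bar>1 + \<xi>\<bar>" by (simp add: abs_mult[symmetric] power2_eq_square algebra_simps)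
    also have "\<dots> \<le> norm (1 - z) * norm (1 + z)"
      using abs_Re_le_cmod[of "1 - z"] abs_Re_le_cmod[of "1 + z"] by (intro mult_mono) (auto simp: z_def)
    also have "\<dots> = norm (1 - z\<^sup>2)" by (simp add: norm_mult[symmetric] power2_eq_square algebra_simps)
    finally show ?thesis .
  qed
  have pos: "\<bar>1 - \<xi>\<^sup>2\<bar> > 0" using \<xi> by (simp add: power2_eq_1_iff)
  have "norm (1 - z\<^sup>2) powr p \<le> \<bar>1 - \<xi>\<^sup>2\<bar> powr p + (1 + norm z) powr (2 * p)"
  proof (cases "p \<ge> 0")
    case True
    then have "norm (1 - z\<^sup>2) powr p \<le> ((1 + norm z)\<^sup>2) powr p"
      using square_norm_upper[of z] by (intro powr_mono2) auto
    then show ?thesis unfolding square_powr by (simp add: add_increasing)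
  next
    case False
    then have "norm (1 - z\<^sup>2) powr p \<le> \<bar>1 - \<xi>\<^sup>2\<bar> powr p" using low pos by (intro powr_mono2') auto
    then show ?thesis by (simp add: add_increasing2)
  qed
  then have 1: "norm ((1 - z\<^sup>2) powr (m - 1)) \<le> Cm * (\<bar>1 - \<xi>\<^sup>2\<bar> powr p + (1 + norm z) powr (2 * p))"
    using m_powr_bound[of z] Cm_nonneg by (meson mult_left_mono order_trans)
  have "norm (f z) \<le> (Cm * (\<bar>1 - \<xi>\<^sup>2\<bar> powr p + (1 + norm z) powr (2 * p))) * (CL * (1 + norm z) powr (- r))"
    unfolding f_def norm_mult by (intro mult_mono 1 L_powr_bound Imz mult_nonneg_nonneg Cm_nonneg) auto
  also have "\<dots> = Cm * CL * (\<bar>1 - \<xi>\<^sup>2\<bar> powr p * (1 + norm z) powr (- r) + (1 + norm z) powr (2 * p - r))"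
  proof -
    have "(1 + norm z) powr (2 * p - r) = (1 + norm z) powr (2 * p) * (1 + norm z) powr (- r)"
      by (simp add: powr_add[symmetric])
    then show ?thesis by (simp add: algebra_simps)
  qed
  also have "\<dots> \<le> Cm * CL * (\<bar>1 - \<xi>\<^sup>2\<bar> powr p * ((1 + 2 powr (- r)) * (1 + \<bar>\<xi>\<bar>) powr (- r)) + (1 + 2 powr (2 * p - r)) * (1 + \<bar>\<xi>\<bar>) powr (2 * p - r))"
    by (intro mult_left_mono add_mono pow mult_nonneg_nonneg Cm_nonneg CL_nonneg) auto
  finally show ?thesis unfolding z_def by (simp add: algebra_simps)
qed

private lemma one_minus_square_slit: "Im z < 0 \<Longrightarrow> 1 - z\<^sup>2 \<notin> \<real>\<^sub>\<le>\<^sub>0"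
  by (auto simp: complex_nonpos_Reals_iff Re_power2 Im_power2) (smt (verit) zero_le_power2 zero_power2)

private lemma f_holomorphic: "f holomorphic_on {z. Im z < 0}"
  unfolding f_def
proof (intro holomorphic_intros)
  show "L holomorphic_on {z. Im z < 0}" unfolding L_def by (intro holomorphic_intros)
qed (auto simp: one_minus_square_slit L_slit)

private lemma f_shift_continuous: "Im w < 0 \<Longrightarrow> continuous_on UNIV (\<lambda>\<xi>. f (complex_of_real \<xi> + w))"
  by (rule continuous_on_compose2[OF holomorphic_on_imp_continuous_on[OF f_holomorphic]])
     (auto intro!: continuous_intros)

private definition "J w = integral UNIV (\<lambda>\<xi>. f (complex_of_real \<xi> + w))" for w

private lemma e_neg: "2 * p - r < 0" using pr by simp

private lemma J_dom:
  assumes w: "w \<in> {z. Im z < 0}"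
  shows "\<exists>\<rho>>0. \<exists>g. ball w \<rho> \<subseteq> {z. Im z < 0} \<and> g integrable_on UNIV \<and>
                 (\<forall>v\<in>ball w \<rho>. \<forall>\<xi>\<in>UNIV. norm (f (complex_of_real \<xi> + v)) \<le> g \<xi>)"
proof -
  define \<eta> where "\<eta> = min 1 (- Im w / 2)"
  have \<eta>: "\<eta> > 0" "\<eta> \<le> 1" "Im w \<le> - 2 * \<eta>" using w by (auto simp: \<eta>_def)
  define C where "C = Cm * (((\<eta> / 3)\<^sup>2) powr p + 1) * CL"
  have C: "C \<ge> 0" unfolding C_def by (intro mult_nonneg_nonneg Cm_nonneg CL_nonneg) auto
  define B where "B = 2 + norm w"
  have B: "B > 0" by (simp add: B_def add_pos_nonneg)
  have Imv: "Im v \<le> - \<eta>" if "v \<in> ball w \<eta>" for v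
    using that abs_Im_le_cmod[of "w - v"] \<eta> by (auto simp: dist_norm)
  have nv: "norm v \<le> 1 + norm w" if "v \<in> ball w \<eta>" for v
    using that norm_triangle_ineq2[of v w] \<eta> by (auto simp: dist_norm norm_minus_commute)
  let ?g = "\<lambda>\<xi>. C * (B powr (- (2 * p - r)) * (1 + \<bar>\<xi>\<bar>) powr (2 * p - r))"
  have "norm (f (complex_of_real \<xi> + v)) \<le> ?g \<xi>" if v: "v \<in> ball w \<eta>" for \<xi> v
  proof -
    let ?z = "complex_of_real \<xi> + v"
    have "norm (f ?z) \<le> C * (1 + norm ?z) powr (2 * p - r)"
      using f_bound_below[OF \<eta>(1,2), of ?z] Imv[OF v] by (simp add: C_def)
    also have "(1 + norm ?z) powr (2 * p - r) \<le> ((1 + \<bar>\<xi>\<bar>) / B) powr (2 * p - r)"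
    proof (rule powr_mono2')
      have "\<bar>\<xi>\<bar> \<le> norm ?z + norm v" using norm_triangle_ineq4[of ?z v] by simp
      then have "1 + \<bar>\<xi>\<bar> \<le> norm ?z + B" using nv[OF v] by (simp add: B_def)
      also have "\<dots> \<le> (1 + norm ?z) * B" unfolding B_def by (simp add: algebra_simps)
      finally show "(1 + \<bar>\<xi>\<bar>) / B \<le> 1 + norm ?z" using B by (simp add: field_simps)
    qed (use e_neg B in auto)
    also have "((1 + \<bar>\<xi>\<bar>) / B) powr (2 * p - r) = B powr (- (2 * p - r)) * (1 + \<bar>\<xi>\<bar>) powr (2 * p - r)"
      unfolding powr_minus using B by (simp add: powr_divide field_simps)
    finally show ?thesis using C by (simp add: mult_left_mono)
  qed
  moreover have "?g integrable_on UNIV"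
    using line_weight_integrable(2)[OF pr] by (intro integrable_on_mult_right) (simp add: absolutely_integrable_on_def)
  ultimately show ?thesis using \<eta> Imv by (intro exI[of _ \<eta>] conjI exI[of _ ?g]) force+
qed

private lemma
  assumes w: "Im w < 0"
  shows J_integrable: "(\<lambda>\<xi>. f (complex_of_real \<xi> + w)) absolutely_integrable_on UNIV"
    and J_deriv: "\<exists>d. (J has_field_derivative d) (at w)"
proof -
  have h: "(\<lambda>w. f (complex_of_real t + w)) holomorphic_on {z. Im z < 0}" for t
    by (rule holomorphic_on_compose_gen[OF _ f_holomorphic, unfolded o_def, where f = "\<lambda>w. complex_of_real t + w"])
       (auto intro!: holomorphic_intros)
  note * = holomorphic_integral[where f = "\<lambda>w \<xi>. f (complex_of_real \<xi> + w)" and A = UNIV and S = "{z. Im z < 0}", OF _ open_halfspace_Im_lt f_shift_continuous h J_dom]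
  show "(\<lambda>\<xi>. f (complex_of_real \<xi> + w)) absolutely_integrable_on UNIV" by (rule *(1)) (use w in auto)
  show "\<exists>d. (J has_field_derivative d) (at w)" unfolding J_def by (rule exI, rule *(3)) (use w in auto)
qed

text \<open>By translation invariance \<open>J (w + s) = J w\<close> for real \<open>s\<close>, so the derivative of \<open>J\<close> vanishes.\<close>

private lemma J_deriv_0:
  assumes w: "Im w < 0"
  shows "(J has_field_derivative 0) (at w)"
proof -
  obtain d where d: "(J has_field_derivative d) (at w)" using J_deriv[OF w] by blast
  have inv: "J (w + of_real s) = J w" for s
    using integral_shift_UNIV[OF J_integrable[OF w], of s] by (simp add: J_def add_ac)
  have "((\<lambda>s. J (w + of_real s)) has_vector_derivative d) (at 0)"
  proof (rule has_vector_derivative_real_field[where f = "\<lambda>z. J (w + z)"])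
    have "((\<lambda>z. J (w + z)) has_field_derivative d * 1) (at (of_real 0))"
      by (rule DERIV_chain2) (use d in \<open>auto intro!: derivative_eq_intros\<close>)
    then show "((\<lambda>z. J (w + z)) has_field_derivative d) (at (of_real 0))" by simp
  qed
  then have "((\<lambda>s::real. J w) has_vector_derivative d) (at 0)" unfolding inv .
  then have "d = 0" using has_vector_derivative_const vector_derivative_unique_at by blast
  with d show ?thesis by simp
qed

text \<open>\<open>J\<close> is constant on the half plane. As the line moves down, the integrand
  tends to 0 under a fixed majorant, so the constant is 0.\<close>

private lemma J_0: assumes w: "Im w < 0" shows "J w = 0"
proof -
  have "\<exists>c. \<forall>w\<in>{z. Im z < 0}. J w = c"
    by (rule has_field_derivative_zero_constant[OF convex_halfspace_Im_lt])
       (auto intro: has_field_derivative_at_within J_deriv_0)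
  then obtain c where c: "\<And>w. Im w < 0 \<Longrightarrow> J w = c" by auto
  define C where "C = Cm * (((1 / 3)\<^sup>2) powr p + 1) * CL"
  have C: "C \<ge> 0" unfolding C_def by (intro mult_nonneg_nonneg Cm_nonneg CL_nonneg) auto
  let ?w = "\<lambda>n. - \<i> * of_real (real (Suc n))"
  have fb: "norm (f (complex_of_real \<xi> + ?w n)) \<le> C * (1 + norm (complex_of_real \<xi> + ?w n)) powr (2 * p - r)" for \<xi> n
    using f_bound_below[of 1 "complex_of_real \<xi> + ?w n"] by (simp add: C_def)
  have "(\<lambda>n. integral UNIV (\<lambda>\<xi>. f (complex_of_real \<xi> + ?w n))) \<longlonglongrightarrow> integral UNIV (\<lambda>\<xi>::real. 0)"
  proof (rule dominated_convergence(2)[where h = "\<lambda>\<xi>. C * (1 + \<bar>\<xi>\<bar>) powr (2 * p - r)"])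
    show "(\<lambda>\<xi>. f (complex_of_real \<xi> + ?w n)) integrable_on UNIV" for n
      using J_integrable[of "?w n"] by (simp add: absolutely_integrable_on_def)
    show "(\<lambda>\<xi>. C * (1 + \<bar>\<xi>\<bar>) powr (2 * p - r)) integrable_on UNIV"
      using line_weight_integrable(2)[OF pr] by (intro integrable_on_mult_right) (simp add: absolutely_integrable_on_def)
    show "norm (f (complex_of_real \<xi> + ?w n)) \<le> C * (1 + \<bar>\<xi>\<bar>) powr (2 * p - r)" for \<xi> n
    proof -
      have "\<bar>\<xi>\<bar> \<le> norm (complex_of_real \<xi> + ?w n)" using abs_Re_le_cmod[of "complex_of_real \<xi> + ?w n"] by simp
      then have "(1 + norm (complex_of_real \<xi> + ?w n)) powr (2 * p - r) \<le> (1 + \<bar>\<xi>\<bar>) powr (2 * p - r)"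
        using e_neg by (intro powr_mono2') auto
      then show ?thesis using fb[of \<xi> n] C by (meson mult_left_mono order_trans)
    qed
    show "(\<lambda>n. f (complex_of_real \<xi> + ?w n)) \<longlonglongrightarrow> 0" for \<xi>
    proof (rule Lim_null_comparison)
      show "\<forall>\<^sub>F n in sequentially. norm (f (complex_of_real \<xi> + ?w n)) \<le> C * real (Suc n) powr (2 * p - r)"
      proof (intro always_eventually allI)
        fix n
        have "real (Suc n) \<le> norm (complex_of_real \<xi> + ?w n)" using abs_Im_le_cmod[of "complex_of_real \<xi> + ?w n"] by simp
        then have "(1 + norm (complex_of_real \<xi> + ?w n)) powr (2 * p - r) \<le> real (Suc n) powr (2 * p - r)"
          using e_neg by (intro powr_mono2') auto
        then show "norm (f (complex_of_real \<xi> + ?w n)) \<le> C * real (Suc n) powr (2 * p - r)"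
          using fb[of \<xi> n] C by (meson mult_left_mono order_trans)
      qed
      have "(\<lambda>n. real (Suc n) powr (2 * p - r)) \<longlonglongrightarrow> 0"
        using e_neg by (intro tendsto_neg_powr filterlim_compose[OF filterlim_real_sequentially filterlim_Suc]) auto
      then show "(\<lambda>n. C * real (Suc n) powr (2 * p - r)) \<longlonglongrightarrow> 0" using tendsto_mult_right_zero by blast
    qed
  qed
  then have "(\<lambda>n. J (?w n)) \<longlonglongrightarrow> 0" by (simp add: J_def)
  moreover have "J (?w n) = c" for n by (rule c) simp
  ultimately have "c = 0" by (simp add: LIMSEQ_const_iff)
  with c[OF w] show ?thesis by simp
qed

text \<open>As z approaches \<xi> from below, (1 - z^2)^(m - 1) tends to \<open>branch \<xi>\<close>
  times |1 - \<xi>^2|^(m - 1): the base reaches the negative axis from above if \<xi> > 1 and from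
  below if \<xi> < -1. At the points 1 and -1 themselves \<open>f0\<close> is 0 by
  convention.\<close>

private definition "branch \<xi> = (if \<bar>\<xi>\<bar> < 1 then 1 else exp (of_real (sgn \<xi>) * \<i> * of_real pi * (m - 1)))" for \<xi> :: real
private definition "f0 \<xi> = (if \<xi> = 1 \<or> \<xi> = -1 then 0 else branch \<xi> * of_real \<bar>1 - \<xi>\<^sup>2\<bar> powr (m - 1) * L (of_real \<xi>) powr (- lam))" for \<xi> :: real

private lemma f_limit:
  assumes \<xi>: "\<xi> \<noteq> 1" "\<xi> \<noteq> -1"
  shows "(\<lambda>n. f (of_real \<xi> - \<i> * of_real (1 / real (Suc n)))) \<longlonglongrightarrow> f0 \<xi>"
proof -
  let ?z = "\<lambda>n. complex_of_real \<xi> - \<i> * of_real (1 / real (Suc n))"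
  have "(\<lambda>n. ?z n) \<longlonglongrightarrow> of_real \<xi> - \<i> * of_real 0"
    by (intro tendsto_intros LIMSEQ_Suc[OF lim_1_over_n])
  then have z: "?z \<longlonglongrightarrow> of_real \<xi>" by simp
  have Lz: "(\<lambda>n. L (?z n) powr (- lam)) \<longlonglongrightarrow> L (of_real \<xi>) powr (- lam)"
  proof (rule tendsto_powr_complex)
    show "L (of_real \<xi>) \<notin> \<real>\<^sub>\<le>\<^sub>0" by (rule L_slit) simp
    show "(\<lambda>n. L (?z n)) \<longlonglongrightarrow> L (of_real \<xi>)" unfolding L_def by (intro tendsto_intros z)
  qed auto
  have "(\<lambda>n. (1 - (?z n)\<^sup>2) powr (m - 1)) \<longlonglongrightarrow> branch \<xi> * of_real \<bar>1 - \<xi>\<^sup>2\<bar> powr (m - 1)"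
  proof (cases "\<bar>\<xi>\<bar> < 1")
    case True
    then have pos: "1 - \<xi>\<^sup>2 > 0" by (simp add: abs_square_less_1)
    have "(\<lambda>n. (1 - (?z n)\<^sup>2) powr (m - 1)) \<longlonglongrightarrow> (1 - (of_real \<xi>)\<^sup>2) powr (m - 1)"
    proof (rule tendsto_powr_complex)
      have "1 - (complex_of_real \<xi>)\<^sup>2 = of_real (1 - \<xi>\<^sup>2)" by simp
      then show "1 - (complex_of_real \<xi>)\<^sup>2 \<notin> \<real>\<^sub>\<le>\<^sub>0" using pos by (simp only: complex_nonpos_Reals_iff) simp
    qed (intro tendsto_intros z)+
    then show ?thesis using True pos by (simp add: branch_def)
  next
    case False
    then have gt: "\<xi>\<^sup>2 - 1 > 0" using \<xi> by (metis abs_square_less_1 diff_gt_0_iff_gt linorder_neqE_linordered_idom power2_eq_1_iff)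
    define s where "s = sgn \<xi>"
    have s: "s = 1 \<or> s = -1" "s * \<xi> > 0" using False by (auto simp: s_def sgn_if)
    have e: "(1 - (?z n)\<^sup>2) powr (m - 1) = exp (of_real s * \<i> * of_real pi * (m - 1)) * ((?z n)\<^sup>2 - 1) powr (m - 1)" for n
    proof -
      \<comment> \<open>\<open>minus_one_powr\<close> is applied to 2 - z^2, because (2 - z^2) - 1 =
        1 - z^2 and 1 - (2 - z^2) = z^2 - 1.\<close>
      have "Im (2 - (?z n)\<^sup>2) = 2 * \<xi> / real (Suc n)" by (simp add: Im_power2 del: of_nat_Suc)
      then have "s * Im (2 - (?z n)\<^sup>2) > 0" using s(2) by (simp del: of_nat_Suc) (simp add: mult.commute mult.left_commute)
      from minus_one_powr[OF s(1) this, of "m - 1"] show ?thesis by simp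
    qed
    have "(\<lambda>n. exp (of_real s * \<i> * of_real pi * (m - 1)) * ((?z n)\<^sup>2 - 1) powr (m - 1)) \<longlonglongrightarrow>
        exp (of_real s * \<i> * of_real pi * (m - 1)) * ((of_real \<xi>)\<^sup>2 - 1) powr (m - 1)"
    proof (intro tendsto_mult tendsto_const tendsto_powr_complex)
      have "(complex_of_real \<xi>)\<^sup>2 - 1 = of_real (\<xi>\<^sup>2 - 1)" by simp
      then show "(complex_of_real \<xi>)\<^sup>2 - 1 \<notin> \<real>\<^sub>\<le>\<^sub>0" using gt by (simp only: complex_nonpos_Reals_iff) simp
    qed (intro tendsto_intros z)+
    then show ?thesis unfolding e using False gt by (simp add: branch_def s_def)
  qed
  from tendsto_mult[OF this Lz] show ?thesis using \<xi> by (simp add: f_def f0_def)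
qed

text \<open>The lines Im z = -1 / (n + 1) approach the real line. The majorant of
  \<open>f_bound_near\<close> does not depend on n, and the exceptional points 1 and -1 form a null
  set.\<close>

private lemma f0_integral: "f0 absolutely_integrable_on UNIV" "integral UNIV f0 = 0"
proof -
  define D where "D \<xi> = Cm * CL * (1 + 2 powr (- r)) * (\<bar>1 - \<xi>\<^sup>2\<bar> powr p * (1 + \<bar>\<xi>\<bar>) powr (- r)) +
    Cm * CL * (1 + 2 powr (2 * p - r)) * (1 + \<bar>\<xi>\<bar>) powr (2 * p - r)" for \<xi> :: real
  have D0: "D \<xi> \<ge> 0" for \<xi> unfolding D_def
    by (intro add_nonneg_nonneg mult_nonneg_nonneg Cm_nonneg CL_nonneg) auto
  have Dint: "D integrable_on UNIV" unfolding D_def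
    using line_weight_integrable[OF pr]
    by (intro integrable_add integrable_on_mult_right) (simp_all add: absolutely_integrable_on_def)
  let ?w = "\<lambda>n. - (\<i> * of_real (1 / real (Suc n)))"
  define g where "g n \<xi> = (if \<xi> \<in> {1, -1} then 0 else f (complex_of_real \<xi> + ?w n))" for n \<xi>
  have Imw: "Im (?w n) < 0" for n by (simp del: of_nat_Suc)
  have gi: "g n integrable_on UNIV" for n
  proof (rule integrable_spike)
    show "(\<lambda>\<xi>. f (complex_of_real \<xi> + ?w n)) integrable_on UNIV"
      using J_integrable[OF Imw, of n] by (simp add: absolutely_integrable_on_def)
    show "negligible {1, -1 :: real}" by simp
  qed (simp add: g_def)
  have g0: "integral UNIV (g n) = 0" for n
  proof -
    have "integral UNIV (g n) = integral UNIV (\<lambda>\<xi>. f (complex_of_real \<xi> + ?w n))"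
      by (rule integral_spike[of "{1, -1}"]) (auto simp: g_def)
    then show ?thesis using J_0[OF Imw, of n] by (simp only: J_def)
  qed
  have gb: "norm (g n \<xi>) \<le> D \<xi>" for n \<xi>
    using f_bound_near[of "1 / real (Suc n)" \<xi>] D0[of \<xi>] by (simp add: g_def D_def)
  have gl: "(\<lambda>n. g n \<xi>) \<longlonglongrightarrow> f0 \<xi>" for \<xi>
    using f_limit[of \<xi>] by (cases "\<xi> = 1 \<or> \<xi> = -1") (auto simp: g_def f0_def)
  have i: "f0 integrable_on UNIV" by (rule dominated_convergence(1)[OF gi Dint gb gl])
  have "(\<lambda>n. integral UNIV (g n)) \<longlonglongrightarrow> integral UNIV f0" by (rule dominated_convergence(2)[OF gi Dint gb gl])
  then show "integral UNIV f0 = 0" unfolding g0 by (simp add: LIMSEQ_const_iff)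
  have "norm (f0 \<xi>) \<le> D \<xi>" for \<xi>
    by (rule Lim_norm_ubound[OF _ gl]) (auto intro!: always_eventually gb)
  then show "f0 absolutely_integrable_on UNIV"
    by (intro absolutely_integrable_integrable_bound[OF _ i Dint])
qed

lemma hypergeometric_connection:
  "exp (\<i> * of_real pi * (m - 1)) * Gamma (lam - 2 * m + 1) *
     (exp (- (\<i> * of_real \<theta> * lam)) * hyp2F1_reg lam m (lam - m + 1) (exp (- (2 * \<i> * of_real \<theta>)))) +
   exp (- (\<i> * of_real pi * (m - 1))) * Gamma (lam - 2 * m + 1) *
     (exp (\<i> * of_real \<theta> * lam) * hyp2F1_reg lam m (lam - m + 1) (exp (2 * \<i> * of_real \<theta>))) +
   Gamma m * (exp (- (\<i> * of_real \<theta> * lam)) * hyp2F1_reg lam m (2 * m) (1 - exp (- (2 * \<i> * of_real \<theta>)))) = 0"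
proof -
  have th: "\<bar>\<theta>\<bar> < pi / 2" "\<theta> \<noteq> 0" "\<bar>- \<theta>\<bar> < pi / 2" "- \<theta> \<noteq> 0" using \<theta> by auto
  have f0m: "(\<lambda>t. f0 (- t)) absolutely_integrable_on {1<..}" "integral {1<..} (\<lambda>t. f0 (- t)) = integral {..<-1} f0"
    using reflect_substitution[of f0] f0_integral(1) by (auto simp: absolutely_integrable_on_line_iff(1))
  have 1: "integral {1<..} f0 = exp (\<i> * of_real pi * (m - 1)) *
     (2 powr (2 * m - 1) * Gamma m * Gamma (lam - 2 * m + 1) *
     (exp (- (\<i> * of_real \<theta> * lam)) * hyp2F1_reg lam m (lam - m + 1) (exp (- (2 * \<i> * of_real \<theta>)))))"
    unfolding laplace_integral_outer[OF m q th(1,2), symmetric] integral_mult_right[symmetric]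
  proof (rule integral_cong)
    fix \<xi> :: real assume "\<xi> \<in> {1<..}"
    then have "\<xi> > 1" "\<bar>1 - \<xi>\<^sup>2\<bar> = \<xi>\<^sup>2 - 1" by (auto simp: abs_if power2_eq_square) (smt (verit) mult_less_cancel_left2)
    then show "f0 \<xi> = exp (\<i> * of_real pi * (m - 1)) * (of_real (\<xi>\<^sup>2 - 1) powr (m - 1) * (of_real (cos \<theta>) + \<i> * of_real (sin \<theta>) * of_real \<xi>) powr - lam)"
      by (simp add: f0_def branch_def L_def)
  qed
  \<comment> \<open>Reflection turns the part over \<xi> < -1 into an outer integral with -
    \<theta>, hence the exponentials with opposite sign.\<close>
  have 2: "integral {1<..} (\<lambda>\<xi>. f0 (- \<xi>)) = exp (- (\<i> * of_real pi * (m - 1))) *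
     (2 powr (2 * m - 1) * Gamma m * Gamma (lam - 2 * m + 1) *
     (exp (- (\<i> * of_real (- \<theta>) * lam)) * hyp2F1_reg lam m (lam - m + 1) (exp (- (2 * \<i> * of_real (- \<theta>))))))"
    unfolding laplace_integral_outer[OF m q th(3,4), symmetric] integral_mult_right[symmetric]
  proof (rule integral_cong)
    fix \<xi> :: real assume "\<xi> \<in> {1<..}"
    then have "\<xi> > 1" "\<bar>1 - \<xi>\<^sup>2\<bar> = \<xi>\<^sup>2 - 1" by (auto simp: abs_if power2_eq_square) (smt (verit) mult_less_cancel_left2)
    then show "f0 (- \<xi>) = exp (- (\<i> * of_real pi * (m - 1))) * (of_real (\<xi>\<^sup>2 - 1) powr (m - 1) * (of_real (cos (- \<theta>)) + \<i> * of_real (sin (- \<theta>)) * of_real \<xi>) powr - lam)"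
      by (simp add: f0_def branch_def L_def)
  qed
  have 3: "integral {-1<..<1} f0 = 2 powr (2 * m - 1) * (Gamma m)\<^sup>2 *
     (exp (- (\<i> * of_real \<theta> * lam)) * hyp2F1_reg lam m (2 * m) (1 - exp (- (2 * \<i> * of_real \<theta>))))"
    unfolding laplace_integral_inner[OF m th(1), symmetric]
  proof (rule integral_cong)
    fix \<xi> :: real assume "\<xi> \<in> {-1<..<1}"
    then have "\<bar>\<xi>\<bar> < 1" "\<xi> \<noteq> 1" "\<xi> \<noteq> -1" by auto
    moreover from this have "\<bar>1 - \<xi>\<^sup>2\<bar> = 1 - \<xi>\<^sup>2" by (simp add: abs_square_le_1)
    ultimately show "f0 \<xi> = of_real (1 - \<xi>\<^sup>2) powr (m - 1) * (of_real (cos \<theta>) + \<i> * of_real (sin \<theta>) * of_real \<xi>) powr - lam"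
      by (simp add: f0_def branch_def L_def)
  qed
  have "integral {..<-1} f0 + integral {-1<..<1} f0 + integral {1<..} f0 = 0"
    using absolutely_integrable_on_line_iff(2)[OF f0_integral(1)] f0_integral(2) by simp
  then have "(2 powr (2 * m - 1) * Gamma m) * (exp (\<i> * of_real pi * (m - 1)) * Gamma (lam - 2 * m + 1) *
     (exp (- (\<i> * of_real \<theta> * lam)) * hyp2F1_reg lam m (lam - m + 1) (exp (- (2 * \<i> * of_real \<theta>)))) +
   exp (- (\<i> * of_real pi * (m - 1))) * Gamma (lam - 2 * m + 1) *
     (exp (\<i> * of_real \<theta> * lam) * hyp2F1_reg lam m (lam - m + 1) (exp (2 * \<i> * of_real \<theta>))) +
   Gamma m * (exp (- (\<i> * of_real \<theta> * lam)) * hyp2F1_reg lam m (2 * m) (1 - exp (- (2 * \<i> * of_real \<theta>))))) = 0"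
    unfolding f0m(2)[symmetric] 1 2 3 by (simp add: algebra_simps power2_eq_square)
  moreover have "2 powr (2 * m - 1) * Gamma m \<noteq> 0"
    using Re_pos_notin_nonpos_Ints[OF m] by (simp add: Gamma_eq_zero_iff)
  ultimately show ?thesis by (simp only: mult_eq_0_iff) simp
qed

end

section \<open>The sum of squares\<close>

text \<open>For x = cos \<theta> in (0, 1) this is \<open>hypergeometric_connection\<close>:
  \<open>quadratic_transformation_cosh\<close> at y = 1 - e^(-2 i \<theta>) rewrites its third term,
  and Legendre's duplication formula for Gamma (2 m) gives the constant. The identity theorem
  extends the result to the whole domain.\<close>

lemma ferrers_connection:
  fixes m lam :: complex
  assumes m: "Re m > 0" and q: "Re (lam - 2 * m + 1) > 0" and x: "x \<in> ferrers_domain"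
  shows "exp (\<i> * of_real pi * (m - 1)) * Gamma (lam - 2 * m + 1) * ferrers_branch 1 lam m x +
     exp (- (\<i> * of_real pi * (m - 1))) * Gamma (lam - 2 * m + 1) * ferrers_branch (-1) lam m x =
     - (2 powr (1 - 2 * m) * of_real (sqrt pi) * hyp2F1_reg lam (2 * m - lam) (m + 1 / 2) ((1 - x) / 2))"
proof (rule holomorphic_eq_if_eq_on_real_interval[OF _ _ open_ferrers_domain connected_ferrers_domain _ _ _ x])
  show "(0::real) < 1" by simp
  show "complex_of_real ` {0<..<1} \<subseteq> ferrers_domain" by (auto simp: ferrers_domain_iff)
  show "(\<lambda>x. exp (\<i> * of_real pi * (m - 1)) * Gamma (lam - 2 * m + 1) * ferrers_branch 1 lam m x +
     exp (- (\<i> * of_real pi * (m - 1))) * Gamma (lam - 2 * m + 1) * ferrers_branch (-1) lam m x) holomorphic_on ferrers_domain"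
    by (intro holomorphic_intros ferrers_branch_holomorphic) auto
  have "(\<lambda>x. hyp2F1_reg lam (2 * m - lam) (m + 1 / 2) ((1 - x) / 2)) holomorphic_on ferrers_domain"
    by (rule holomorphic_on_compose_gen[OF _ hyp2F1_reg_holomorphic, unfolded o_def, where f = "\<lambda>x. (1 - x) / 2"])
       (auto intro!: holomorphic_intros ferrers_domain_slits)
  then show "(\<lambda>x. - (2 powr (1 - 2 * m) * of_real (sqrt pi) * hyp2F1_reg lam (2 * m - lam) (m + 1 / 2) ((1 - x) / 2))) holomorphic_on ferrers_domain"
    by (intro holomorphic_intros)
next
  fix t :: real assume t: "0 < t" "t < 1"
  define \<theta> where "\<theta> = arccos t"
  have ct: "cos \<theta> = t" unfolding \<theta>_def using t by (intro cos_arccos) auto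
  have \<theta>: "0 < \<theta>" "\<theta> < pi / 2"
    using t arccos_less_arccos[of t 1] arccos_less_arccos[of 0 t] by (auto simp: \<theta>_def)
  have A: "Arccos (of_real t) = of_real \<theta>" unfolding \<theta>_def using t by (simp add: of_real_arccos)
  define X where "X = exp (- (2 * \<i> * complex_of_real \<theta>))"
  define h where "h = exp (- (\<i> * complex_of_real \<theta>))"
  have X: "X \<notin> \<real>\<^sub>\<le>\<^sub>0" unfolding X_def by (rule exp_minus_2i_slits) (use \<theta> in auto)
  have y: "1 - X \<in> cut_plane" using X by (auto simp: cut_plane_iff complex_nonpos_Reals_iff)
  have hX: "h\<^sup>2 = X" by (simp add: h_def X_def exp_double[symmetric] mult.assoc)
  have Reh: "Re h > 0" using cos_gt_zero_pi[of \<theta>] \<theta> by (simp add: h_def Re_exp)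
  have cs: "csqrt X = h" unfolding hX[symmetric] using Reh by (intro csqrt_square) auto
  have arg: "(2 - 1 / h - h) / 4 = (1 - of_real t) / 2"
  proof -
    have "1 / h = exp (\<i> * complex_of_real \<theta>)" by (simp add: h_def exp_minus inverse_eq_divide)
    then have "1 / h + h = 2 * cos (complex_of_real \<theta>)" by (simp add: h_def cos_exp_eq)
    also have "\<dots> = 2 * of_real t" by (simp only: cos_of_real ct)
    finally have "1 / h + h = 2 * complex_of_real t" .
    then have "(2 - (1 / h + h)) / 4 = (1 - of_real t) / 2" by (simp only:) simp
    then show ?thesis by (simp add: diff_diff_eq)
  qed
  have Xp: "X powr (- lam / 2) = exp (\<i> * of_real \<theta> * lam)"
  proof -
    have "Ln X = - (2 * \<i> * complex_of_real \<theta>)" unfolding X_def by (rule Ln_exp) (use \<theta> in auto)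
    then show ?thesis using X by (auto simp: powr_def mult_ac)
  qed
  have m2: "2 * m \<notin> \<int>\<^sub>\<le>\<^sub>0" by (rule Re_pos_notin_nonpos_Ints) (use m in simp)
  have mh: "m \<notin> \<int>\<^sub>\<le>\<^sub>0" "m + 1 / 2 \<notin> \<int>\<^sub>\<le>\<^sub>0" using m by (auto intro!: Re_pos_notin_nonpos_Ints)
  have "X powr (- lam / 2) * hyp2F1_reg lam (2 * m - lam) (m + 1 / 2) ((1 - of_real t) / 2) =
         rGamma (m + 1 / 2) * Gamma (2 * m) * hyp2F1_reg lam m (2 * m) (1 - X)"
    using quadratic_transformation_cosh[OF m2 y, of lam] by (simp add: cs arg)
  then have "hyp2F1_reg lam (2 * m - lam) (m + 1 / 2) ((1 - of_real t) / 2) =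
     rGamma (m + 1 / 2) * Gamma (2 * m) * (exp (- (\<i> * of_real \<theta> * lam)) * hyp2F1_reg lam m (2 * m) (1 - X))"
    unfolding Xp by (simp add: exp_minus field_simps)
  then have "2 powr (1 - 2 * m) * of_real (sqrt pi) * hyp2F1_reg lam (2 * m - lam) (m + 1 / 2) ((1 - of_real t) / 2) =
     (Gamma m * Gamma (m + 1 / 2)) * rGamma (m + 1 / 2) * (exp (- (\<i> * of_real \<theta> * lam)) * hyp2F1_reg lam m (2 * m) (1 - X))"
    unfolding Gamma_legendre_duplication[OF mh] using powr_of_real_eq_exp[of 2 "1 - 2 * m"] by (simp add: mult_ac)
  also have "\<dots> = Gamma m * (exp (- (\<i> * of_real \<theta> * lam)) * hyp2F1_reg lam m (2 * m) (1 - X))"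
    using mh by (simp add: rGamma_inverse_Gamma Gamma_eq_zero_iff)
  finally have e: "2 powr (1 - 2 * m) * of_real (sqrt pi) * hyp2F1_reg lam (2 * m - lam) (m + 1 / 2) ((1 - of_real t) / 2) = \<dots>" .
  have b: "ferrers_branch 1 lam m (of_real t) = exp (- (\<i> * of_real \<theta> * lam)) * hyp2F1_reg lam m (lam - m + 1) X"
    "ferrers_branch (-1) lam m (of_real t) = exp (\<i> * of_real \<theta> * lam) * hyp2F1_reg lam m (lam - m + 1) (exp (2 * \<i> * of_real \<theta>))"
    by (simp_all add: ferrers_branch_def A X_def mult_ac)
  show "exp (\<i> * of_real pi * (m - 1)) * Gamma (lam - 2 * m + 1) * ferrers_branch 1 lam m (of_real t) +
     exp (- (\<i> * of_real pi * (m - 1))) * Gamma (lam - 2 * m + 1) * ferrers_branch (-1) lam m (of_real t) =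
     - (2 powr (1 - 2 * m) * of_real (sqrt pi) * hyp2F1_reg lam (2 * m - lam) (m + 1 / 2) ((1 - of_real t) / 2))"
    unfolding e b using hypergeometric_connection[OF m q \<theta>] unfolding X_def by (simp add: eq_neg_iff_add_eq_0)
qed

text \<open>Up to a common factor Q is E B1 + B2 / E and (\<pi>/2) P is i (E B1 - B2 / E), with E =
  e^(i \<pi> \<mu>). So Q - i (\<pi>/2) P and Q + i (\<pi>/2) P are each a multiple of a single
  branch, and the sum of squares is their product.\<close>

lemma ferrers_sum_of_squares:
  assumes \<mu>: "Re \<mu> > - 1 / 2" and \<nu>\<mu>: "Re (\<nu> - \<mu>) > - 1" and x: "x \<in> ferrers_domain"
  shows "(ferrersQ \<nu> (- \<mu>) x)\<^sup>2 + of_real (pi\<^sup>2 / 4) * (ferrersP \<nu> (- \<mu>) x)\<^sup>2 =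
    of_real pi * (Gamma (\<nu> - \<mu> + 1))\<^sup>2 * (2 powr \<mu>)\<^sup>2 * (1 - x\<^sup>2) powr \<mu> *
    (ferrers_branch 1 (\<nu> + \<mu> + 1) (\<mu> + 1 / 2) x * ferrers_branch (-1) (\<nu> + \<mu> + 1) (\<mu> + 1 / 2) x)"
proof -
  define lam m where "lam = \<nu> + \<mu> + 1" "m = \<mu> + 1 / 2"
  have m: "Re m > 0" and q: "Re (lam - 2 * m + 1) > 0" using \<mu> \<nu>\<mu> by (auto simp: lam_m_def)
  have qe: "lam - 2 * m + 1 = \<nu> - \<mu> + 1" by (simp add: lam_m_def)
  have c: "\<nu> + 3 / 2 \<notin> \<int>\<^sub>\<le>\<^sub>0" "1 + \<mu> \<notin> \<int>\<^sub>\<le>\<^sub>0"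
    using \<mu> \<nu>\<mu> by (auto intro!: Re_pos_notin_nonpos_Ints)
  define B1 B2 where "B1 = ferrers_branch 1 lam m x" "B2 = ferrers_branch (-1) lam m x"
  define E where "E = exp (\<i> * of_real pi * \<mu>)"
  define W where "W = (1 - x) powr (\<mu> / 2) * (1 + x) powr (\<mu> / 2)"
  define G where "G = Gamma (\<nu> - \<mu> + 1)"
  define F where "F = hyp2F1_reg lam (2 * m - lam) (m + 1 / 2) ((1 - x) / 2)"
  have E0: "E \<noteq> 0" by (simp add: E_def)
  have W2: "W\<^sup>2 = (1 - x\<^sup>2) powr \<mu>"
  proof -
    have "(u powr (\<mu> / 2))\<^sup>2 = u powr \<mu>" for u :: complex
      unfolding power2_eq_square powr_add[symmetric] by simp
    then show ?thesis by (simp add: W_def power_mult_distrib one_minus_square_powr[OF x])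
  qed
  \<comment> \<open>m - 1 = \<mu> - 1/2 gives the factor - i; this is the source of the imaginary
    unit that P carries relative to Q.\<close>
  have em: "exp (\<i> * of_real pi * (m - 1)) = - \<i> * E" "exp (- (\<i> * of_real pi * (m - 1))) = \<i> * inverse E"
  proof -
    have "\<i> * of_real pi * (m - 1) = \<i> * of_real pi * \<mu> + - (\<i> * of_real pi / 2)" by (simp add: lam_m_def algebra_simps)
    moreover have "exp (- (\<i> * of_real pi / 2)) = - \<i>" by (simp add: complex_eq_iff Re_exp Im_exp)
    ultimately show 1: "exp (\<i> * of_real pi * (m - 1)) = - \<i> * E" by (simp only: exp_add E_def mult_ac)
    show "exp (- (\<i> * of_real pi * (m - 1))) = \<i> * inverse E" unfolding exp_minus 1 by simp
  qed
  have p2: "2 powr (1 - 2 * m) = inverse ((2 powr \<mu>)\<^sup>2 :: complex)"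
  proof -
    have "1 - 2 * m = - (\<mu> + \<mu>)" by (simp add: lam_m_def)
    then show ?thesis by (simp only: powr_minus powr_add power2_eq_square)
  qed
  have T0: "(2::complex) powr \<mu> \<noteq> 0" by simp
  have Q: "ferrersQ \<nu> (- \<mu>) x = of_real (sqrt pi) * G * 2 powr \<mu> / 2 * W * (E * B1 + inverse E * B2)"
    unfolding ferrersQ_eq[OF c(1) x] G_def W_def E_def B1_B2_def lam_m_def by (simp add: exp_minus)
  have sp: "complex_of_real (sqrt pi) * of_real (sqrt pi) = of_real pi" by (simp flip: of_real_mult)
  have s0: "complex_of_real (sqrt pi) \<noteq> 0" by simp
  have "- \<i> * E * G * B1 + \<i> * inverse E * G * B2 = - (inverse ((2 powr \<mu>)\<^sup>2) * of_real (sqrt pi) * F)"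
    using ferrers_connection[OF m q x] unfolding em qe p2 G_def B1_B2_def F_def .
  then have "\<i> * (2 powr \<mu>)\<^sup>2 * (E * G * B1 - inverse E * G * B2) = of_real (sqrt pi) * F"
    using T0 by (simp add: field_simps)
  then have pF: "of_real (sqrt pi) * (\<i> * (2 powr \<mu>)\<^sup>2 * G * (E * B1 - inverse E * B2)) = of_real pi * F"
    unfolding sp[symmetric] by (simp add: algebra_simps)
  have "ferrersP \<nu> (- \<mu>) x = inverse (2 powr \<mu>) * W * F"
    using ferrersP_eq[OF c(2) x, of \<nu>] by (simp add: W_def F_def lam_m_def powr_minus add.commute[of 1 \<mu>])
  then have "of_real pi * ferrersP \<nu> (- \<mu>) x = inverse (2 powr \<mu>) * W * (of_real pi * F)" by simp
  then have P: "of_real pi * ferrersP \<nu> (- \<mu>) x = of_real (sqrt pi) * (\<i> * 2 powr \<mu> * G * W * (E * B1 - inverse E * B2))"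
    unfolding pF[symmetric] using T0 by (simp add: power2_eq_square)
  have "4 * ((ferrersQ \<nu> (- \<mu>) x)\<^sup>2 + of_real (pi\<^sup>2 / 4) * (ferrersP \<nu> (- \<mu>) x)\<^sup>2) =
     (2 * ferrersQ \<nu> (- \<mu>) x)\<^sup>2 + (of_real pi * ferrersP \<nu> (- \<mu>) x)\<^sup>2"
    by (simp add: power_mult_distrib algebra_simps)
  also have "\<dots> = (of_real (sqrt pi))\<^sup>2 * (G * 2 powr \<mu> * W)\<^sup>2 * ((E * B1 + inverse E * B2)\<^sup>2 - (E * B1 - inverse E * B2)\<^sup>2)"
  proof -
    have "2 * ferrersQ \<nu> (- \<mu>) x = of_real (sqrt pi) * (G * 2 powr \<mu> * W) * (E * B1 + inverse E * B2)"
      unfolding Q by simp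
    moreover have "of_real pi * ferrersP \<nu> (- \<mu>) x = of_real (sqrt pi) * (G * 2 powr \<mu> * W) * (\<i> * (E * B1 - inverse E * B2))"
      unfolding P by (simp only: mult_ac)
    ultimately show ?thesis by (simp only: power_mult_distrib i_squared) (simp add: right_diff_distrib)
  qed
  also have "(E * B1 + inverse E * B2)\<^sup>2 - (E * B1 - inverse E * B2)\<^sup>2 = 4 * (B1 * B2)"
    using E0 by (simp add: power2_eq_square field_simps)
  finally have "4 * ((ferrersQ \<nu> (- \<mu>) x)\<^sup>2 + of_real (pi\<^sup>2 / 4) * (ferrersP \<nu> (- \<mu>) x)\<^sup>2) =
     4 * (of_real pi * G\<^sup>2 * (2 powr \<mu>)\<^sup>2 * W\<^sup>2 * (B1 * B2))"
    by (simp add: power_mult_distrib sp[folded power2_eq_square])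
  then have "(ferrersQ \<nu> (- \<mu>) x)\<^sup>2 + of_real (pi\<^sup>2 / 4) * (ferrersP \<nu> (- \<mu>) x)\<^sup>2 =
     of_real pi * G\<^sup>2 * (2 powr \<mu>)\<^sup>2 * W\<^sup>2 * (B1 * B2)"
    by (simp only: mult_cancel_left) simp
  then show ?thesis unfolding W2 G_def B1_B2_def lam_m_def .
qed

text \<open>The limit \<open>|x| \<rightarrow> 1\<close> of the product formula at \<open>y = cnj x\<close>.\<close>

lemma product_formula_unit_circle:
  fixes m lam :: complex
  assumes m: "Re m > 0" and q: "Re (lam - 2 * m + 1) > 0" and \<theta>: "0 < \<theta>" "\<theta> < pi / 2"
  defines "g \<equiv> \<lambda>t. beta_weight m (lam - 2 * m + 1) t *
      (of_real (2 - 2 * cos (2 * \<theta>) * t) powr (- lam) *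
       hyp2F1_reg (lam / 2) ((lam + 1) / 2) (lam - m + 1) (of_real (4 * (1 - t)\<^sup>2 / (2 - 2 * cos (2 * \<theta>) * t)\<^sup>2)))"
  shows "g absolutely_integrable_on {0<..<1}"
    and "integral {0<..<1} g = Gamma m * Gamma (lam - 2 * m + 1) *
       hyp2F1_reg lam m (lam - m + 1) (exp (- (2 * \<i> * of_real \<theta>))) * hyp2F1_reg lam m (lam - m + 1) (exp (2 * \<i> * of_real \<theta>))"
proof -
  define c where "c = lam - m + 1"
  have "Re c > 0" using m q by (simp add: c_def)
  then have c0: "c \<notin> \<int>\<^sub>\<le>\<^sub>0" by (rule Re_pos_notin_nonpos_Ints)
  let ?w = "beta_weight m (lam - 2 * m + 1)"
  define K where "K = hyp2F1_reg (lam / 2) ((lam + 1) / 2) c"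
  define \<Phi> where "\<Phi> = hyp2F1_reg lam m c"
  define C where "C = cos (2 * \<theta>)"
  define y where "y = exp (- (2 * \<i> * complex_of_real \<theta>))"
  \<comment> \<open>\<open>s\<close> = (Im y)^2 is the least value of |r - y|^2 = 1 + r^2 - 2 r C
    over real r; it bounds \<open>P\<close> from below uniformly in r and t.\<close>
  define s where "s = (sin (2 * \<theta>))\<^sup>2"
  have "sin (2 * \<theta>) > 0" using \<theta> by (intro sin_gt_zero) auto
  then have s: "s > 0" by (simp add: s_def)
  have sC: "s = 1 - C\<^sup>2" by (simp add: s_def C_def sin_squared_eq)
  have s1: "s \<le> 1" by (simp add: sC)
  have yC: "Re y = C" "norm y = 1" "cnj y = exp (2 * \<i> * of_real \<theta>)"
    by (simp_all add: y_def C_def Re_exp exp_cnj)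
  define P where "P r t = 1 + r\<^sup>2 - 2 * r * C * t" for r t :: real
  define u where "u r t = 4 * r\<^sup>2 * (1 - t)\<^sup>2 / (P r t)\<^sup>2" for r t :: real
  define f where "f r t = ?w t * (of_real (P r t) powr (- lam) * K (of_real (u r t)))" for r t
  have C1: "\<bar>C\<bar> \<le> 1" by (simp add: C_def)
  have dist: "1 + r\<^sup>2 - 2 * r * C \<ge> s" for r
  proof -
    have "1 + r\<^sup>2 - 2 * r * C = (r - C)\<^sup>2 + s" by (simp add: sC power2_eq_square algebra_simps)
    then show ?thesis by simp
  qed
  have P_eq: "P r t = (1 - t) * (1 + r\<^sup>2) + t * (1 + r\<^sup>2 - 2 * r * C)" for r t by (simp add: P_def algebra_simps)
  have P_low: "s \<le> P r t" if "0 \<le> t" "t \<le> 1" for r t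
  proof -
    have "(1 - t) * s \<le> (1 - t) * (1 + r\<^sup>2)" using that s1 by (intro mult_left_mono) (auto intro: order_trans[OF s1])
    moreover have "t * s \<le> t * (1 + r\<^sup>2 - 2 * r * C)" using that dist[of r] by (intro mult_left_mono) auto
    ultimately show ?thesis unfolding P_eq by (simp add: algebra_simps)
  qed
  have P_up: "P r t \<le> 4" if "0 \<le> t" "t \<le> 1" "0 \<le> r" "r \<le> 1" for r t
  proof -
    have "\<bar>r * C * t\<bar> \<le> 1 * 1 * 1" unfolding abs_mult using that C1 by (intro mult_mono) auto
    moreover have "r\<^sup>2 \<le> 1" using that by (simp add: power_le_one)
    ultimately show ?thesis unfolding P_def by (simp add: abs_le_iff)
  qed
  \<comment> \<open>1 - u is (P - 2 r (1 - t)) (P + 2 r (1 - t)) / P^2, and P - 2 r (1 - t) \<ge> t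
    s. So u can reach 1 only at t = 0, where the growth of \<open>K\<close> costs a power of
    t.\<close>
  have u_bound: "0 \<le> u r t" "u r t \<le> 1 - t * s / 4" if "0 \<le> t" "t \<le> 1" "0 \<le> r" "r \<le> 1" for r t
  proof -
    have Pp: "P r t > 0" using P_low[of t r] that s by linarith
    show "0 \<le> u r t" by (simp add: u_def)
    have "t * s \<le> P r t - 2 * r * (1 - t)"
    proof -
      have "P r t - 2 * r * (1 - t) = (1 - t) * (1 - r)\<^sup>2 + t * (1 + r\<^sup>2 - 2 * r * C)"
        unfolding P_eq by (simp add: power2_eq_square algebra_simps)
      moreover have "0 \<le> (1 - t) * (1 - r)\<^sup>2" using that by simp
      moreover have "t * s \<le> t * (1 + r\<^sup>2 - 2 * r * C)" using that dist[of r] by (intro mult_left_mono) auto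
      ultimately show ?thesis by linarith
    qed
    moreover have "P r t \<le> P r t + 2 * r * (1 - t)" using that by simp
    moreover have "0 \<le> t * s" using that s by simp
    ultimately have "(t * s) * P r t \<le> (P r t - 2 * r * (1 - t)) * (P r t + 2 * r * (1 - t))"
      using Pp by (intro mult_mono) linarith+
    also have "\<dots> = (P r t)\<^sup>2 * (1 - u r t)" using Pp by (simp add: u_def power2_eq_square field_simps)
    finally have "t * s * P r t \<le> P r t * (P r t * (1 - u r t))" by (simp add: power2_eq_square mult.assoc)
    then have ts: "t * s \<le> P r t * (1 - u r t)" using Pp by (simp add: mult.commute[of _ "P r t"])
    moreover have "0 \<le> t * s" using that s by simp
    ultimately have "0 \<le> 1 - u r t" using Pp by (metis zero_le_mult_iff order_trans not_le)
    then have "P r t * (1 - u r t) \<le> 4 * (1 - u r t)" using P_up[OF that] by (intro mult_right_mono)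
    with ts have "t * s \<le> 4 * (1 - u r t)" by (rule order_trans)
    then show "u r t \<le> 1 - t * s / 4" by simp
  qed
  have g_eq: "g = f 1"
    by (rule ext) (simp add: g_def f_def P_def u_def C_def K_def c_def)
  \<comment> \<open>\<open>\<eta>\<close> must be positive and at least Re m - 1/2 for
    \<open>hyp2F1_reg_growth\<close>, and below Re m so that t^(Re m - \<eta> - 1) remains
    integrable at 0.\<close>
  define \<eta> where "\<eta> = max (Re m - 1 / 2) (Re m / 2)"
  have \<eta>: "\<eta> > 0" "\<eta> < Re m" using m by (auto simp: \<eta>_def)
  have le: "Re (lam / 2 + (lam + 1) / 2 - c) \<le> \<eta>"
  proof -
    have "lam / 2 + (lam + 1) / 2 - c = m - 1 / 2" by (simp add: c_def field_simps)
    then show ?thesis by (simp add: \<eta>_def)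
  qed
  obtain CK where CK: "CK \<ge> 0" "\<And>u. 0 \<le> u \<Longrightarrow> u < 1 \<Longrightarrow> norm (K (of_real u)) \<le> CK * (1 - u) powr (- \<eta>)"
    using hyp2F1_reg_growth[OF c0 \<eta>(1) le] unfolding K_def by blast
  define CP where "CP = s powr (- Re lam) + 4 powr (- Re lam)"
  define D where "D t = CP * CK * (s / 4) powr (- \<eta>) * (t powr (Re m - \<eta> - 1) * (1 - t) powr (Re (lam - 2 * m + 1) - 1))" for t
  have bound: "norm (f r t) \<le> D t" if t: "t \<in> {0<..<1}" and r: "0 \<le> r" "r \<le> 1" for r t
  proof -
    have t': "0 \<le> t" "t \<le> 1" using t by auto
    have Pp: "P r t > 0" using P_low[OF t', of r] s by linarith
    have 1: "norm (complex_of_real (P r t) powr (- lam)) \<le> CP"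
    proof -
      have "norm (complex_of_real (P r t) powr (- lam)) = P r t powr (- Re lam)" using Pp by (simp add: norm_powr_real_powr)
      also have "\<dots> \<le> (s powr (- Re lam) + 4 powr (- Re lam)) * 1 powr (- Re lam)"
        using P_low[OF t', of r] P_up[OF t' r] s by (intro powr_le_if_between) auto
      finally show ?thesis by (simp add: CP_def)
    qed
    have ub: "0 \<le> u r t" "u r t \<le> 1 - t * s / 4" using u_bound[OF t' r] .
    have tp: "t * s / 4 > 0" using t s by simp
    have "norm (K (of_real (u r t))) \<le> CK * (1 - u r t) powr (- \<eta>)"
      using ub tp by (intro CK(2)) linarith+
    also have "(1 - u r t) powr (- \<eta>) \<le> (t * (s / 4)) powr (- \<eta>)" using ub tp \<eta> by (intro powr_mono2') auto
    also have "\<dots> = t powr (- \<eta>) * (s / 4) powr (- \<eta>)" by (rule powr_mult)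
    finally have 2: "norm (K (of_real (u r t))) \<le> CK * (t powr (- \<eta>) * (s / 4) powr (- \<eta>))"
      using CK(1) by (simp add: mult_left_mono)
    have "norm (f r t) \<le> (t powr (Re m - 1) * (1 - t) powr (Re (lam - 2 * m + 1) - 1)) * (CP * (CK * (t powr (- \<eta>) * (s / 4) powr (- \<eta>))))"
      unfolding f_def norm_mult using t norm_beta_weight[of t m "lam - 2 * m + 1"]
      by (intro mult_mono 1 2 mult_nonneg_nonneg) (auto simp: CP_def CK(1))
    also have "\<dots> = D t"
    proof -
      have "t powr (Re m - \<eta> - 1) = t powr (Re m - 1) * t powr (- \<eta>)" by (simp add: powr_add[symmetric] algebra_simps)
      then show ?thesis by (simp add: D_def mult_ac)
    qed
    finally show ?thesis .
  qed
  have Dint: "D integrable_on {0<..<1}"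
    unfolding D_def using has_integral_Beta_real[of "Re m - \<eta>" "Re (lam - 2 * m + 1)"] \<eta> q
    by (intro integrable_on_mult_right) (auto simp: has_integral_Icc_iff_Ioo)
  have fcont: "continuous_on {0<..<1} (f r)" if r: "0 \<le> r" "r \<le> 1" for r
  proof -
    have uc: "complex_of_real (u r t) \<in> cut_plane" and Pp: "P r t > 0" if "t \<in> {0<..<1}" for t
    proof -
      have "0 < t * s" using that s by simp
      then show "complex_of_real (u r t) \<in> cut_plane" using u_bound(2)[of t r] r that by (auto simp: cut_plane_iff)
      show "P r t > 0" using P_low[of t r] that s by auto
    qed
    have cP: "continuous_on {0<..<1} (P r)" unfolding P_def by (intro continuous_intros)
    have cu: "continuous_on {0<..<1} (u r)" unfolding u_def using Pp by (intro continuous_intros cP) force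
    have "continuous_on {0<..<1} (\<lambda>t. K (of_real (u r t)))"
      unfolding K_def
      by (rule continuous_on_compose2[OF holomorphic_on_imp_continuous_on[OF hyp2F1_reg_holomorphic]])
         (use uc cu in \<open>auto intro!: continuous_intros\<close>)
    moreover have "continuous_on {0<..<1} (\<lambda>t. complex_of_real (P r t) powr (- lam))"
      by (intro continuous_on_powr_slit continuous_intros cP) (auto simp: complex_nonpos_Reals_iff not_le Pp)
    ultimately show ?thesis unfolding f_def by (intro continuous_on_mult continuous_on_beta_weight)
  qed
  have fint: "f r absolutely_integrable_on {0<..<1}" if r: "0 \<le> r" "r \<le> 1" for r
    by (rule measurable_bounded_by_integrable_imp_absolutely_integrable[OF _ _ Dint])
       (use bound r fcont[OF r] in \<open>auto intro!: continuous_imp_measurable_on_sets_lebesgue\<close>)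
  show "g absolutely_integrable_on {0<..<1}" unfolding g_eq by (rule fint) auto
  \<comment> \<open>Radii strictly between 0 and 1 that tend to 1; the product formula is applied at
    x = R y and the conjugate of x.\<close>
  define R where "R n = real (Suc n) / real (Suc (Suc n))" for n
  have R: "0 < R n" "R n < 1" for n by (auto simp: R_def)
  have R1: "R \<longlonglongrightarrow> 1" unfolding R_def by real_asymp
  have int: "integral {0<..<1} (f (R n)) = Gamma m * Gamma (lam - 2 * m + 1) * \<Phi> (of_real (R n) * y) * \<Phi> (of_real (R n) * cnj y)" for n
  proof -
    let ?x = "of_real (R n) * y"
    have nx: "0 < cmod ?x" "cmod ?x < 1" using R[of n] by (simp_all add: norm_mult yC)
    have xx: "?x * cnj ?x = of_real ((R n)\<^sup>2)" "?x + cnj ?x = of_real (2 * R n * C)"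
    proof -
      show "?x * cnj ?x = of_real ((R n)\<^sup>2)" using complex_norm_square[of ?x] R[of n] by (simp add: norm_mult yC)
      show "?x + cnj ?x = of_real (2 * R n * C)" using complex_add_cnj[of ?x] by (simp add: yC mult.assoc)
    qed
    have e1: "1 + ?x * cnj ?x - (?x + cnj ?x) * of_real t = of_real (P (R n) t)" for t
      unfolding xx by (simp add: P_def)
    have e2: "4 * ?x * cnj ?x * (1 - of_real t)\<^sup>2 / (of_real (P (R n) t))\<^sup>2 = of_real (u (R n) t)" for t
      unfolding mult.assoc[of 4] xx by (simp add: u_def mult_ac)
    show ?thesis
      using product_formula[OF nx m q c_def cnj_in_product_domain(1)[OF nx]]
      unfolding e1 e2 f_def[abs_def] K_def \<Phi>_def by simp
  qed
  have "(\<lambda>n. integral {0<..<1} (f (R n))) \<longlonglongrightarrow> integral {0<..<1} (f 1)"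
  proof (rule dominated_convergence(2)[OF _ Dint])
    show "f (R n) integrable_on {0<..<1}" for n
      using fint[of "R n"] R[of n] by (simp add: absolutely_integrable_on_def less_imp_le)
    show "norm (f (R n) t) \<le> D t" if "t \<in> {0<..<1}" for n t using bound[OF that, of "R n"] R[of n] by (simp add: less_imp_le)
    show "(\<lambda>n. f (R n) t) \<longlonglongrightarrow> f 1 t" if t: "t \<in> {0<..<1}" for t
    proof -
      have Pp: "P 1 t > 0" using P_low[of t 1] t s by auto
      have lP: "(\<lambda>n. P (R n) t) \<longlonglongrightarrow> P 1 t" unfolding P_def by (intro tendsto_intros R1)
      have lu: "(\<lambda>n. u (R n) t) \<longlonglongrightarrow> u 1 t" unfolding u_def using Pp by (intro tendsto_intros R1 lP) auto
      have "0 < t * s" using t s by simp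
      then have uc: "complex_of_real (u 1 t) \<in> cut_plane" using u_bound(2)[of t 1] t by (auto simp: cut_plane_iff)
      have "isCont K (of_real (u 1 t))"
        using hyp2F1_reg_deriv(1)[OF uc] DERIV_isCont unfolding K_def by blast
      then have "(\<lambda>n. K (of_real (u (R n) t))) \<longlonglongrightarrow> K (of_real (u 1 t))"
        by (rule isCont_tendsto_compose) (intro tendsto_intros lu)
      moreover have "(\<lambda>n. complex_of_real (P (R n) t) powr (- lam)) \<longlonglongrightarrow> of_real (P 1 t) powr (- lam)"
        by (rule tendsto_powr_complex) (use Pp in \<open>auto intro!: tendsto_intros lP simp: complex_nonpos_Reals_iff\<close>)
      ultimately show ?thesis unfolding f_def by (intro tendsto_mult tendsto_const)
    qed
  qed
  moreover have "(\<lambda>n. integral {0<..<1} (f (R n))) \<longlonglongrightarrow> Gamma m * Gamma (lam - 2 * m + 1) * \<Phi> y * \<Phi> (cnj y)"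
  proof -
    have yc: "y \<in> cut_plane" "cnj y \<in> cut_plane"
      using exp_minus_2i_slits(2)[of \<theta>] exp_minus_2i_slits(2)[of "- \<theta>"] \<theta> unfolding yC(3) by (auto simp: y_def)
    have l: "(\<lambda>n. \<Phi> (of_real (R n) * z)) \<longlonglongrightarrow> \<Phi> z" if z: "z \<in> cut_plane" for z
    proof -
      have "isCont \<Phi> z" using hyp2F1_reg_deriv(1)[OF z] DERIV_isCont unfolding \<Phi>_def by blast
      moreover have "(\<lambda>n. of_real (R n) * z) \<longlonglongrightarrow> of_real 1 * z" by (intro tendsto_intros R1)
      ultimately show ?thesis by (intro isCont_tendsto_compose[of z \<Phi>]) simp_all
    qed
    show ?thesis unfolding int by (intro tendsto_intros l yc)
  qed
  ultimately have "integral {0<..<1} (f 1) = Gamma m * Gamma (lam - 2 * m + 1) * \<Phi> y * \<Phi> (cnj y)"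
    by (rule LIMSEQ_unique)
  then show "integral {0<..<1} g = Gamma m * Gamma (lam - 2 * m + 1) *
       hyp2F1_reg lam m (lam - m + 1) (exp (- (2 * \<i> * of_real \<theta>))) * hyp2F1_reg lam m (lam - m + 1) (exp (2 * \<i> * of_real \<theta>))"
    unfolding g_eq yC(3) by (simp add: \<Phi>_def c_def y_def)
qed

section \<open>The integral\<close>

text \<open>Put k = 2 sin^2 \<theta> and w = 1 + k t / (1 - t). Then w = P / (2 (1 - t)) and 1 - 2
  cos^2 \<theta> + w = k / (1 - t), so 1 / w^2 is the argument 4 (1 - t)^2 / P^2 of the product
  formula. The power of w + 1 in Q cancels against the explicit one in the integrand.\<close>

lemma legendre_integrand_real_point:
  fixes \<nu> \<mu> :: complex and \<theta> :: real
  assumes \<mu>: "Re \<mu> > - 1 / 2" and \<nu>\<mu>: "Re (\<nu> - \<mu>) > - 1" and \<theta>: "0 < \<theta>" "\<theta> < pi / 2"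
  shows "legendre_integrand \<nu> \<mu> (of_real (cos \<theta>)) absolutely_integrable_on {1<..}"
    and "integral {1<..} (legendre_integrand \<nu> \<mu> (of_real (cos \<theta>))) =
      of_real (sqrt pi) * exp (- \<i> * of_real pi * \<mu>) * (Gamma (\<nu> - \<mu> + 1))\<^sup>2 * Gamma (\<mu> + 1 / 2) *
      2 powr \<mu> * (2 * (1 - (of_real (cos \<theta>))\<^sup>2)) powr (2 * \<mu>) *
      (ferrers_branch 1 (\<nu> + \<mu> + 1) (\<mu> + 1 / 2) (of_real (cos \<theta>)) *
       ferrers_branch (-1) (\<nu> + \<mu> + 1) (\<mu> + 1 / 2) (of_real (cos \<theta>)))"
proof -
  define lam m where "lam = \<nu> + \<mu> + 1" "m = \<mu> + 1 / 2"
  have m: "Re m > 0" and q: "Re (lam - 2 * m + 1) > 0" using \<mu> \<nu>\<mu> by (auto simp: lam_m_def)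
  have qe: "lam - 2 * m + 1 = \<nu> - \<mu> + 1" and c: "lam - m + 1 = \<nu> + 3 / 2" by (simp_all add: lam_m_def)
  have c0: "\<nu> + 3 / 2 \<notin> \<int>\<^sub>\<le>\<^sub>0" using \<mu> \<nu>\<mu> by (auto intro!: Re_pos_notin_nonpos_Ints)
  define k where "k = 2 * (1 - (cos \<theta>)\<^sup>2)"
  have "sin \<theta> > 0" using \<theta> by (intro sin_gt_zero) auto
  then have k: "k > 0" by (simp add: k_def sin_squared_eq[symmetric])
  define A where "A = of_real (sqrt pi) * exp (- \<i> * of_real pi * \<mu>) * Gamma (\<nu> - \<mu> + 1)"
  define C where "C = A * 2 powr \<mu> * of_real k powr (2 * \<mu>)"
  define P where "P t = 2 - 2 * cos (2 * \<theta>) * t" for t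
  have P_eq: "P t = 2 * (1 - t) + 2 * k * t" for t unfolding P_def k_def cos_double_cos by (simp add: algebra_simps)
  define g where "g t = beta_weight m (lam - 2 * m + 1) t *
      (of_real (P t) powr (- lam) * hyp2F1_reg (lam / 2) ((lam + 1) / 2) (lam - m + 1) (of_real (4 * (1 - t)\<^sup>2 / (P t)\<^sup>2)))" for t
  let ?L = "legendre_integrand \<nu> \<mu> (of_real (cos \<theta>))"
  have sub: "(k / (1 - t)\<^sup>2) *\<^sub>R ?L (1 + k * t / (1 - t)) = C * g t" if t: "t \<in> {0<..<1}" for t
  proof -
    define w where "w = 1 + k * t / (1 - t)"
    define Y V where "Y = k * t / (1 - t)" "V = k / (1 - t)"
    have t': "0 < t" "0 < 1 - t" using t by auto
    have pos: "Y > 0" "V > 0" "P t > 0" using t k by (auto simp: Y_V_def P_eq intro!: add_pos_pos)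
    have w: "w > 1" using pos by (simp add: w_def Y_V_def)
    have wP: "w = P t / (2 * (1 - t))" using t by (simp add: w_def P_eq field_simps)
    have wY: "w - 1 = Y" by (simp add: w_def Y_V_def)
    have wV: "1 - 2 * (complex_of_real (cos \<theta>))\<^sup>2 + of_real w = of_real V"
    proof -
      have "1 - 2 * (cos \<theta>)\<^sup>2 + w = V" using t by (simp add: w_def Y_V_def k_def field_simps)
      then show ?thesis by (metis of_real_1 of_real_add of_real_diff of_real_mult of_real_numeral of_real_power)
    qed
    have u: "1 / (complex_of_real w)\<^sup>2 = of_real (4 * (1 - t)\<^sup>2 / (P t)\<^sup>2)"
    proof -
      have "1 / w\<^sup>2 = 4 * (1 - t)\<^sup>2 / (P t)\<^sup>2" unfolding wP power_divide power_mult_distrib by simp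
      then show ?thesis by (metis of_real_1 of_real_divide of_real_power)
    qed
    have dom: "complex_of_real w \<in> legendre_domain" using w by (simp add: legendre_domain_iff)
    define K where "K = hyp2F1_reg (lam / 2) ((lam + 1) / 2) (lam - m + 1) (of_real (4 * (1 - t)\<^sup>2 / (P t)\<^sup>2))"
    have Qe: "legendreQ \<nu> (- \<mu>) (of_real w) = A / 2 powr (\<nu> + 1) *
        (of_real Y powr (\<mu> / 2) * of_real (w + 1) powr (\<mu> / 2)) * of_real w powr (- lam) * K"
      using legendreQ_eq_whipple[OF dom c0, of \<mu>] unfolding u c[symmetric] lam_m_def(1)[symmetric] K_def A_def wY[symmetric] by simp
    have nz: "complex_of_real (w + 1) powr (\<mu> / 2) \<noteq> 0" using w by (simp del: of_real_add)
    \<comment> \<open>The exponent (\<mu> - 1) / 2 of w - 1 is made for this: with \<mu> / 2 from Q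
      it adds up to m - 1, the exponent of the beta weight at t = 0.\<close>
    have YY: "complex_of_real Y powr (\<mu> / 2) * of_real Y powr ((\<mu> - 1) / 2) = of_real Y powr (m - 1)"
      unfolding powr_add[symmetric] by (simp add: lam_m_def field_simps)
    have L: "?L w = A * K * ((2 powr (- (\<nu> + 1)) * of_real w powr (- lam)) * (of_real Y powr (m - 1) * of_real V powr (m - 1)))"
    proof -
      have cancel: "A / p * (y * z) * w' * K * (y' / z) * v = A * K * ((inverse p * w') * ((y * y') * v))"
        if "z \<noteq> 0" for p y z w' y' v :: complex
        using that by (simp add: field_simps)
      have m1: "m - 1 = \<mu> - 1 / 2" by (simp add: lam_m_def)
      show ?thesis
        unfolding legendre_integrand_def Qe wV wY YY[symmetric] powr_minus[of 2] unfolding m1 by (rule cancel[OF nz])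
    qed
    have lnw: "ln w = ln (P t) - (ln 2 + ln (1 - t))"
    proof -
      have "ln (2 * (1 - t)) = ln 2 + ln (1 - t)" using t' by (intro ln_mult_pos) auto
      moreover have "ln w = ln (P t) - ln (2 * (1 - t))" unfolding wP using t' pos by (intro ln_divide_pos) auto
      ultimately show ?thesis by simp
    qed
    have lnY: "ln Y = ln k + ln t - ln (1 - t)" unfolding Y_V_def using k t' by (simp add: ln_div ln_mult)
    have lnV: "ln V = ln k - ln (1 - t)" unfolding Y_V_def using k t' by (simp add: ln_div)
    have kp: "complex_of_real (k / (1 - t)\<^sup>2) = exp (of_real (ln k - 2 * ln (1 - t)))"
      unfolding exp_of_real using k t' by (simp add: exp_diff exp_double)
    have two: "(2::complex) powr a = exp (a * of_real (ln 2))" for a using powr_of_real_eq_exp[of 2 a] by simp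
    have "of_real (k / (1 - t)\<^sup>2) * ((2 powr (- (\<nu> + 1)) * of_real w powr (- lam)) * (of_real Y powr (m - 1) * of_real V powr (m - 1))) =
       2 powr \<mu> * of_real k powr (2 * \<mu>) * (beta_weight m (lam - 2 * m + 1) t * of_real (P t) powr (- lam))"
    proof -
      have "w > 0" using w by simp
      show ?thesis
        unfolding beta_weight_def kp two powr_of_real_eq_exp[OF pos(1)] powr_of_real_eq_exp[OF pos(2)] powr_of_real_eq_exp[OF pos(3)]
          powr_of_real_eq_exp[OF \<open>w > 0\<close>] powr_of_real_eq_exp[OF k] powr_of_real_eq_exp[OF t'(1)] powr_of_real_eq_exp[OF t'(2)]
        unfolding exp_add[symmetric] lnw lnY lnV of_real_add of_real_diff of_real_mult of_real_numeral
        by (intro arg_cong[where f = exp]) (simp add: lam_m_def field_simps)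
    qed
    then have "of_real (k / (1 - t)\<^sup>2) * ?L w = A * K * (2 powr \<mu> * of_real k powr (2 * \<mu>) * (beta_weight m (lam - 2 * m + 1) t * of_real (P t) powr (- lam)))"
      unfolding L by (simp only: mult_ac)
    then show ?thesis unfolding w_def[symmetric] scaleR_conv_of_real g_def C_def K_def by (simp only: mult_ac)
  qed
  note pf = product_formula_unit_circle[OF m q \<theta>, folded P_def, folded g_def]
  have "(\<lambda>t. C * g t) absolutely_integrable_on {0<..<1}" by (intro set_integrable_mult_right pf(1))
  then have "(\<lambda>t. (k / (1 - t)\<^sup>2) *\<^sub>R ?L (1 + k * t / (1 - t))) absolutely_integrable_on {0<..<1}"
    by (rule set_integrable_cong[THEN iffD1, rotated 3]) (simp_all only: sub)
  then show int: "?L absolutely_integrable_on {1<..}"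
    by (simp only: moebius_substitution(1)[OF k])
  have "Arccos (of_real (cos \<theta>)) = of_real \<theta>" using \<theta> by (subst of_real_arccos[symmetric]) (auto simp: arccos_cos)
  then have br: "ferrers_branch 1 lam m (of_real (cos \<theta>)) * ferrers_branch (-1) lam m (of_real (cos \<theta>)) =
      hyp2F1_reg lam m (lam - m + 1) (exp (- (2 * \<i> * of_real \<theta>))) * hyp2F1_reg lam m (lam - m + 1) (exp (2 * \<i> * of_real \<theta>))"
    by (simp add: ferrers_branch_def exp_minus)
  have "integral {1<..} ?L = integral {0<..<1} (\<lambda>t. (k / (1 - t)\<^sup>2) *\<^sub>R ?L (1 + k * t / (1 - t)))"
    by (rule moebius_substitution(2)[OF k int, symmetric])
  also have "\<dots> = integral {0<..<1} (\<lambda>t. C * g t)"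
    by (rule Henstock_Kurzweil_Integration.integral_cong) (rule sub)
  also have "\<dots> = C * integral {0<..<1} g" by simp
  also have "\<dots> = C * (Gamma m * Gamma (\<nu> - \<mu> + 1) * (ferrers_branch 1 lam m (of_real (cos \<theta>)) * ferrers_branch (-1) lam m (of_real (cos \<theta>))))"
    unfolding pf(2) br qe by (simp only: mult.assoc)
  finally have fin: "integral {1<..} ?L = \<dots>" .
  have kk: "2 * (1 - (complex_of_real (cos \<theta>))\<^sup>2) = of_real k" by (simp add: k_def)
  show "integral {1<..} ?L =
      of_real (sqrt pi) * exp (- \<i> * of_real pi * \<mu>) * (Gamma (\<nu> - \<mu> + 1))\<^sup>2 * Gamma (\<mu> + 1 / 2) *
      2 powr \<mu> * (2 * (1 - (of_real (cos \<theta>))\<^sup>2)) powr (2 * \<mu>) *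
      (ferrers_branch 1 (\<nu> + \<mu> + 1) (\<mu> + 1 / 2) (of_real (cos \<theta>)) *
       ferrers_branch (-1) (\<nu> + \<mu> + 1) (\<mu> + 1 / 2) (of_real (cos \<theta>)))"
    unfolding kk fin lam_m_def[symmetric] C_def A_def by (simp only: power2_eq_square mult_ac)
qed

section \<open>Holomorphy of the integral in x\<close>

lemma ferrers_domain_one_minus_square:
  assumes x: "x \<in> ferrers_domain" and s: "0 \<le> s" "s \<le> 1"
  shows "1 - x\<^sup>2 * of_real s \<notin> \<real>\<^sub>\<le>\<^sub>0"
proof
  assume "1 - x\<^sup>2 * of_real s \<in> \<real>\<^sub>\<le>\<^sub>0"
  then have *: "Im (x\<^sup>2) * s = 0" "Re (x\<^sup>2) * s \<ge> 1" by (auto simp: complex_nonpos_Reals_iff)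
  then have "s \<noteq> 0" by auto
  with * s have "Im (x\<^sup>2) = 0" "0 < Re (x\<^sup>2)" by (auto intro: zero_less_mult_pos2[of _ s])
  moreover from this s have "Re (x\<^sup>2) * s \<le> Re (x\<^sup>2) * 1" by (intro mult_left_mono) auto
  ultimately have "1 - x\<^sup>2 \<in> \<real>\<^sub>\<le>\<^sub>0" using * by (auto simp: complex_nonpos_Reals_iff)
  with ferrers_domain_slits(6)[OF x] show False by simp
qed

text \<open>The substitution with k = 2 does not involve x and gives 1 - 2 x^2 + w = (2 / (1 - t))
  (1 - x^2 (1 - t)). All dependence on x then sits in \<open>h\<close>, which is continuous up to
  both ends, and \<open>W\<close> collects the rest.\<close>

lemma legendre_integral_holomorphic:
  fixes \<nu> \<mu> :: complex
  assumes \<mu>: "Re \<mu> > - 1 / 2" and \<nu>\<mu>: "Re (\<nu> - \<mu>) > - 1"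
  shows "(\<lambda>x. integral {1<..} (legendre_integrand \<nu> \<mu> x)) holomorphic_on ferrers_domain"
proof -
  define W where "W t = of_real (2 / (1 - t)\<^sup>2) * (legendreQ \<nu> (- \<mu>) (of_real (1 + 2 * t / (1 - t))) *
     (of_real (1 + 2 * t / (1 - t) - 1) powr ((\<mu> - 1) / 2) / of_real (1 + 2 * t / (1 - t) + 1) powr (\<mu> / 2))) *
     of_real (2 / (1 - t)) powr (\<mu> - 1 / 2)" for t :: real
  define h where "h a x t = (1 - x\<^sup>2 * of_real (1 - t)) powr a" for a x :: complex and t :: real
  have sub: "(2 / (1 - t)\<^sup>2) *\<^sub>R legendre_integrand \<nu> \<mu> x (1 + 2 * t / (1 - t)) = W t * h (\<mu> - 1 / 2) x t"
    if t: "t \<in> {0<..<1}" for x t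
  proof -
    have "1 - 2 * x\<^sup>2 + of_real (1 + 2 * t / (1 - t)) = of_real (2 / (1 - t)) * (1 - x\<^sup>2 * of_real (1 - t))"
    proof -
      have "complex_of_real (1 + 2 * t / (1 - t)) = of_real (2 / (1 - t) - 1)" using t by (intro arg_cong[where f = of_real]) (simp add: field_simps)
      moreover have "2 / (1 - t) * (1 - t) = 2" using t by (intro nonzero_eq_divide_eq[THEN iffD1]) auto
      then have "complex_of_real (2 / (1 - t)) * of_real (1 - t) = 2" by (metis of_real_mult of_real_numeral)
      moreover have "1 - 2 * X + (D - 1) = D * (1 - X * s)" if "D * s = 2" for X D s :: complex
      proof -
        have "D * (1 - X * s) = D - X * (D * s)" by (simp add: algebra_simps)
        then show ?thesis by (simp add: that)
      qed
      ultimately show ?thesis by (simp only: of_real_diff of_real_1)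
    qed
    then have "(1 - 2 * x\<^sup>2 + of_real (1 + 2 * t / (1 - t))) powr (\<mu> - 1 / 2) = of_real (2 / (1 - t)) powr (\<mu> - 1 / 2) * h (\<mu> - 1 / 2) x t"
      unfolding h_def using t by (simp only:) (rule powr_times_real_left, auto)
    then show ?thesis unfolding legendre_integrand_def scaleR_conv_of_real W_def by (simp only: mult_ac)
  qed
  have hc: "continuous_on (ferrers_domain \<times> {0..1}) (\<lambda>(x, t). h a x t)" for a
  proof -
    have "1 - (fst p)\<^sup>2 * of_real (1 - snd p) \<notin> \<real>\<^sub>\<le>\<^sub>0" if "p \<in> ferrers_domain \<times> {0..1}" for p
      using that by (intro ferrers_domain_one_minus_square) auto
    then show ?thesis unfolding h_def case_prod_unfold by (intro continuous_on_powr_slit continuous_intros)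
  qed
  have hh: "(\<lambda>x. h a x t) holomorphic_on ferrers_domain" if "t \<in> {0<..<1}" for a t
    unfolding h_def by (intro holomorphic_intros) (use that in \<open>auto simp del: of_real_diff dest: ferrers_domain_one_minus_square[of _ "1 - t"]\<close>)
  have x0: "(1 / 2 :: complex) \<in> ferrers_domain" by (simp add: ferrers_domain_iff)
  have Wc: "continuous_on {0<..<1} W"
  proof -
    define w where "w t = 1 + 2 * t / (1 - t)" for t :: real
    have pos: "w t - 1 > 0" "w t + 1 > 0" "2 / (1 - t) > 0" if "t \<in> {0<..<1}" for t
      using that by (auto simp: w_def intro!: add_pos_pos)
    have wc: "continuous_on {0<..<1} w" "continuous_on {0<..<1} (\<lambda>t::real. 2 / (1 - t))" "continuous_on {0<..<1} (\<lambda>t::real. 2 / (1 - t)\<^sup>2)"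
      unfolding w_def by (auto intro!: continuous_intros)
    have pc: "continuous_on {0<..<1} (\<lambda>t. complex_of_real (f t) powr a)"
      if "continuous_on {0<..<1} f" "\<And>t. t \<in> {0<..<1} \<Longrightarrow> f t > 0" for f :: "real \<Rightarrow> real" and a
      using that by (intro continuous_on_powr_slit continuous_on_of_real) (auto simp: complex_nonpos_Reals_iff not_le)
    have "w t > 1" if "t \<in> {0<..<1}" for t using pos(1)[OF that] by simp
    then have wd: "(\<lambda>t. complex_of_real (w t)) ` {0<..<1} \<subseteq> legendre_domain" by (auto simp: legendre_domain_iff)
    have Qc: "continuous_on {0<..<1} (\<lambda>t. legendreQ \<nu> (- \<mu>) (of_real (w t)))"
      by (rule continuous_on_compose2[OF holomorphic_on_imp_continuous_on[OF legendreQ_holomorphic] _ wd])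
        (intro continuous_on_of_real wc)
    have p1: "continuous_on {0<..<1} (\<lambda>t. complex_of_real (w t - 1) powr a)" for a
      by (rule pc) (use pos wc in \<open>auto intro!: continuous_intros\<close>)
    have p2: "continuous_on {0<..<1} (\<lambda>t. complex_of_real (w t + 1) powr a)" for a
      by (rule pc) (use pos wc in \<open>auto intro!: continuous_intros\<close>)
    have p3: "continuous_on {0<..<1} (\<lambda>t. complex_of_real (2 / (1 - t)) powr a)" for a
      by (rule pc[OF wc(2) pos(3)])
    have nz: "complex_of_real (w t + 1) powr (\<mu> / 2) \<noteq> 0" if "t \<in> {0<..<1}" for t
      using pos(2)[OF that] by (simp del: of_real_add)
    show ?thesis unfolding W_def w_def[symmetric]
      using nz by (intro continuous_on_mult continuous_on_divide continuous_on_of_real wc Qc p1 p2 p3) auto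
  qed
  \<comment> \<open>Integrability of \<open>W\<close> is read off from one point, x = 1/2 = cos
    (\<pi>/3): there the product of \<open>W\<close> and \<open>h\<close> is known to be integrable,
    and multiplying by the inverse power, which is again an instance of \<open>h\<close>, recovers
    \<open>W\<close>.\<close>
  have W: "W absolutely_integrable_on {0<..<1}"
  proof -
    define W0 where "W0 t = W t * h (\<mu> - 1 / 2) (1 / 2) t" for t
    have "legendre_integrand \<nu> \<mu> (1 / 2) absolutely_integrable_on {1<..}"
      using legendre_integrand_real_point(1)[OF \<mu> \<nu>\<mu>, of "pi / 3"] by (simp add: cos_60)
    then have "(\<lambda>t. (2 / (1 - t)\<^sup>2) *\<^sub>R legendre_integrand \<nu> \<mu> (1 / 2) (1 + 2 * t / (1 - t))) absolutely_integrable_on {0<..<1}"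
      by (subst moebius_substitution(1)) auto
    then have "W0 absolutely_integrable_on {0<..<1}"
      by (rule set_integrable_cong[THEN iffD1, rotated 3]) (simp_all only: sub W0_def)
    moreover have "continuous_on {0<..<1} W0"
    proof -
      have "continuous_on {0<..<1} (\<lambda>t. (\<lambda>(x, t). h (\<mu> - 1 / 2) x t) (1 / 2, t))"
        by (rule continuous_on_compose2[OF hc]) (use x0 in \<open>auto intro!: continuous_intros\<close>)
      then show ?thesis unfolding W0_def by (intro continuous_on_mult Wc) simp
    qed
    ultimately have "(\<lambda>t. W0 t * h (1 / 2 - \<mu>) (1 / 2) t) absolutely_integrable_on {0<..<1}"
      by (rule holomorphic_weighted_integral(1)[OF open_ferrers_domain _ _ hc hh x0])
    moreover have "W0 t * h (1 / 2 - \<mu>) (1 / 2) t = W t" if "t \<in> {0<..<1}" for t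
    proof -
      have "1 - (1 / 2)\<^sup>2 * complex_of_real (1 - t) \<notin> \<real>\<^sub>\<le>\<^sub>0"
        using that by (intro ferrers_domain_one_minus_square x0) auto
      then have "1 - (1 / 2)\<^sup>2 * complex_of_real (1 - t) \<noteq> 0" by (rule contrapos_nn) (simp only: nonpos_Reals_zero_I)
      then have "h (\<mu> - 1 / 2) (1 / 2) t * h (1 / 2 - \<mu>) (1 / 2) t = 1"
        unfolding h_def powr_add[symmetric] by simp
      then show ?thesis by (simp add: W0_def mult.assoc)
    qed
    ultimately show ?thesis by (subst set_integrable_cong[OF refl, symmetric]) (assumption | simp)+
  qed
  have hw: "(\<lambda>t. W t * h a x t) absolutely_integrable_on {0<..<1}"
    "(\<lambda>x. integral {0<..<1} (\<lambda>t. W t * h a x t)) field_differentiable at x" if x: "x \<in> ferrers_domain" for a x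
  proof -
    show "(\<lambda>t. W t * h a x t) absolutely_integrable_on {0<..<1}"
      by (rule holomorphic_weighted_integral(1)[OF open_ferrers_domain W Wc hc _ x]) (rule hh)
    show "(\<lambda>x. integral {0<..<1} (\<lambda>t. W t * h a x t)) field_differentiable at x"
      unfolding field_differentiable_def
      by (rule exI, rule holomorphic_weighted_integral(3)[OF open_ferrers_domain W Wc hc _ x]) (rule hh)
  qed
  have "integral {1<..} (legendre_integrand \<nu> \<mu> x) = integral {0<..<1} (\<lambda>t. W t * h (\<mu> - 1 / 2) x t)" if x: "x \<in> ferrers_domain" for x
  proof -
    have "(\<lambda>t. (2 / (1 - t)\<^sup>2) *\<^sub>R legendre_integrand \<nu> \<mu> x (1 + 2 * t / (1 - t))) absolutely_integrable_on {0<..<1}"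
      using hw(1)[OF x, of "\<mu> - 1 / 2"] by (rule set_integrable_cong[THEN iffD1, rotated 3]) (simp_all only: sub)
    then have "legendre_integrand \<nu> \<mu> x absolutely_integrable_on {1<..}" by (subst (asm) moebius_substitution(1)) auto
    then have "integral {1<..} (legendre_integrand \<nu> \<mu> x) = integral {0<..<1} (\<lambda>t. (2 / (1 - t)\<^sup>2) *\<^sub>R legendre_integrand \<nu> \<mu> x (1 + 2 * t / (1 - t)))"
      by (intro moebius_substitution(2)[symmetric]) auto
    also have "\<dots> = integral {0<..<1} (\<lambda>t. W t * h (\<mu> - 1 / 2) x t)"
      by (rule Henstock_Kurzweil_Integration.integral_cong) (rule sub)
    finally show ?thesis .
  qed
  moreover have "(\<lambda>x. integral {0<..<1} (\<lambda>t. W t * h (\<mu> - 1 / 2) x t)) holomorphic_on ferrers_domain"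
    using hw(2) by (auto simp: holomorphic_on_def intro: field_differentiable_at_within)
  ultimately show ?thesis by (auto intro: holomorphic_transform)
qed

lemma legendre_integral_eq_branches:
  assumes \<mu>: "Re \<mu> > - 1 / 2" and \<nu>\<mu>: "Re (\<nu> - \<mu>) > - 1" and x: "x \<in> ferrers_domain"
  shows "integral {1<..} (legendre_integrand \<nu> \<mu> x) =
      of_real (sqrt pi) * exp (- \<i> * of_real pi * \<mu>) * (Gamma (\<nu> - \<mu> + 1))\<^sup>2 * Gamma (\<mu> + 1 / 2) *
      2 powr \<mu> * (2 * (1 - x\<^sup>2)) powr (2 * \<mu>) *
      (ferrers_branch 1 (\<nu> + \<mu> + 1) (\<mu> + 1 / 2) x * ferrers_branch (-1) (\<nu> + \<mu> + 1) (\<mu> + 1 / 2) x)"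
proof (rule holomorphic_eq_if_eq_on_real_interval[OF legendre_integral_holomorphic[OF \<mu> \<nu>\<mu>] _ open_ferrers_domain connected_ferrers_domain _ _ _ x])
  show "(0::real) < 1" by simp
  show "complex_of_real ` {0<..<1} \<subseteq> ferrers_domain" by (auto simp: ferrers_domain_iff)
  have "2 * (1 - x\<^sup>2) \<notin> \<real>\<^sub>\<le>\<^sub>0" if "x \<in> ferrers_domain" for x
    using ferrers_domain_slits(6)[OF that] by (auto simp: complex_nonpos_Reals_iff)
  then show "(\<lambda>x. of_real (sqrt pi) * exp (- \<i> * of_real pi * \<mu>) * (Gamma (\<nu> - \<mu> + 1))\<^sup>2 * Gamma (\<mu> + 1 / 2) *
      2 powr \<mu> * (2 * (1 - x\<^sup>2)) powr (2 * \<mu>) *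
      (ferrers_branch 1 (\<nu> + \<mu> + 1) (\<mu> + 1 / 2) x * ferrers_branch (-1) (\<nu> + \<mu> + 1) (\<mu> + 1 / 2) x)) holomorphic_on ferrers_domain"
    by (intro holomorphic_intros ferrers_branch_holomorphic) auto
next
  fix t :: real assume t: "0 < t" "t < 1"
  have "cos (arccos t) = t" "0 < arccos t" "arccos t < pi / 2"
    using t arccos_less_arccos[of t 1] arccos_less_arccos[of 0 t] by (auto intro: cos_arccos)
  then show "integral {1<..} (legendre_integrand \<nu> \<mu> (of_real t)) =
      of_real (sqrt pi) * exp (- \<i> * of_real pi * \<mu>) * (Gamma (\<nu> - \<mu> + 1))\<^sup>2 * Gamma (\<mu> + 1 / 2) *
      2 powr \<mu> * (2 * (1 - (of_real t)\<^sup>2)) powr (2 * \<mu>) *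
      (ferrers_branch 1 (\<nu> + \<mu> + 1) (\<mu> + 1 / 2) (of_real t) * ferrers_branch (-1) (\<nu> + \<mu> + 1) (\<mu> + 1 / 2) (of_real t))"
    using legendre_integrand_real_point(2)[OF \<mu> \<nu>\<mu>, of "arccos t"] by simp
qed

text \<open>Both sides are multiples of the same product of branches. The integral carries (2 (1 -
  x^2))^(2 \<mu>), which the denominator reduces to the power \<mu> of 1 - x^2 found in the sum of
  squares.\<close>

lemma sum_of_squares_eq_integral:
  assumes \<mu>: "Re \<mu> > - 1 / 2" and \<nu>\<mu>: "Re (\<nu> - \<mu>) > - 1" and x: "x \<in> ferrers_domain"
  shows "(ferrersQ \<nu> (- \<mu>) x)\<^sup>2 + of_real (pi\<^sup>2 / 4) * (ferrersP \<nu> (- \<mu>) x)\<^sup>2 =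
         of_real (sqrt pi) * exp (\<i> * of_real pi * \<mu>) /
           (2 powr \<mu> * Gamma (\<mu> + 1 / 2) * (1 - x\<^sup>2) powr \<mu>) *
         integral {1<..} (legendre_integrand \<nu> \<mu> x)"
proof -
  define B where "B = ferrers_branch 1 (\<nu> + \<mu> + 1) (\<mu> + 1 / 2) x * ferrers_branch (-1) (\<nu> + \<mu> + 1) (\<mu> + 1 / 2) x"
  define X where "X = (1 - x\<^sup>2) powr \<mu>"
  define T where "T = (2::complex) powr \<mu>"
  define G where "G = Gamma (\<mu> + 1 / 2)"
  define S where "S = complex_of_real (sqrt pi)"
  define E where "E = exp (\<i> * of_real pi * \<mu>)"
  have "\<mu> + 1 / 2 \<notin> \<int>\<^sub>\<le>\<^sub>0" using \<mu> by (auto intro!: Re_pos_notin_nonpos_Ints)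
  then have nz: "G \<noteq> 0" "X \<noteq> 0" "T \<noteq> 0" "E \<noteq> 0"
    using ferrers_domain_slits(6)[OF x] by (auto simp: G_def X_def T_def E_def Gamma_eq_zero_iff)
  have "(2 * (1 - x\<^sup>2)) powr (2 * \<mu>) = T\<^sup>2 * X\<^sup>2"
    using powr_times_real_left[of 2 "1 - x\<^sup>2" "2 * \<mu>"]
    by (simp add: T_def X_def power2_eq_square powr_add[symmetric])
  then have I: "integral {1<..} (legendre_integrand \<nu> \<mu> x) = S * inverse E * (Gamma (\<nu> - \<mu> + 1))\<^sup>2 * G * T * (T\<^sup>2 * X\<^sup>2) * B"
    using legendre_integral_eq_branches[OF assms] by (simp add: S_def E_def G_def T_def B_def exp_minus)
  have "S * S = of_real pi" by (simp add: S_def flip: of_real_mult)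
  then have "of_real pi * (Gamma (\<nu> - \<mu> + 1))\<^sup>2 * T\<^sup>2 * X * B = S * E / (T * G * X) * integral {1<..} (legendre_integrand \<nu> \<mu> x)"
    unfolding I using nz by (simp add: power2_eq_square field_simps)
  then show ?thesis
    unfolding ferrers_sum_of_squares[OF assms] B_def[symmetric] X_def T_def S_def G_def E_def .
qed

section \<open>The range of convergence\<close>

text \<open>The powers of w - 1 and of w + 1 are merged so that the exponents at 1 and at infinity
  can be read off.\<close>

lemma legendre_integrand_eq:
  assumes w: "w > 1"
  shows "legendre_integrand \<nu> \<mu> x w =
    of_real (sqrt pi) * exp (- \<i> * of_real pi * \<mu>) * Gamma (\<nu> - \<mu> + 1) / 2 powr (\<nu> + 1) *
    (of_real (w - 1) powr (- 1 / 2) * of_real (w + 1) powr (- \<mu>) * of_real w powr (- (\<nu> - \<mu> + 1)) *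
     hyp2F1_reg ((\<nu> - \<mu> + 1) / 2) ((\<nu> - \<mu> + 2) / 2) (\<nu> + 3 / 2) (of_real (1 / w\<^sup>2)) *
     (1 - 2 * x\<^sup>2 + of_real w) powr (\<mu> - 1 / 2))"
proof -
  have dom: "complex_of_real w \<in> legendre_domain" using w by (simp add: legendre_domain_iff)
  define Y Z where "Y = complex_of_real (w - 1)" "Z = complex_of_real (w + 1)"
  have "Z \<noteq> 0" using w by (simp add: Y_Z_def del: of_real_add)
  have YZ: "complex_of_real w - 1 = Y" "complex_of_real w + 1 = Z" by (simp_all add: Y_Z_def)
  have Yp: "Y powr (- \<mu> / 2) * Y powr ((\<mu> - 1) / 2) = Y powr (- 1 / 2)"
    unfolding powr_add[symmetric] by (simp add: field_simps)
  have Zp: "Z powr (- \<mu> / 2) / Z powr (\<mu> / 2) = Z powr (- \<mu>)"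
    unfolding powr_diff[symmetric] by (simp add: field_simps)
  have u: "1 / (complex_of_real w)\<^sup>2 = of_real (1 / w\<^sup>2)" by simp
  have alg: "A * (y * z) / (p * q) * F * (y' / z') * v = A / p * ((y * y') * (z / z') * inverse q * F * v)" for A y z p q F y' z' v :: complex
    by (simp add: divide_inverse mult_ac)
  show ?thesis
    unfolding legendre_integrand_def legendreQ_eq[OF dom] YZ Y_Z_def[symmetric] u alg Yp Zp
    by (simp add: powr_minus[of _ "\<nu> - \<mu> + 1"] flip: powr_minus)
qed

text \<open>At infinity the integrand is to leading order a nonzero multiple of w^(\<mu> - \<nu> -
  2). If Re \<mu> < 0, the hypergeometric factor behaves like (1 - 1/w^2)^\<mu> at w = 1 and the
  integrand like (w - 1)^(\<mu> - 1/2). So failure of either inequality contradicts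
  \<open>not_integrable_at_infinity\<close> or \<open>not_integrable_at_right\<close>.\<close>

lemma legendre_integrand_integrable_imp:
  assumes x: "x \<in> ferrers_domain" and Q: "\<nu> - \<mu> + 1 \<notin> \<int>\<^sub>\<le>\<^sub>0" and c: "\<nu> + 3 / 2 \<notin> \<int>\<^sub>\<le>\<^sub>0"
    and int: "legendre_integrand \<nu> \<mu> x integrable_on {1<..}"
  shows "Re (\<nu> - \<mu>) > - 1" and "Re \<mu> > - 1 / 2"
proof -
  define A where "A = of_real (sqrt pi) * exp (- \<i> * of_real pi * \<mu>) * Gamma (\<nu> - \<mu> + 1) / 2 powr (\<nu> + 1)"
  define F where "F = hyp2F1_reg ((\<nu> - \<mu> + 1) / 2) ((\<nu> - \<mu> + 2) / 2) (\<nu> + 3 / 2)"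
  \<comment> \<open>\<open>Gamma\<close> is 0 at its poles, so this rests on \<nu> - \<mu> + 1 not
    being one.\<close>
  have A: "A \<noteq> 0" using Q by (simp add: A_def Gamma_eq_zero_iff)
  let ?L = "legendre_integrand \<nu> \<mu> x"
  have L: "?L w = A * (of_real (w - 1) powr (- 1 / 2) * of_real (w + 1) powr (- \<mu>) * of_real w powr (- (\<nu> - \<mu> + 1)) *
     F (of_real (1 / w\<^sup>2)) * (1 - 2 * x\<^sup>2 + of_real w) powr (\<mu> - 1 / 2))" if "w > 1" for w
    using legendre_integrand_eq[OF that, of \<nu> \<mu> x] by (simp only: A_def F_def)
  have F_cont: "isCont F z" if "z \<in> cut_plane" for z
    using hyp2F1_reg_deriv(1)[OF that] DERIV_isCont unfolding F_def by blast
  have one: "(1::complex) \<notin> \<real>\<^sub>\<le>\<^sub>0" by (simp add: complex_nonpos_Reals_iff)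
  show "Re (\<nu> - \<mu>) > - 1"
  proof (rule ccontr)
    assume "\<not> Re (\<nu> - \<mu>) > - 1"
    then have p: "Re (\<mu> - \<nu> - 2) \<ge> - 1" by simp
    have lim: "((\<lambda>w. A * (of_real ((w - 1) / w) powr (- 1 / 2) * of_real ((w + 1) / w) powr (- \<mu>) * F (of_real (1 / w\<^sup>2)) *
        ((1 - 2 * x\<^sup>2) * of_real (1 / w) + 1) powr (\<mu> - 1 / 2))) \<longlongrightarrow>
        A * (1 powr (- 1 / 2) * 1 powr (- \<mu>) * F (of_real 0) * ((1 - 2 * x\<^sup>2) * of_real 0 + 1) powr (\<mu> - 1 / 2))) at_top"
    proof -
      have l: "((\<lambda>w::real. (w - 1) / w) \<longlongrightarrow> 1) at_top" "((\<lambda>w::real. (w + 1) / w) \<longlongrightarrow> 1) at_top"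
        "((\<lambda>w::real. 1 / w\<^sup>2) \<longlongrightarrow> 0) at_top" "((\<lambda>w::real. 1 / w) \<longlongrightarrow> 0) at_top"
        by real_asymp+
      have c1: "((\<lambda>w. complex_of_real ((w - 1) / w)) \<longlongrightarrow> 1) at_top" "((\<lambda>w. complex_of_real ((w + 1) / w)) \<longlongrightarrow> 1) at_top"
        using tendsto_of_real[OF l(1), where 'a = complex] tendsto_of_real[OF l(2), where 'a = complex] by (simp_all only: of_real_1)
      have Fl: "((\<lambda>w. F (of_real (1 / w\<^sup>2))) \<longlongrightarrow> F (of_real 0)) at_top"
        by (rule isCont_tendsto_compose[OF F_cont]) (simp add: zero_in_cut_plane, rule tendsto_of_real[OF l(3)])
      have s: "(1 - 2 * x\<^sup>2) * complex_of_real 0 + 1 \<notin> \<real>\<^sub>\<le>\<^sub>0" using one by simp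
      have vl: "((\<lambda>w. (1 - 2 * x\<^sup>2) * complex_of_real (1 / w) + 1) \<longlongrightarrow> (1 - 2 * x\<^sup>2) * complex_of_real 0 + 1) at_top"
        by (intro tendsto_add tendsto_mult tendsto_const tendsto_of_real l(4))
      show ?thesis
        by (intro tendsto_mult tendsto_const Fl tendsto_powr_complex[OF one] tendsto_powr_complex[OF s] c1 vl)
    qed
    have ev: "\<forall>\<^sub>F w in at_top. A * (of_real ((w - 1) / w) powr (- 1 / 2) * of_real ((w + 1) / w) powr (- \<mu>) * F (of_real (1 / w\<^sup>2)) *
        ((1 - 2 * x\<^sup>2) * of_real (1 / w) + 1) powr (\<mu> - 1 / 2)) = ?L w * of_real w powr (- (\<mu> - \<nu> - 2))"
      using eventually_gt_at_top[of 1]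
    proof eventually_elim
      fix w :: real assume w: "w > 1"
      then have pos: "w > 0" "w - 1 > 0" "w + 1 > 0" "(w - 1) / w > 0" "(w + 1) / w > 0" by auto
      have v: "1 - 2 * x\<^sup>2 + of_real w = of_real w * ((1 - 2 * x\<^sup>2) * of_real (1 / w) + 1)"
        using w by (simp add: field_simps)
      have vp: "(1 - 2 * x\<^sup>2 + of_real w) powr (\<mu> - 1 / 2) = of_real w powr (\<mu> - 1 / 2) * ((1 - 2 * x\<^sup>2) * of_real (1 / w) + 1) powr (\<mu> - 1 / 2)"
        unfolding v by (rule powr_times_real_left) (use w in auto)
      have ln: "ln ((w - 1) / w) = ln (w - 1) - ln w" "ln ((w + 1) / w) = ln (w + 1) - ln w"
        using pos by (intro ln_divide_pos; simp)+
      have key: "complex_of_real ((w - 1) / w) powr (- 1 / 2) * of_real ((w + 1) / w) powr (- \<mu>) =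
          of_real (w - 1) powr (- 1 / 2) * of_real (w + 1) powr (- \<mu>) * of_real w powr (- (\<nu> - \<mu> + 1)) *
          of_real w powr (\<mu> - 1 / 2) * of_real w powr (- (\<mu> - \<nu> - 2))"
        unfolding powr_of_real_eq_exp[OF pos(1)] powr_of_real_eq_exp[OF pos(2)] powr_of_real_eq_exp[OF pos(3)] powr_of_real_eq_exp[OF pos(4)]
          powr_of_real_eq_exp[OF pos(5)]
        unfolding exp_add[symmetric] ln of_real_diff
        by (intro arg_cong[where f = exp]) (simp add: field_simps)
      show "A * (of_real ((w - 1) / w) powr (- 1 / 2) * of_real ((w + 1) / w) powr (- \<mu>) * F (of_real (1 / w\<^sup>2)) *
        ((1 - 2 * x\<^sup>2) * of_real (1 / w) + 1) powr (\<mu> - 1 / 2)) = ?L w * of_real w powr (- (\<mu> - \<nu> - 2))"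
        unfolding L[OF w] key vp by (simp only: mult_ac)
    qed
    \<comment> \<open>The leading coefficient at infinity contains F(0) = 1 / Gamma (\<nu> + 3/2),
      which is nonzero off the poles.\<close>
    have "F (of_real 0) = rGamma (\<nu> + 3 / 2)" by (simp add: F_def hyp2F1_reg_0)
    then have nz: "A * (1 powr (- 1 / 2) * 1 powr (- \<mu>) * F (of_real 0) * ((1 - 2 * x\<^sup>2) * of_real 0 + 1) powr (\<mu> - 1 / 2)) \<noteq> 0"
      using A rGamma_nonzero[OF c] by simp
    show False by (rule not_integrable_at_infinity[OF int Lim_transform_eventually[OF lim ev] nz p])
  qed
  show "Re \<mu> > - 1 / 2"
  proof (rule ccontr)
    assume "\<not> Re \<mu> > - 1 / 2"
    then have p: "Re (\<mu> - 1 / 2) \<le> - 1" and m: "Re (- \<mu>) > 0" by simp_all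
    define a b where "a = (\<nu> - \<mu> + 1) / 2" "b = (\<nu> - \<mu> + 2) / 2"
    have abc: "a + b - (\<nu> + 3 / 2) = - \<mu>" by (simp add: a_b_def field_simps)
    define \<kappa> where "\<kappa> = Gamma (- \<mu>) * rGamma a * rGamma b"
    \<comment> \<open>A pole of Gamma at a or b would make \<nu> - \<mu> + 1, which equals 2 a and 2
      b - 1, a nonpositive integer.\<close>
    have "a \<notin> \<int>\<^sub>\<le>\<^sub>0"
    proof
      assume "a \<in> \<int>\<^sub>\<le>\<^sub>0"
      then obtain n where n: "a = - of_nat n" by (auto elim!: nonpos_Ints_cases')
      have "\<nu> - \<mu> + 1 = 2 * a" by (simp add: a_b_def)
      also have "\<dots> = - of_nat (2 * n)" by (simp add: n)
      finally show False using Q by (metis minus_of_nat_in_nonpos_Ints)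
    qed
    moreover have "b \<notin> \<int>\<^sub>\<le>\<^sub>0"
    proof
      assume "b \<in> \<int>\<^sub>\<le>\<^sub>0"
      then obtain n where n: "b = - of_nat n" by (auto elim!: nonpos_Ints_cases')
      have "\<nu> - \<mu> + 1 = 2 * b - 1" by (simp add: a_b_def)
      also have "\<dots> = - of_nat (2 * n + 1)" by (simp add: n)
      finally show False using Q by (metis minus_of_nat_in_nonpos_Ints)
    qed
    moreover have "- \<mu> \<notin> \<int>\<^sub>\<le>\<^sub>0" by (rule Re_pos_notin_nonpos_Ints[OF m])
    ultimately have \<kappa>: "\<kappa> \<noteq> 0" unfolding \<kappa>_def by (simp add: rGamma_nonzero Gamma_eq_zero_iff)
    have u: "filterlim (\<lambda>w::real. 1 / w\<^sup>2) (at_left 1) (at_right 1)" by real_asymp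
    have "((\<lambda>u. F (of_real u) * of_real (1 - u) powr (- \<mu>)) \<longlongrightarrow> \<kappa>) (at_left 1)"
      using hyp2F1_reg_at_1[OF c, of a b] m unfolding abc \<kappa>_def F_def a_b_def[symmetric] by simp
    then have Fl: "((\<lambda>w. F (of_real (1 / w\<^sup>2)) * of_real (1 - 1 / w\<^sup>2) powr (- \<mu>)) \<longlongrightarrow> \<kappa>) (at_right 1)"
      by (rule filterlim_compose[OF _ u])
    have two: "2 * (1 - x\<^sup>2) \<notin> \<real>\<^sub>\<le>\<^sub>0" using ferrers_domain_slits(6)[OF x] by (auto simp: complex_nonpos_Reals_iff)
    have lim: "((\<lambda>w. A * (of_real w powr (- (\<nu> + \<mu> + 1)) * (1 - 2 * x\<^sup>2 + of_real w) powr (\<mu> - 1 / 2) *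
        (F (of_real (1 / w\<^sup>2)) * of_real (1 - 1 / w\<^sup>2) powr (- \<mu>)))) \<longlongrightarrow>
        A * (of_real 1 powr (- (\<nu> + \<mu> + 1)) * (2 * (1 - x\<^sup>2)) powr (\<mu> - 1 / 2) * \<kappa>)) (at_right 1)"
    proof -
      have w: "((\<lambda>w. complex_of_real w) \<longlongrightarrow> of_real 1) (at_right 1)" by (intro tendsto_intros)
      have "((\<lambda>w. 1 - 2 * x\<^sup>2 + complex_of_real w) \<longlongrightarrow> 1 - 2 * x\<^sup>2 + of_real 1) (at_right 1)" by (intro tendsto_intros)
      then have v: "((\<lambda>w. 1 - 2 * x\<^sup>2 + complex_of_real w) \<longlongrightarrow> 2 * (1 - x\<^sup>2)) (at_right 1)" by (simp add: algebra_simps)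
      have one': "complex_of_real 1 \<notin> \<real>\<^sub>\<le>\<^sub>0" using one by simp
      show ?thesis
        by (intro tendsto_mult[OF _ Fl] tendsto_mult tendsto_const tendsto_powr_complex[OF one'] tendsto_powr_complex[OF two] w v Fl)
    qed
    have ev: "\<forall>\<^sub>F w in at_right 1. A * (of_real w powr (- (\<nu> + \<mu> + 1)) * (1 - 2 * x\<^sup>2 + of_real w) powr (\<mu> - 1 / 2) *
        (F (of_real (1 / w\<^sup>2)) * of_real (1 - 1 / w\<^sup>2) powr (- \<mu>))) = ?L w * of_real (w - 1) powr (- (\<mu> - 1 / 2))"
      using eventually_at_right_less[of 1]
    proof eventually_elim
      fix w :: real assume w: "1 < w"
      have e: "1 - 1 / w\<^sup>2 = (w - 1) * (w + 1) / (w * w)" using w by (simp add: field_simps power2_eq_square)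
      have pos: "w > 0" "w - 1 > 0" "w + 1 > 0" "(w - 1) * (w + 1) > 0" "w * w > 0" using w by auto
      have pos': "1 - 1 / w\<^sup>2 > 0" unfolding e using pos by (intro divide_pos_pos)
      have ln: "ln (1 - 1 / w\<^sup>2) = (ln (w - 1) + ln (w + 1)) - (ln w + ln w)"
        unfolding e ln_divide_pos[OF pos(4,5)] ln_mult_pos[OF pos(2,3)] ln_mult_pos[OF pos(1,1)] by simp
      have key: "complex_of_real w powr (- (\<nu> + \<mu> + 1)) * of_real (1 - 1 / w\<^sup>2) powr (- \<mu>) =
         of_real (w - 1) powr (- 1 / 2) * of_real (w + 1) powr (- \<mu>) * of_real w powr (- (\<nu> - \<mu> + 1)) * of_real (w - 1) powr (- (\<mu> - 1 / 2))"
        unfolding powr_of_real_eq_exp[OF pos(1)] powr_of_real_eq_exp[OF pos(2)] powr_of_real_eq_exp[OF pos(3)] powr_of_real_eq_exp[OF pos']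
        unfolding exp_add[symmetric] ln of_real_diff of_real_add
        by (intro arg_cong[where f = exp]) (simp add: field_simps)
      have alg: "A * (p * v * (f * r)) = A * (p * r) * v * f" for p v f r :: complex by (simp only: mult_ac)
      show "A * (of_real w powr (- (\<nu> + \<mu> + 1)) * (1 - 2 * x\<^sup>2 + of_real w) powr (\<mu> - 1 / 2) *
        (F (of_real (1 / w\<^sup>2)) * of_real (1 - 1 / w\<^sup>2) powr (- \<mu>))) = ?L w * of_real (w - 1) powr (- (\<mu> - 1 / 2))"
        unfolding L[OF w] alg key by (simp only: mult_ac)
    qed
    have "2 * (1 - x\<^sup>2) \<noteq> 0" using two by (rule contrapos_nn) (simp only: nonpos_Reals_zero_I)
    then have nz: "A * (of_real 1 powr (- (\<nu> + \<mu> + 1)) * (2 * (1 - x\<^sup>2)) powr (\<mu> - 1 / 2) * \<kappa>) \<noteq> 0"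
      using A \<kappa> by (simp only: mult_eq_0_iff powr_eq_0_iff of_real_1 one_neq_zero) simp
    show False by (rule not_integrable_at_right[OF int Lim_transform_eventually[OF lim ev] nz p])
  qed
qed

text \<open>The reciprocal Gamma function vanishes at 0, -1, -2, ..., so the first n coefficients
  are 0; shifting the index by n leaves the series on the right.\<close>

lemma hyp2F1_reg_nonpos_int:
  assumes u: "norm u < 1"
  shows "hyp2F1_reg a b (1 - of_nat n) u =
     pochhammer a n * pochhammer b n * u ^ n * hyp2F1_reg (a + of_nat n) (b + of_nat n) (1 + of_nat n) u"
proof -
  let ?f = "\<lambda>k. fps_nth (hyp_fps a b (1 - of_nat n)) k * u ^ k"
  let ?g = "\<lambda>k. fps_nth (hyp_fps (a + of_nat n) (b + of_nat n) (1 + of_nat n)) k * u ^ k"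
  have shift: "?f (k + n) = pochhammer a n * pochhammer b n * u ^ n * ?g k" for k
  proof -
    have g: "rGamma (1 - of_nat n + of_nat (k + n) :: complex) = 1 / fact k" "rGamma (1 + of_nat n + of_nat k :: complex) = 1 / fact (k + n)"
      using Gamma_fact[of k, where 'a = complex] Gamma_fact[of "k + n", where 'a = complex]
      by (simp_all add: rGamma_inverse_Gamma inverse_eq_divide add_ac)
    show ?thesis
      unfolding hyp_fps_nth g using pochhammer_product'[of a n k] pochhammer_product'[of b n k]
      by (simp add: add.commute[of k n] power_add mult_ac)
  qed
  have zero: "?f k = 0" if "k < n" for k
  proof -
    have "(1 - of_nat n + of_nat k :: complex) = - of_nat (n - 1 - k)" using that by (simp add: of_nat_diff)
    then have "rGamma (1 - of_nat n + of_nat k :: complex) = 0" by (metis rGamma_eq_zero_iff minus_of_nat_in_nonpos_Ints)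
    then show ?thesis by simp
  qed
  have "(\<lambda>k. ?f (k + n)) sums (pochhammer a n * pochhammer b n * u ^ n * hyp2F1_reg (a + of_nat n) (b + of_nat n) (1 + of_nat n) u)"
    unfolding shift by (intro sums_mult hyp2F1_reg_sums u)
  then have "?f sums (pochhammer a n * pochhammer b n * u ^ n * hyp2F1_reg (a + of_nat n) (b + of_nat n) (1 + of_nat n) u + (\<Sum>k<n. ?f k))"
    by (rule sums_iff_shift[where f = ?f and n = n, THEN iffD1])
  moreover have "(\<Sum>k<n. ?f k) = 0" by (intro sum.neutral ballI zero) simp
  ultimately show ?thesis using hyp2F1_reg_sums[OF u, of a b "1 - of_nat n"] by (auto dest: sums_unique2)
qed

text \<open>In the degenerate case, where \<open>\<nu> + 3/2\<close> is a pole of \<open>\<Gamma>\<close>, the degrees \<open>\<nu>\<close> and \<open>-1 - \<nu>\<close> give the same functions.\<close>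

lemma legendreQ_degenerate:
  assumes \<nu>: "\<nu> + 3 / 2 = 1 - of_nat n" and Q: "\<nu> - \<mu> + 1 \<notin> \<int>\<^sub>\<le>\<^sub>0"
  shows "legendreQ \<nu> (- \<mu>) = legendreQ (- 1 - \<nu>) (- \<mu>)"
proof -
  define a where "a = (\<nu> - \<mu> + 1) / 2"
  have \<nu>0: "\<nu> = 1 - of_nat n - 3 / 2" using \<nu> by (metis add_diff_cancel_right')
  have \<nu>': "- 1 - \<nu> = \<nu> + 2 * of_nat n"
  proof -
    have "- 1 - (1 - N - 3 / 2) = (1 - N - 3 / 2) + 2 * N" for N :: complex by (simp add: field_simps)
    then show ?thesis unfolding \<nu>0 .
  qed
  have e: "\<nu> + - \<mu> + 1 = 2 * a" "(\<nu> + - \<mu> + 2) / 2 = a + 1 / 2" "\<nu> + 2 * of_nat n + - \<mu> + 1 = 2 * a + of_nat (2 * n)"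
    "(\<nu> + 2 * of_nat n + - \<mu> + 2) / 2 = a + 1 / 2 + of_nat n" "(2 * a + of_nat (2 * n)) / 2 = a + of_nat n"
    "\<nu> + 2 * of_nat n + 3 / 2 = 1 + of_nat n" "\<nu> + 2 * of_nat n + 1 = (\<nu> + 1) + of_nat (2 * n)" "2 * a / 2 = a"
    using \<nu> by (simp_all add: a_def field_simps)
  have a: "2 * a \<notin> \<int>\<^sub>\<le>\<^sub>0" using Q e(1) by simp
  \<comment> \<open>The symbol \<open>pochhammer (2 * a) (2 * n)\<close> splits by the duplication
    formula into the two Pochhammer symbols that \<open>hyp2F1_reg_nonpos_int\<close> produces; 4^n
    is absorbed by the power of 2 in the denominator of Q.\<close>
  have G: "Gamma (2 * a + of_nat (2 * n)) = 4 ^ n * pochhammer a n * pochhammer (a + 1 / 2) n * Gamma (2 * a)"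
  proof -
    have "Gamma (2 * a) \<noteq> 0" using a by (simp add: Gamma_eq_zero_iff)
    then have "Gamma (2 * a + of_nat (2 * n)) = pochhammer (2 * a) (2 * n) * Gamma (2 * a)"
      using pochhammer_Gamma[OF a, of "2 * n"] by (simp add: field_simps)
    then show ?thesis by (simp add: pochhammer_double power_mult)
  qed
  have "of_real (sqrt pi) * exp (\<i> * of_real pi * - \<mu>) * Gamma (\<nu> + - \<mu> + 1) *
            ((z - 1) powr (- \<mu> / 2) * (z + 1) powr (- \<mu> / 2)) / (2 powr (\<nu> + 1) * z powr (\<nu> + - \<mu> + 1)) *
            hyp2F1_reg ((\<nu> + - \<mu> + 1) / 2) ((\<nu> + - \<mu> + 2) / 2) (\<nu> + 3 / 2) (1 / z\<^sup>2) =
        of_real (sqrt pi) * exp (\<i> * of_real pi * - \<mu>) * Gamma (- 1 - \<nu> + - \<mu> + 1) *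
            ((z - 1) powr (- \<mu> / 2) * (z + 1) powr (- \<mu> / 2)) / (2 powr (- 1 - \<nu> + 1) * z powr (- 1 - \<nu> + - \<mu> + 1)) *
            hyp2F1_reg ((- 1 - \<nu> + - \<mu> + 1) / 2) ((- 1 - \<nu> + - \<mu> + 2) / 2) (- 1 - \<nu> + 3 / 2) (1 / z\<^sup>2)"
    if z: "norm z > 1" for z
  proof -
    have z0: "z \<noteq> 0" using z by auto
    have "norm (1 / z\<^sup>2) < 1" using one_less_power[OF z, of 2] by (auto simp: norm_divide norm_power divide_less_eq)
    note F = hyp2F1_reg_nonpos_int[OF this, of a "a + 1 / 2" n]
    have zp: "z powr (2 * a + of_nat (2 * n)) = z powr (2 * a) * (z\<^sup>2) ^ n"
      unfolding powr_add using z0 by (subst powr_nat') (auto simp: power_mult)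
    have tp: "(2::complex) powr ((\<nu> + 1) + of_nat (2 * n)) = 2 powr (\<nu> + 1) * 4 ^ n"
      unfolding powr_add by (subst powr_nat') (auto simp: power_mult)
    show ?thesis unfolding \<nu>' e \<nu> F G zp tp using z0 by (simp add: power_divide field_simps)
  qed
  \<comment> \<open>Only the defining expressions on |z| > 1 have been compared; both functions are
    then the same choice from the same predicate, hence equal everywhere.\<close>
  then show ?thesis
    unfolding legendreQ_def analytic_continuation_def by (intro arg_cong[where f = Eps] ext) auto
qed

theorem theorem58:
  fixes \<nu> \<mu> x :: complex
  assumes x_domain: "x \<in> ferrers_domain"
    and Q_defined: "\<nu> - \<mu> + 1 \<notin> \<int>\<^sub>\<le>\<^sub>0"
    and converges: "legendre_integrand \<nu> \<mu> x integrable_on {1<..}"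
  shows "(ferrersQ \<nu> (- \<mu>) x)\<^sup>2 + of_real (pi\<^sup>2 / 4) * (ferrersP \<nu> (- \<mu>) x)\<^sup>2 =
         of_real (sqrt pi) * exp (\<i> * of_real pi * \<mu>) /
           (2 powr \<mu> * Gamma (\<mu> + 1 / 2) * (1 - x\<^sup>2) powr \<mu>) *
         integral {1<..} (legendre_integrand \<nu> \<mu> x)"
proof (cases "\<nu> + 3 / 2 \<in> \<int>\<^sub>\<le>\<^sub>0")
  case False
  note r = legendre_integrand_integrable_imp[OF x_domain Q_defined False converges]
  show ?thesis by (rule sum_of_squares_eq_integral[OF r(2) r(1) x_domain])
next
  case True
  then obtain k where k: "\<nu> + 3 / 2 = - of_nat k" by (auto elim!: nonpos_Ints_cases')
  \<comment> \<open>The shift to n = k + 1 gives the form 1 - n in which the leading n coefficients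
    of the series vanish.\<close>
  then have \<nu>: "\<nu> + 3 / 2 = 1 - of_nat (k + 1)" by simp
  define \<nu>' where "\<nu>' = - 1 - \<nu>"
  have \<nu>': "\<nu>' = \<nu> + of_nat (2 * (k + 1))"
  proof -
    have "\<nu> = - of_nat k - 3 / 2" by (simp only: k eq_diff_eq)
    then show ?thesis by (simp add: \<nu>'_def)
  qed
  note Qe = legendreQ_degenerate[OF \<nu> Q_defined, folded \<nu>'_def]
  \<comment> \<open>Besides \<mu> and x, P depends only on the unordered pair - \<nu>, \<nu> + 1,
    which \<nu> \<mapsto> -1 - \<nu> leaves unchanged.\<close>
  have P: "ferrersP \<nu> (- \<mu>) x = ferrersP \<nu>' (- \<mu>) x"
    unfolding ferrersP_def \<nu>'_def using hyp2F1_reg_commute[OF ferrers_domain_slits(3)[OF x_domain], of "- \<nu>" "\<nu> + 1"]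
    by (simp add: add.commute)
  have Q: "ferrersQ \<nu> (- \<mu>) = ferrersQ \<nu>' (- \<mu>)" unfolding ferrersQ_def Qe ..
  have I: "legendre_integrand \<nu> \<mu> x = legendre_integrand \<nu>' \<mu> x" unfolding legendre_integrand_def[abs_def] Qe ..
  \<comment> \<open>\<nu>' exceeds \<nu> by the natural number 2 (k + 1), so a pole for \<nu>' would
    be one for \<nu>.\<close>
  have "\<nu>' - \<mu> + 1 \<notin> \<int>\<^sub>\<le>\<^sub>0"
  proof
    assume "\<nu>' - \<mu> + 1 \<in> \<int>\<^sub>\<le>\<^sub>0"
    then obtain n where "\<nu>' - \<mu> + 1 = - of_nat n" by (auto elim!: nonpos_Ints_cases')
    then have "\<nu> - \<mu> + 1 = - of_nat (n + 2 * (k + 1))" unfolding \<nu>' by (simp add: algebra_simps)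
    then show False using Q_defined by (metis minus_of_nat_in_nonpos_Ints)
  qed
  moreover have "\<nu>' + 3 / 2 \<notin> \<int>\<^sub>\<le>\<^sub>0"
  proof (rule Re_pos_notin_nonpos_Ints)
    have "\<nu> = - of_nat k - 3 / 2" by (simp only: k eq_diff_eq)
    then have "\<nu>' + 3 / 2 = of_nat (k + 2)" by (simp add: \<nu>'_def)
    then show "Re (\<nu>' + 3 / 2) > 0" by simp
  qed
  ultimately have r: "Re (\<nu>' - \<mu>) > - 1" "Re \<mu> > - 1 / 2"
    using legendre_integrand_integrable_imp[OF x_domain] converges unfolding I by blast+
  show ?thesis unfolding P Q I by (rule sum_of_squares_eq_integral[OF r(2) r(1) x_domain])
qed

end
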